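(* Let $n\in\{2,3,4\}$ and let the tensor $\mathbb A$ satisfy the relaxed ellipticity condition with constant $C_{\mathbb A}>0$. Let $\mathbf f\in\dot{\mathbf H}_\#^{-1}$ and $$\|\mathbf f\|_{\dot{\mathbf H}_\#^{-1}}<\frac{\pi^3}{\sqrt2}\,C_{\mathbb A}^{-2}\,C_{4\#}^{-2},$$ where $C_{4\#}>0$ is the constant from the Sobolev embedding inequality $\|\mathbf v\|_{\mathbf L_{4\#}}\le C_{4\#}\|\mathbf v\|_{\mathbf H^1_\#}$ for all $\mathbf v\in\mathbf H^1_\#$. Then the anisotropic Navier-Stokes equation $$-\boldsymbol{\mathfrak L}\mathbf u+\nabla p+(\mathbf u\cdot\nabla)\mathbf u=\mathbf f$$ has a unique solution $(\mathbf u,p)\in\dot{\mathbf H}_{\#\sigma}^1\times\dot H_\#^0$.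
   Context: Repeated indices are summed from $1$ to $n$; $\partial_j=\partial/\partial x_j$. All functions and distributions are real-valued. $\mathbb A=(a_{kj}^{\alpha\beta})_{1\le k,j,\alpha,\beta\le n}$ is a tensor of real constants with the symmetry $a_{kj}^{\alpha\beta}=a_{\alpha j}^{k\beta}=a_{k\beta}^{\alpha j}$ (standing assumption). Relaxed ellipticity condition: there is a constant $C_{\mathbb A}>0$ such that $C_{\mathbb A}a_{kj}^{\alpha\beta}\zeta_{k\alpha}\zeta_{j\beta}\ge|\boldsymbol\zeta|^2:=\zeta_{k\alpha}\zeta_{k\alpha}$ for all $\boldsymbol\zeta\in\mathbb R^{n\times n}$ with $\boldsymbol\zeta=\boldsymbol\zeta^\top$ and $\sum_k\zeta_{kk}=0$. $(\boldsymbol{\mathfrak L}\mathbf u)_k:=\partial_\alpha(a_{kj}^{\alpha\beta}E_{j\beta}(\mathbf u))=\partial_\alpha(a_{kj}^{\alpha\beta}\partial_\beta u_j)$ with $E_{j\beta}(\mathbf u)=\frac12(\partial_ju_\beta+\partial_\beta u_j)$. $((\mathbf u\cdot\nabla)\mathbf u)_k=u_j\partial_ju_k$. $\mathbb T=[0,1)^n$ is the flat torus; functions/distributions on it are identified with $1$-periodic ones on $\mathbb R^n$. Fourier coefficients: $\hat g(\boldsymbol\xi)=\int_{\mathbb T}e^{-2\pi i\mathbf x\cdot\boldsymbol\xi}g(\mathbf x)d\mathbf x$, $\boldsymbol\xi\in\mathbb Z^n$, extended to periodic distributions. $H^s_\#$ is the space of periodic distributions with finite norm $\|g\|_{H^s_\#}=\big(\sum_{\boldsymbol\xi\in\mathbb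 Z^n}(1+|\boldsymbol\xi|^2)^s|\hat g(\boldsymbol\xi)|^2\big)^{1/2}$; $\dot H^s_\#=\{g\in H^s_\#:\hat g(\mathbf 0)=0\}$ with the same norm. $L_{4\#}$ is the space of $1$-periodic functions with the norm of $L_4(\mathbb T)$. Bold symbols denote $n$-component vector versions (with the Euclidean norm of vectors $|\mathbf v(\mathbf x)|$, $|\widehat{\mathbf v}(\boldsymbol\xi)|$ in the definitions of norms); $\dot{\mathbf H}^s_{\#\sigma}=\{\mathbf w\in\dot{\mathbf H}^s_\#:\mathrm{div}\,\mathbf w=0\}$. Equations are understood in the sense of (periodic) distributions. *)

theory Defs
  imports "HOL-Analysis.Analysis"
begin

section \<open>Periodic distributions\<close>

definition periodic :: "(real^'n \<Rightarrow> 'b) \<Rightarrow> bool" where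
  "periodic f \<longleftrightarrow> (\<forall>i x. f (x + axis i 1) = f x)"

definition partial :: "'n \<Rightarrow> (real^'n \<Rightarrow> real) \<Rightarrow> real^'n \<Rightarrow> real" where
  "partial j \<phi> x = frechet_derivative \<phi> (at x) (axis j 1)"

definition partials :: "'n list \<Rightarrow> (real^'n \<Rightarrow> real) \<Rightarrow> real^'n \<Rightarrow> real" where
  "partials js \<phi> = foldr partial js \<phi>"

text \<open>Differentiability of every iterated partial derivative includes continuity of all of them,
  so the following is the space of \<open>C\<^sup>\<infinity>\<close> periodic functions.\<close>

definition test_fun :: "(real^'n \<Rightarrow> real) set" where
  "test_fun = {\<phi>. periodic \<phi> \<and> (\<forall>js x. partials js \<phi> differentiable (at x))}"

type_synonym 'n distr = "(real^'n \<Rightarrow> real) \<Rightarrow> real"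

text \<open>Real periodic distributions: linear functionals on the test functions, continuous with
  respect to the \<open>C\<^sup>N\<close> norms; \<open>M\<close> ranges over the upper bounds of the \<open>C\<^sup>N\<close> norm of \<open>\<phi>\<close>.
  They are extensional, so that equality of distributions is equality in HOL.\<close>

definition pdistr :: "'n::finite distr set" where
  "pdistr = {g \<in> extensional test_fun.
     (\<forall>\<phi>\<in>test_fun. \<forall>\<psi>\<in>test_fun. g (\<lambda>x. \<phi> x + \<psi> x) = g \<phi> + g \<psi>) \<and>
     (\<forall>c. \<forall>\<phi>\<in>test_fun. g (\<lambda>x. c * \<phi> x) = c * g \<phi>) \<and>
     (\<exists>C N. \<forall>\<phi>\<in>test_fun. \<forall>M. (\<forall>js x. length js \<le> N \<longrightarrow> \<bar>partials js \<phi> x\<bar> \<le> M)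
        \<longrightarrow> \<bar>g \<phi>\<bar> \<le> C * M)}"

definition ddiff :: "'n::finite \<Rightarrow> 'n distr \<Rightarrow> 'n distr" where
  "ddiff j g = (\<lambda>\<phi>\<in>test_fun. - g (partial j \<phi>))"

definition div_distr :: "'n::finite distr^'n \<Rightarrow> 'n distr" where
  "div_distr w = (\<lambda>\<phi>\<in>test_fun. \<Sum>j\<in>UNIV. ddiff j (w $ j) \<phi>)"


section \<open>Distributions given by functions\<close>

definition torus_cell :: "(real^'n) set" where
  "torus_cell = {x. \<forall>i. 0 \<le> x $ i \<and> x $ i < 1}"

definition L1_per :: "(real^'n \<Rightarrow> real) set" where
  "L1_per = {g. periodic g \<and> g \<in> borel_measurable borel \<and> set_integrable lborel torus_cell g}"

definition regular :: "(real^'n \<Rightarrow> real) \<Rightarrow> 'n distr" where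
  "regular g = (\<lambda>\<phi>\<in>test_fun. LINT x:torus_cell|lborel. g x * \<phi> x)"

text \<open>The function with which a distribution is identified; it is determined up to a null set
  if it exists, and it is arbitrary otherwise.\<close>

definition fun_of :: "'n::finite distr \<Rightarrow> real^'n \<Rightarrow> real" where
  "fun_of g = (SOME h. h \<in> L1_per \<and> regular h = g)"

definition L4_per :: "(real^'n \<Rightarrow> real^'n) set" where
  "L4_per = {h. periodic h \<and> h \<in> borel_measurable borel \<and>
     set_integrable lborel torus_cell (\<lambda>x. norm (h x) ^ 4)}"

definition L4_norm :: "(real^'n \<Rightarrow> real^'n) \<Rightarrow> real" where
  "L4_norm h = root 4 (LINT x:torus_cell|lborel. norm (h x) ^ 4)"


section \<open>Periodic Sobolev spaces\<close>

definition freq :: "int^'n \<Rightarrow> real^'n" where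
  "freq \<xi> = (\<chi> i. of_int (\<xi> $ i))"

text \<open>The pairing of the real distribution \<open>g\<close> with \<open>exp (- 2 \<pi> \<i> x \<bullet> \<xi>)\<close>, split into real and
  imaginary part.\<close>

definition fourier :: "'n::finite distr \<Rightarrow> int^'n \<Rightarrow> complex" where
  "fourier g \<xi> = Complex (g (\<lambda>x. cos (2 * pi * (x \<bullet> freq \<xi>)))) (- g (\<lambda>x. sin (2 * pi * (x \<bullet> freq \<xi>))))"

definition sobolev_term :: "real \<Rightarrow> 'n::finite distr \<Rightarrow> int^'n \<Rightarrow> real" where
  "sobolev_term s g \<xi> = (1 + (norm (freq \<xi>))\<^sup>2) powr s * (cmod (fourier g \<xi>))\<^sup>2"

definition H_per :: "real \<Rightarrow> 'n::finite distr set" where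
  "H_per s = {g \<in> pdistr. sobolev_term s g summable_on UNIV}"

definition H_dot :: "real \<Rightarrow> 'n::finite distr set" where
  "H_dot s = {g \<in> H_per s. fourier g 0 = 0}"

definition sobolev_term_vec :: "real \<Rightarrow> 'n::finite distr^'n \<Rightarrow> int^'n \<Rightarrow> real" where
  "sobolev_term_vec s v \<xi> =
     (1 + (norm (freq \<xi>))\<^sup>2) powr s * (\<Sum>k\<in>UNIV. (cmod (fourier (v $ k) \<xi>))\<^sup>2)"

definition H_vec :: "real \<Rightarrow> ('n::finite distr^'n) set" where
  "H_vec s = {v. (\<forall>k. v $ k \<in> pdistr) \<and> sobolev_term_vec s v summable_on UNIV}"

definition H_vec_norm :: "real \<Rightarrow> 'n::finite distr^'n \<Rightarrow> real" where
  "H_vec_norm s v = sqrt (\<Sum>\<^sub>\<infinity>\<xi>. sobolev_term_vec s v \<xi>)"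

definition H_vec_dot :: "real \<Rightarrow> ('n::finite distr^'n) set" where
  "H_vec_dot s = {v \<in> H_vec s. \<forall>k. fourier (v $ k) 0 = 0}"

definition H_vec_dot_sigma :: "real \<Rightarrow> ('n::finite distr^'n) set" where
  "H_vec_dot_sigma s = {w \<in> H_vec_dot s. div_distr w = (\<lambda>\<phi>\<in>test_fun. 0)}"


section \<open>The anisotropic Navier-Stokes equation\<close>

text \<open>Throughout, \<open>a k j \<alpha> \<beta>\<close> is the tensor component with lower indices \<open>k j\<close> and upper
  indices \<open>\<alpha> \<beta>\<close>.\<close>

type_synonym 'n tensor = "'n \<Rightarrow> 'n \<Rightarrow> 'n \<Rightarrow> 'n \<Rightarrow> real"

definition symmetric_tensor :: "'n tensor \<Rightarrow> bool" where
  "symmetric_tensor a \<longleftrightarrow>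
     (\<forall>k j \<alpha> \<beta>. a k j \<alpha> \<beta> = a \<alpha> j k \<beta> \<and> a k j \<alpha> \<beta> = a k \<beta> \<alpha> j)"

definition relaxed_elliptic :: "'n::finite tensor \<Rightarrow> real \<Rightarrow> bool" where
  "relaxed_elliptic a C \<longleftrightarrow>
     (\<forall>\<zeta> :: real^'n^'n. \<zeta> = transpose \<zeta> \<and> trace \<zeta> = 0 \<longrightarrow>
        C * (\<Sum>k\<in>UNIV. \<Sum>j\<in>UNIV. \<Sum>\<alpha>\<in>UNIV. \<Sum>\<beta>\<in>UNIV. a k j \<alpha> \<beta> * \<zeta> $ k $ \<alpha> * \<zeta> $ j $ \<beta>)
          \<ge> (\<Sum>k\<in>UNIV. \<Sum>\<alpha>\<in>UNIV. \<zeta> $ k $ \<alpha> * \<zeta> $ k $ \<alpha>))"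

definition strain :: "'n::finite distr^'n \<Rightarrow> 'n \<Rightarrow> 'n \<Rightarrow> 'n distr" where
  "strain u j \<beta> = (\<lambda>\<phi>\<in>test_fun. 1/2 * (ddiff j (u $ \<beta>) \<phi> + ddiff \<beta> (u $ j) \<phi>))"

definition stress :: "'n::finite tensor \<Rightarrow> 'n distr^'n \<Rightarrow> 'n \<Rightarrow> 'n \<Rightarrow> 'n distr" where
  "stress a u k \<alpha> = (\<lambda>\<phi>\<in>test_fun. \<Sum>j\<in>UNIV. \<Sum>\<beta>\<in>UNIV. a k j \<alpha> \<beta> * strain u j \<beta> \<phi>)"

definition stokes_op :: "'n::finite tensor \<Rightarrow> 'n distr^'n \<Rightarrow> 'n distr^'n" where
  "stokes_op a u = (\<chi> k. (\<lambda>\<phi>\<in>test_fun. \<Sum>\<alpha>\<in>UNIV. ddiff \<alpha> (stress a u k \<alpha>) \<phi>))"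

text \<open>For \<open>u \<in> H_vec 1\<close> both \<open>u\<^sub>j\<close> and \<open>\<partial>\<^sub>j u\<^sub>k\<close> are square integrable functions on the cell, so
  their pointwise product is integrable and gives a distribution.\<close>

definition convection :: "'n::finite distr^'n \<Rightarrow> 'n distr^'n" where
  "convection u =
     (\<chi> k. regular (\<lambda>x. \<Sum>j\<in>UNIV. fun_of (u $ j) x * fun_of (ddiff j (u $ k)) x))"

definition navier_stokes ::
    "'n::finite tensor \<Rightarrow> 'n distr^'n \<Rightarrow> 'n distr^'n \<Rightarrow> 'n distr \<Rightarrow> bool" where
  "navier_stokes a f u p \<longleftrightarrow>
     (\<forall>k. \<forall>\<phi>\<in>test_fun.
        - (stokes_op a u $ k) \<phi> + ddiff k p \<phi> + (convection u $ k) \<phi> = (f $ k) \<phi>)"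

text \<open>\<open>C\<close> is an admissible constant in the embedding of \<open>H_vec 1\<close> into \<open>L4_per\<close>; the type
  argument fixes the dimension.\<close>

definition sobolev_L4_const :: "'n::finite itself \<Rightarrow> real \<Rightarrow> bool" where
  "sobolev_L4_const _ C \<longleftrightarrow>
     (\<forall>v \<in> (H_vec 1 :: ('n distr^'n) set). \<exists>h \<in> L4_per.
        (\<forall>k. regular (\<lambda>x. h x $ k) = v $ k) \<and> L4_norm h \<le> C * H_vec_norm 1 v)"

end

(*
The functions cas xi x = cos (2 pi x.xi) + sin (2 pi x.xi), xi in Z^n, form a real orthonormal basis of
L2 of the torus (the Hartley basis), and the derivative of cas xi in direction j is 2 pi xi_j cas (-xi).
A periodic distribution is determined by its values on this basis, so divergence-free fields in H^1 form
a closed subspace of a real l2 space, and the equation becomes a family of equations indexed by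
the frequency. At each frequency the pressure gradient is parallel to xi: it disappears from the weak
form on divergence-free fields, and is recovered from the residual of a weak solution.

Let A(u,w) be the bilinear form of the Stokes operator, b(v,u,w) the integral of ((v.grad)u).w. For div v = 0 it vanishes when u = w, so for given
v the Lax-Milgram lemma yields the solution u = T v of the linear problem A(u,w) + b(v,u,w) = <f,w>. The
symmetrized gradient of a divergence-free field satisfies |E(u)|^2 = |grad u|^2 / 2, and
|grad u|^2 >= 2 pi^2 |u|^2 in H^1 since |xi| >= 1; hence A(u,u) >= |grad u|^2 / (2 C_A) >= pi^2/C_A |u|^2 and
|grad T v| <= sqrt 2 C_A / pi |f|. For w = T v1 - T v2 one has A(w,w) = - b(v1 - v2, T v2, w), so T is
Lipschitz with constant sqrt 2 C_A^2 C4^2 |f| / pi^3, which is less than 1 exactly under the smallness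
assumption. Its fixed points are the weak solutions.
*)
theory Submission
  imports Defs
begin

section \<open>Square summable families\<close>

text \<open>Each real field or functional becomes one real square summable family: a velocity in H^1
  by its Hartley coefficients times sqrt(1 + |xi|^2), the force in H^(-1) by its coefficients
  divided by that root. Both maps preserve norms, the pairing of f with w becomes the inner product
  of l2, and the constants of the smallness condition survive unchanged. Unlike exponentials,
  Hartley functions impose no conjugation constraint on the coefficients; the price is that a
  derivative exchanges xi and -xi. The obstacle is convection: it is a product of functions, not a
  multiplier, while a distribution determines its function only almost everywhere. Velocities obtain
  a function from the assumed L4 embedding, gradients from the Riesz-Fischer theorem, and
  completeness of the basis among integrable functions makes the integral independent of both
  choices. Completeness is used once more for smooth functions: it identifies the uniform limit of
  the Hartley series of a test function with that function, and this density is what lets a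
  distribution be read off from its coefficients.\<close>

typedef 'i ell2 = "{f :: 'i \<Rightarrow> real. (\<lambda>i. (f i)\<^sup>2) summable_on UNIV}"
  morphisms coef Abs_ell2
  by (rule exI[of _ "\<lambda>_. 0"]) simp

setup_lifting type_definition_ell2

lemma summable_on_square_finite_sums:
  fixes f :: "'i \<Rightarrow> real"
  assumes "\<And>F. finite F \<Longrightarrow> (\<Sum>i\<in>F. (f i)\<^sup>2) \<le> B"
  shows "(\<lambda>i. (f i)\<^sup>2) summable_on UNIV"
  by (rule nonneg_bdd_above_summable_on) (use assms in \<open>auto simp: bdd_above_def\<close>)

lemma summable_on_mult_squares:
  fixes f g :: "'i \<Rightarrow> real"
  assumes "(\<lambda>i. (f i)\<^sup>2) summable_on A" "(\<lambda>i. (g i)\<^sup>2) summable_on A"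
  shows "(\<lambda>i. f i * g i) summable_on A"
proof (rule abs_summable_summable, rule summable_on_comparison_test)
  show "(\<lambda>i. (f i)\<^sup>2 + (g i)\<^sup>2) summable_on A"
    by (intro summable_on_add assms)
  fix i
  have "0 \<le> (\<bar>f i\<bar> - \<bar>g i\<bar>)\<^sup>2" by simp
  also have "\<dots> = (f i)\<^sup>2 + (g i)\<^sup>2 - 2 * (\<bar>f i\<bar> * \<bar>g i\<bar>)"
    by (simp add: power2_diff)
  finally have "2 * (\<bar>f i\<bar> * \<bar>g i\<bar>) \<le> (f i)\<^sup>2 + (g i)\<^sup>2" by simp
  moreover have "0 \<le> \<bar>f i\<bar> * \<bar>g i\<bar>" by simp
  ultimately show "norm (f i * g i) \<le> (f i)\<^sup>2 + (g i)\<^sup>2"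
    unfolding real_norm_def abs_mult by linarith
qed simp

lemma summable_on_add_squares:
  fixes f g :: "'i \<Rightarrow> real"
  assumes "(\<lambda>i. (f i)\<^sup>2) summable_on A" "(\<lambda>i. (g i)\<^sup>2) summable_on A"
  shows "(\<lambda>i. (f i + g i)\<^sup>2) summable_on A"
proof -
  have "(\<lambda>i. (f i)\<^sup>2 + (g i)\<^sup>2 + 2 * (f i * g i)) summable_on A"
    by (intro summable_on_add assms summable_on_cmult_right summable_on_mult_squares)
  then show ?thesis by (simp add: power2_sum mult.assoc)
qed

instantiation ell2 :: (type) real_vector
begin
lift_definition zero_ell2 :: "'a ell2" is "\<lambda>_. 0" by simp
lift_definition plus_ell2 :: "'a ell2 \<Rightarrow> 'a ell2 \<Rightarrow> 'a ell2" is "\<lambda>f g i. f i + g i"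
  by (rule summable_on_add_squares)
lift_definition uminus_ell2 :: "'a ell2 \<Rightarrow> 'a ell2" is "\<lambda>f i. - f i" by simp
lift_definition minus_ell2 :: "'a ell2 \<Rightarrow> 'a ell2 \<Rightarrow> 'a ell2" is "\<lambda>f g i. f i - g i"
  using summable_on_add_squares[of _ _ "\<lambda>i. - _ i"] by fastforce
lift_definition scaleR_ell2 :: "real \<Rightarrow> 'a ell2 \<Rightarrow> 'a ell2" is "\<lambda>c f i. c * f i"
  by (simp add: power_mult_distrib summable_on_cmult_right)
instance
  by standard (transfer; auto simp: fun_eq_iff algebra_simps)+
end

instantiation ell2 :: (type) real_inner
begin
definition inner_ell2 :: "'a ell2 \<Rightarrow> 'a ell2 \<Rightarrow> real" where
  "inner_ell2 x y = (\<Sum>\<^sub>\<infinity>i. coef x i * coef y i)"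
definition norm_ell2 :: "'a ell2 \<Rightarrow> real" where "norm_ell2 x = sqrt (x \<bullet> x)"
definition dist_ell2 :: "'a ell2 \<Rightarrow> 'a ell2 \<Rightarrow> real" where "dist_ell2 x y = norm (x - y)"
definition sgn_ell2 :: "'a ell2 \<Rightarrow> 'a ell2" where "sgn_ell2 x = x /\<^sub>R norm x"
definition uniformity_ell2 :: "('a ell2 \<times> 'a ell2) filter" where
  "uniformity_ell2 = (INF e\<in>{0<..}. principal {(x, y). dist x y < e})"
definition open_ell2 :: "'a ell2 set \<Rightarrow> bool" where
  "open_ell2 U = (\<forall>x\<in>U. \<forall>\<^sub>F (x', y) in uniformity. x' = x \<longrightarrow> y \<in> U)"
instance
proof
  fix x y z :: "'a ell2" and r :: real
  have sm: "(\<lambda>i. coef x i * coef y i) summable_on UNIV" for x y :: "'a ell2"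
    using coef[of x] coef[of y] by (intro summable_on_mult_squares) auto
  show "dist x y = norm (x - y)" by (rule dist_ell2_def)
  show "sgn x = x /\<^sub>R norm x" by (rule sgn_ell2_def)
  show "(uniformity :: ('a ell2 \<times> 'a ell2) filter) = (INF e\<in>{0<..}. principal {(x, y). dist x y < e})"
    by (rule uniformity_ell2_def)
  show "open U = (\<forall>x\<in>U. \<forall>\<^sub>F (x', y) in uniformity. x' = x \<longrightarrow> y \<in> U)" for U :: "'a ell2 set"
    by (rule open_ell2_def)
  show "x \<bullet> y = y \<bullet> x" by (simp add: inner_ell2_def mult.commute)
  show "(x + y) \<bullet> z = x \<bullet> z + y \<bullet> z"
    unfolding inner_ell2_def plus_ell2.rep_eq distrib_right by (rule infsum_add[OF sm sm])
  show "(r *\<^sub>R x) \<bullet> y = r * (x \<bullet> y)"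
    unfolding inner_ell2_def scaleR_ell2.rep_eq mult.assoc by (rule infsum_cmult_right) (rule sm)
  show "0 \<le> x \<bullet> x" unfolding inner_ell2_def by (rule infsum_nonneg) simp
  show "norm x = sqrt (x \<bullet> x)" by (rule norm_ell2_def)
  show "(x \<bullet> x = 0) = (x = 0)"
  proof
    assume "x \<bullet> x = 0"
    then have "coef x i * coef x i = 0" for i
      using nonneg_infsum_le_0D[of "\<lambda>i. coef x i * coef x i" UNIV i] sm[of x x]
      by (simp add: inner_ell2_def)
    then show "x = 0" by (simp add: coef_inject[symmetric] zero_ell2.rep_eq fun_eq_iff)
  qed (simp add: inner_ell2_def zero_ell2.rep_eq)
qed
end

lemma coef_simps [simp]:
  "coef 0 i = 0" "coef (x + y) i = coef x i + coef y i" "coef (x - y) i = coef x i - coef y i"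
  "coef (- x) i = - coef x i" "coef (c *\<^sub>R x) i = c * coef x i"
  by (simp_all add: zero_ell2.rep_eq plus_ell2.rep_eq minus_ell2.rep_eq uminus_ell2.rep_eq
      scaleR_ell2.rep_eq)

lemma ell2_eqI: "(\<And>i. coef x i = coef y i) \<Longrightarrow> x = y"
  by (simp add: coef_inject[symmetric] fun_eq_iff)

lemma summable_coef_square: "(\<lambda>i. (coef x i)\<^sup>2) summable_on UNIV"
  using coef[of x] by simp

lemma has_sum_inner_ell2: "((\<lambda>i. coef x i * coef y i) has_sum (x \<bullet> y)) UNIV"
  unfolding inner_ell2_def
  by (intro has_sum_infsum summable_on_mult_squares summable_coef_square)

lemma has_sum_norm_ell2: "((\<lambda>i. (coef x i)\<^sup>2) has_sum (norm x)\<^sup>2) UNIV"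
  using has_sum_inner_ell2[of x x] unfolding power2_norm_eq_inner by (simp add: power2_eq_square)

lemma finite_sum_le_norm_ell2: "finite F \<Longrightarrow> (\<Sum>i\<in>F. (coef x i)\<^sup>2) \<le> (norm x)\<^sup>2"
  using has_sum_norm_ell2[of x] by (auto intro!: has_sum_mono_neutral[OF has_sum_finite])

lemma coef_le_norm: "\<bar>coef x i\<bar> \<le> norm x"
proof -
  have "(coef x i)\<^sup>2 \<le> (norm x)\<^sup>2" using finite_sum_le_norm_ell2[of "{i}" x] by simp
  then show ?thesis by (simp add: abs_le_square_iff[symmetric])
qed

lemma norm_ell2_le:
  assumes "0 \<le> B" "\<And>F. finite F \<Longrightarrow> (\<Sum>i\<in>F. (coef x i)\<^sup>2) \<le> B\<^sup>2"
  shows "norm x \<le> B"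
proof -
  have "(norm x)\<^sup>2 \<le> B\<^sup>2"
    by (rule has_sum_le_finite_sums[OF has_sum_norm_ell2]) (rule assms(2))
  then show ?thesis using assms(1) by (rule power2_le_imp_le)
qed

lemma bounded_linear_coef: "bounded_linear (\<lambda>x. coef x i)"
  proof (rule bounded_linear_intro[where K = 1])
  show "norm (coef x i) \<le> norm x * 1" for x
    using coef_le_norm[of x i] by (simp only: real_norm_def mult_1_right)
qed simp_all

lemma coef_sum: "coef (\<Sum>i\<in>F. x i) l = (\<Sum>i\<in>F. coef (x i) l)"
  by (induction F rule: infinite_finite_induct) auto

text \<open>A Cauchy sequence converges in every coefficient. The Cauchy bound on finite partial
  sums of squares passes to this pointwise limit, which gives both the square summability of the
  limit and the convergence in norm.\<close>

instance ell2 :: (type) complete_space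
proof
  fix X :: "nat \<Rightarrow> 'a ell2" assume X: "Cauchy X"
  have "Cauchy (\<lambda>n. coef (X n) i)" for i
    using bounded_linear.Cauchy[OF bounded_linear_coef X] .
  then have "\<exists>l. (\<lambda>n. coef (X n) i) \<longlonglongrightarrow> l" for i
    by (simp add: Cauchy_convergent_iff convergent_def)
  then obtain y where y: "\<And>i. (\<lambda>n. coef (X n) i) \<longlonglongrightarrow> y i" by metis
  have est: "(\<Sum>i\<in>F. (coef (X m) i - y i)\<^sup>2) \<le> e\<^sup>2"
    if N: "\<And>n. n \<ge> N \<Longrightarrow> norm (X m - X n) \<le> e" and F: "finite F" for F m N e
  proof (rule LIMSEQ_le_const2)
    show "(\<lambda>n. \<Sum>i\<in>F. (coef (X m) i - coef (X n) i)\<^sup>2) \<longlonglongrightarrow> (\<Sum>i\<in>F. (coef (X m) i - y i)\<^sup>2)"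
      by (intro tendsto_intros y)
    have "(\<Sum>i\<in>F. (coef (X m) i - coef (X n) i)\<^sup>2) \<le> e\<^sup>2" if "n \<ge> N" for n
      using finite_sum_le_norm_ell2[OF F, of "X m - X n"] power_mono[OF N[OF that], of 2] by simp
    then show "\<exists>N. \<forall>n\<ge>N. (\<Sum>i\<in>F. (coef (X m) i - coef (X n) i)\<^sup>2) \<le> e\<^sup>2" by blast
  qed
  have cau: "\<exists>N. \<forall>m\<ge>N. \<forall>n\<ge>N. norm (X m - X n) \<le> e" if "e > 0" for e
    using X that unfolding Cauchy_def dist_norm by (meson less_imp_le)
  obtain N where N: "\<And>m n. m \<ge> N \<Longrightarrow> n \<ge> N \<Longrightarrow> norm (X m - X n) \<le> 1"
    using cau[of 1] by auto
  have "(\<lambda>i. (coef (X N) i - y i)\<^sup>2) summable_on UNIV"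
    by (rule summable_on_square_finite_sums, rule est) (use N in auto)
  \<comment> \<open>The limit family is a member of the sequence minus a difference that
    \<open>est\<close> has just bounded, so it is square summable.\<close>
  then have "(\<lambda>i. (coef (X N) i + - (coef (X N) i - y i))\<^sup>2) summable_on UNIV"
    by (intro summable_on_add_squares summable_coef_square) (simp add: power2_commute)
  then have "(\<lambda>i. (y i)\<^sup>2) summable_on UNIV" by simp
  then have Y: "coef (Abs_ell2 y) = y" by (simp add: Abs_ell2_inverse)
  have "X \<longlonglongrightarrow> Abs_ell2 y"
  proof (rule metric_LIMSEQ_I)
    fix r :: real assume "r > 0"
    then obtain N where N: "\<And>m n. m \<ge> N \<Longrightarrow> n \<ge> N \<Longrightarrow> norm (X m - X n) \<le> r / 2"
      using cau[of "r / 2"] by auto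
    have "norm (X m - Abs_ell2 y) \<le> r / 2" if "m \<ge> N" for m
      by (rule norm_ell2_le) (use \<open>r > 0\<close> est[of N m "r/2"] N that in \<open>auto simp: Y\<close>)
    then show "\<exists>N. \<forall>n\<ge>N. dist (X n) (Abs_ell2 y) < r"
      using \<open>r > 0\<close> unfolding dist_norm by (intro exI[of _ N]) force
  qed
  then show "convergent X" by (rule convergentI)
qed

definition ell2_unit :: "'i \<Rightarrow> 'i ell2" where
  "ell2_unit i = Abs_ell2 (\<lambda>l. if l = i then 1 else 0)"

lemma coef_ell2_unit: "coef (ell2_unit i) l = (if l = i then 1 else 0)"
proof -
  have "(\<lambda>l. (if l = i then 1 else 0 :: real)\<^sup>2) summable_on {i}" by simp
  then have "(\<lambda>l. (if l = i then 1 else 0 :: real)\<^sup>2) summable_on UNIV"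
    by (rule summable_on_cong_neutral[THEN iffD1, rotated -1]) auto
  then show ?thesis unfolding ell2_unit_def by (subst Abs_ell2_inverse) auto
qed

lemma inner_ell2_unit: "x \<bullet> ell2_unit i = coef x i"
proof -
  have "((\<lambda>l. coef x l * coef (ell2_unit i) l) has_sum coef x i) {i}"
    by (rule has_sum_finiteI) (auto simp: coef_ell2_unit)
  then have "((\<lambda>l. coef x l * coef (ell2_unit i) l) has_sum coef x i) UNIV"
    by (rule has_sum_cong_neutral[THEN iffD1, rotated -1]) (auto simp: coef_ell2_unit)
  then show ?thesis using has_sum_inner_ell2 by (rule has_sum_unique[rotated])
qed

text \<open>The square norm of the remainder after a finite set is, by Pythagoras, the tail of the
  summable series of squares.\<close>

lemma ell2_unit_expansion: "((\<lambda>i. coef x i *\<^sub>R ell2_unit i) has_sum x) UNIV"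
proof -
  define S where "S F = (\<Sum>i\<in>F. coef x i *\<^sub>R ell2_unit i)" for F
  have S: "coef (S F) l = (if l \<in> F then coef x l else 0)" if "finite F" for F l
    using that unfolding S_def coef_sum by (simp add: coef_ell2_unit if_distrib sum.delta cong: if_cong)
  have nrm: "(norm (x - S F))\<^sup>2 = (norm x)\<^sup>2 - (\<Sum>i\<in>F. (coef x i)\<^sup>2)" if F: "finite F" for F
  proof -
    have 1: "x \<bullet> S F = (\<Sum>i\<in>F. (coef x i)\<^sup>2)"
      unfolding S_def inner_sum_right by (simp add: inner_ell2_unit power2_eq_square)
    have "S F \<bullet> S F = (\<Sum>i\<in>F. coef x i * coef (S F) i)"
      unfolding S_def[of F] inner_sum_right by (simp add: inner_ell2_unit)
    also have "\<dots> = (\<Sum>i\<in>F. (coef x i)\<^sup>2)"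
      by (intro sum.cong) (auto simp: S[OF F] power2_eq_square)
    finally show ?thesis using 1
      by (simp add: power2_norm_eq_inner inner_diff_left inner_diff_right inner_commute)
  qed
  have "((\<lambda>F. (norm (x - S F))\<^sup>2) \<longlongrightarrow> 0) (finite_subsets_at_top UNIV)"
  proof -
    have "((\<lambda>F. (norm x)\<^sup>2 - (\<Sum>i\<in>F. (coef x i)\<^sup>2)) \<longlongrightarrow> (norm x)\<^sup>2 - (norm x)\<^sup>2)
        (finite_subsets_at_top UNIV)"
      using has_sum_norm_ell2[of x] unfolding has_sum_def by (intro tendsto_intros)
    then have "((\<lambda>F. (norm x)\<^sup>2 - (\<Sum>i\<in>F. (coef x i)\<^sup>2)) \<longlongrightarrow> 0) (finite_subsets_at_top UNIV)"
      by simp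
    then show ?thesis
      by (rule Lim_transform_eventually) (auto simp: nrm intro!: eventually_finite_subsets_at_top_weakI)
  qed
  then have "((\<lambda>F. sqrt ((norm (x - S F))\<^sup>2)) \<longlongrightarrow> sqrt 0) (finite_subsets_at_top UNIV)"
    by (rule tendsto_real_sqrt)
  then have "((\<lambda>F. norm (S F - x)) \<longlongrightarrow> 0) (finite_subsets_at_top UNIV)"
    by (simp add: norm_minus_commute)
  then show ?thesis
    unfolding has_sum_def S_def[symmetric]
    by (simp add: tendsto_norm_zero_iff LIM_zero_iff)
qed

text \<open>Finite combinations of unit vectors are dense. This reduces identities between bounded
  linear maps to basis vectors; the antisymmetry of convection is proved this way, once in each of
  two arguments.\<close>

lemma bounded_linear_ell2_eqI:
  fixes f g :: "'i ell2 \<Rightarrow> 'b::real_normed_vector"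
  assumes f: "bounded_linear f" and g: "bounded_linear g"
    and eq: "\<And>i. f (ell2_unit i) = g (ell2_unit i)"
  shows "f x = g x"
proof -
  have *: "((\<lambda>i. coef x i *\<^sub>R h (ell2_unit i)) has_sum h x) UNIV" if h: "bounded_linear h" for h :: "'i ell2 \<Rightarrow> 'b"
    using has_sum_bounded_linear[OF h ell2_unit_expansion[of x]]
    by (simp add: o_def linear_simps[OF h])
  show ?thesis using has_sum_unique[OF *[OF f, unfolded eq] *[OF g]] .
qed


section \<open>Riesz representation and the Lax--Milgram lemma\<close>

text \<open>The representer minimizes the energy \<open>J\<close> over S: \<open>J\<close> is
  bounded below, minimizing sequences are Cauchy by the parallelogram law, and the vanishing first
  variation at the minimizer is the claimed identity. The functional lives on the whole space but is
  represented on S only.\<close>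

lemma riesz_representation:
  fixes F :: "'a::{real_inner, complete_space} \<Rightarrow> real"
  assumes S: "subspace S" "closed S" and F: "bounded_linear F"
  shows "\<exists>r\<in>S. \<forall>w\<in>S. F w = r \<bullet> w"
proof -
  interpret F: bounded_linear F by fact
  obtain K where K: "\<And>x. \<bar>F x\<bar> \<le> norm x * K" "K \<ge> 0" using F.nonneg_bounded by auto
  define J where "J w = w \<bullet> w - 2 * F w" for w
  have lb: "J w \<ge> - K\<^sup>2" for w
  proof -
    have "0 \<le> (norm w - K)\<^sup>2" by simp
    moreover have "F w \<le> norm w * K" using K(1)[of w] by simp
    ultimately show ?thesis unfolding J_def by (simp add: power2_norm_eq_inner[symmetric] power2_diff)
  qed
  define m where "m = (INF w\<in>S. J w)"
  have ne: "S \<noteq> {}" using S(1) subspace_0 by blast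
  have bb: "bdd_below (J ` S)" using lb by (auto simp: bdd_below_def)
  have m_le: "m \<le> J w" if "w \<in> S" for w unfolding m_def using bb that by (rule cINF_lower)
  have "\<exists>w\<in>S. J w < m + 1 / Suc n" for n
    using cINF_less_iff[OF ne bb, of "m + 1 / Suc n"] by (simp add: m_def)
  then obtain X where X: "\<And>n. X n \<in> S" "\<And>n. J (X n) < m + 1 / Suc n" by metis
  \<comment> \<open>The parallelogram law: the midpoint lies in S, so its energy is at least m, and
    the linear part of \<open>J\<close> cancels in the identity below.\<close>
  have par: "(norm (x - y))\<^sup>2 \<le> 2 * (J x - m) + 2 * (J y - m)" if "x \<in> S" "y \<in> S" for x y
  proof -
    have "m \<le> J ((1/2) *\<^sub>R (x + y))"
      using that S(1) by (intro m_le subspace_scale subspace_add)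
    moreover have "(norm (x - y))\<^sup>2 = 2 * J x + 2 * J y - 4 * J ((1/2) *\<^sub>R (x + y))"
      unfolding J_def by (simp add: power2_norm_eq_inner F.add F.scaleR algebra_simps inner_commute)
    ultimately show ?thesis by argo
  qed
  have par': "(norm (X i - X j))\<^sup>2 \<le> 4 / Suc n" if "i \<ge> n" "j \<ge> n" for i j n
  proof -
    have "1 / real (Suc i) \<le> 1 / Suc n" "1 / real (Suc j) \<le> 1 / Suc n"
      using that by (auto intro!: divide_left_mono)
    moreover have "4 / real (Suc n) = 4 * (1 / real (Suc n))" by simp
    ultimately show ?thesis using par[OF X(1) X(1), of i j] X(2)[of i] X(2)[of j] by argo
  qed
  have "Cauchy X"
  proof (rule CauchyI)
    fix e :: real assume e: "0 < e"
    obtain n where n: "4 / e\<^sup>2 < real (Suc n)"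
      using reals_Archimedean2 less_trans lessI of_nat_less_iff by metis
    then have "4 / real (Suc n) < e\<^sup>2" using e by (simp add: field_simps)
    then have "norm (X i - X j) < e" if "i \<ge> n" "j \<ge> n" for i j
      using par'[OF that] e by (meson le_less_trans less_imp_le power_less_imp_less_base)
    then show "\<exists>M. \<forall>m\<ge>M. \<forall>n\<ge>M. norm (X m - X n) < e" by blast
  qed
  then obtain r where r: "X \<longlonglongrightarrow> r" using Cauchy_convergent convergent_def by blast
  have rS: "r \<in> S" using closed_sequentially[OF S(2) X(1) r] .
  have "J r \<le> m"
  proof (rule LIMSEQ_le)
    show "(\<lambda>n. J (X n)) \<longlonglongrightarrow> J r" unfolding J_def by (intro tendsto_intros r F.tendsto)
    show "(\<lambda>n. m + 1 / Suc n) \<longlonglongrightarrow> m"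
      using tendsto_add[OF tendsto_const LIMSEQ_inverse_real_of_nat, of m]
      by (simp add: inverse_eq_divide)
    show "\<exists>N. \<forall>n\<ge>N. J (X n) \<le> m + 1 / Suc n" using X(2) less_imp_le by blast
  qed
  then have min: "J r \<le> J w" if "w \<in> S" for w using m_le[OF that] by simp
  have "F w = r \<bullet> w" if w: "w \<in> S" for w
  proof -
    define d where "d = r \<bullet> w - F w"
    have q: "0 \<le> 2 * t * d + t\<^sup>2 * (norm w)\<^sup>2" for t
    proof -
      have "J r \<le> J (r + t *\<^sub>R w)" using S(1) rS w by (intro min subspace_add subspace_scale)
      then show ?thesis unfolding J_def d_def power2_norm_eq_inner
        by (simp add: F.add F.scaleR algebra_simps inner_commute power2_eq_square)
    qed
    have "d = 0"
    proof (cases "w = 0")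
      case True then show ?thesis by (simp add: d_def F.zero)
    next
      case False
      \<comment> \<open>The value t = -d / |w|^2 minimizes the quadratic in \<open>q\<close>;
        nonnegativity there forces d = 0.\<close>
      then have "2 * (- d / (norm w)\<^sup>2) * d + (- d / (norm w)\<^sup>2)\<^sup>2 * (norm w)\<^sup>2 = - d\<^sup>2 / (norm w)\<^sup>2"
        by (simp add: field_simps power2_eq_square)
      then have "d\<^sup>2 / (norm w)\<^sup>2 \<le> 0" using q[of "- d / (norm w)\<^sup>2"] by simp
      then show ?thesis using False by (auto simp: divide_le_0_iff power2_eq_square mult_le_0_iff)
    qed
    then show ?thesis by (simp add: d_def)
  qed
  then show ?thesis using rS by blast
qed

lemma lax_milgram:
  fixes B :: "'a::{real_inner, complete_space} \<Rightarrow> 'a \<Rightarrow> real"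
  assumes S: "subspace S" "closed S" and B: "bounded_bilinear B" and F: "bounded_linear F"
    and coercive: "\<alpha> > 0" "\<And>u. u \<in> S \<Longrightarrow> B u u \<ge> \<alpha> * (norm u)\<^sup>2"
  shows "\<exists>u\<in>S. \<forall>w\<in>S. B u w = F w"
proof -
  interpret B: bounded_bilinear B by fact
  obtain K where K: "\<And>u w. \<bar>B u w\<bar> \<le> norm u * norm w * K" "K > 0" using B.pos_bounded by auto
  obtain l where l: "l \<in> S" "\<And>w. w \<in> S \<Longrightarrow> F w = l \<bullet> w"
    using riesz_representation[OF S F] by blast
  have "\<exists>A. \<forall>u. A u \<in> S \<and> (\<forall>w\<in>S. B u w = A u \<bullet> w)"
    using riesz_representation[OF S B.bounded_linear_right] by metis
  then obtain A where A: "\<And>u. A u \<in> S" "\<And>u w. w \<in> S \<Longrightarrow> B u w = A u \<bullet> w" by metis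
  have A_diff: "A u - A v = A (u - v)" for u v
  proof -
    have "(A u - A v - A (u - v)) \<bullet> w = 0" if "w \<in> S" for w
      using that by (simp add: inner_diff_left A(2)[symmetric] B.diff_left)
    moreover have "A u - A v - A (u - v) \<in> S" using S(1) A(1) by (intro subspace_diff)
    ultimately have "(A u - A v - A (u - v)) \<bullet> (A u - A v - A (u - v)) = 0" by blast
    then show ?thesis by simp
  qed
  have A_norm: "norm (A u) \<le> K * norm u" for u
  proof (cases "A u = 0")
    case False
    have "(norm (A u))\<^sup>2 \<le> norm u * norm (A u) * K"
      using K(1)[of u "A u"] A(2)[OF A(1)] by (simp add: power2_norm_eq_inner)
    then show ?thesis using False by (simp add: power2_eq_square field_simps)
  qed (use K in auto)
  \<comment> \<open>With this step size rho K^2 \<le> \<alpha>, so the factor 1 - 2 rho \<alpha> +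
    rho^2 K^2 is at most 1 - rho \<alpha>. The summand \<alpha>^2 in the denominator keeps rho
    \<alpha> \<le> 1, so that the root defining \<open>c\<close> is taken of a nonnegative
    number.\<close>
  define \<rho> where "\<rho> = \<alpha> / (K\<^sup>2 + \<alpha>\<^sup>2)"
  have Kp: "K\<^sup>2 + \<alpha>\<^sup>2 > 0" using K coercive(1) by (simp add: add_pos_pos)
  have \<rho>: "\<rho> > 0" using Kp coercive(1) by (simp add: \<rho>_def)
  define c where "c = sqrt (1 - \<rho> * \<alpha>)"
  have ra: "\<rho> * \<alpha> \<le> 1" "0 < \<rho> * \<alpha>"
    using Kp coercive(1) by (auto simp: \<rho>_def field_simps power2_eq_square)
  have c: "0 \<le> c" "c < 1" using ra by (auto simp: c_def)
  define T where "T u = u - \<rho> *\<^sub>R (A u - l)" for u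
  have contr: "dist (T u) (T v) \<le> c * dist u v" if "u \<in> S" "v \<in> S" for u v
  proof -
    define w where "w = u - v"
    have wS: "w \<in> S" using that S(1) by (simp add: w_def subspace_diff)
    have "T u - T v = w - \<rho> *\<^sub>R (A u - A v)" unfolding T_def w_def by (simp add: algebra_simps)
    then have TT: "T u - T v = w - \<rho> *\<^sub>R A w" by (simp add: A_diff w_def)
    have "(norm (T u - T v))\<^sup>2 = (norm w)\<^sup>2 - 2 * \<rho> * B w w + \<rho>\<^sup>2 * (norm (A w))\<^sup>2"
      unfolding TT A(2)[OF wS] power2_norm_eq_inner
      by (simp add: algebra_simps inner_commute power2_eq_square)
    also have "\<dots> \<le> (norm w)\<^sup>2 - 2 * \<rho> * (\<alpha> * (norm w)\<^sup>2) + \<rho>\<^sup>2 * (K * norm w)\<^sup>2"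
      using coercive(2)[OF wS] \<rho> A_norm[of w]
      by (intro add_mono diff_mono mult_left_mono power_mono) auto
    also have "\<dots> = (1 - 2 * \<rho> * \<alpha> + \<rho> * (\<rho> * K\<^sup>2)) * (norm w)\<^sup>2"
      by (simp add: algebra_simps power2_eq_square)
    also have "\<dots> \<le> (1 - \<rho> * \<alpha>) * (norm w)\<^sup>2"
    proof -
      have "\<rho> * K\<^sup>2 \<le> \<alpha>" using Kp coercive(1) by (simp add: \<rho>_def field_simps)
      then have "\<rho> * (\<rho> * K\<^sup>2) \<le> \<rho> * \<alpha>" using \<rho> by simp
      then show ?thesis by (intro mult_right_mono) (auto simp: algebra_simps)
    qed
    also have "\<dots> = (c * norm w)\<^sup>2" using ra by (simp add: c_def power_mult_distrib)
    finally show ?thesis unfolding dist_norm w_def[symmetric]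
      by (rule power2_le_imp_le) (use c in simp)
  qed
  have "\<exists>!u. u \<in> S \<and> T u = u"
  proof (rule Banach_fix[OF _ _ c])
    show "complete S" using S(2) by (simp add: complete_eq_closed)
    show "S \<noteq> {}" using S(1) subspace_0 by blast
    show "T ` S \<subseteq> S" unfolding T_def using S(1) A(1) l(1)
      by (auto intro!: subspace_diff subspace_scale)
  qed (use contr in blast)
  then obtain u where u: "u \<in> S" "T u = u" by blast
  then have "A u = l" using \<rho> by (simp add: T_def)
  then show ?thesis using u(1) A(2) l(2) by (intro bexI[of _ u]) auto
qed


section \<open>Periodic test functions and the Hartley basis\<close>

lemma freq_simps [simp]:
  "freq 0 = 0" "freq (- \<xi>) = - freq \<xi>" "freq (\<xi> + \<eta>) = freq \<xi> + freq \<eta>"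
  "freq (\<xi> - \<eta>) = freq \<xi> - freq \<eta>" "freq \<xi> $ i = of_int (\<xi> $ i)"
  by (simp_all add: freq_def vec_eq_iff)

section \<open>Periodicity under integer translations\<close>

lemma periodic_axis_int:
  assumes "periodic f"
  shows "f (x + axis i (real_of_int m)) = f x"
proof (induction m arbitrary: x rule: int_induct[where k = 0])
  case base
  have "axis i (0::real) = 0" by (simp add: axis_def vec_eq_iff)
  then show ?case by (simp only: of_int_0 add_0_right)
next
  case (step1 m)
  have "axis i (real_of_int (m + 1)) = axis i (real_of_int m) + axis i 1"
    by (simp add: axis_def vec_eq_iff)
  then have "f (x + axis i (real_of_int (m + 1))) = f ((x + axis i (real_of_int m)) + axis i 1)"
    by (simp add: add.assoc)
  then show ?case using assms step1 by (simp add: periodic_def)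
next
  case (step2 m)
  have "axis i (real_of_int m) = axis i (real_of_int (m - 1)) + axis i 1"
    by (simp add: axis_def vec_eq_iff)
  then have "f (x + axis i (real_of_int m)) = f ((x + axis i (real_of_int (m - 1))) + axis i 1)"
    by (simp add: add.assoc)
  then show ?case using assms step2 by (simp add: periodic_def)
qed

lemma periodic_freq:
  fixes \<xi> :: "int^'n"
  assumes "periodic f"
  shows "f (x + freq \<xi>) = f x"
proof -
  have "f (x + (\<Sum>i\<in>I. axis i (real_of_int (\<xi> $ i)))) = f x" if "finite I" for I :: "'n set"
    using that
  proof (induction I arbitrary: x)
    case (insert i I)
    have "f (x + (\<Sum>i\<in>insert i I. axis i (real_of_int (\<xi> $ i)))) =
        f ((x + (\<Sum>i\<in>I. axis i (real_of_int (\<xi> $ i)))) + axis i (real_of_int (\<xi> $ i)))"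
      using insert by (simp add: ac_simps)
    then show ?case using periodic_axis_int[OF assms] insert.IH by simp
  qed simp
  moreover have "(\<Sum>i\<in>UNIV. axis i (real_of_int (\<xi> $ i))) = freq \<xi>"
    by (simp add: vec_eq_iff axis_def if_distrib sum.delta cong: if_cong)
  ultimately show ?thesis by (metis finite)
qed

lemma torus_cell_representative:
  obtains \<xi> :: "int^'n" where "x - freq \<xi> \<in> torus_cell"
proof -
  have "x - freq (\<chi> i. \<lfloor>x $ i\<rfloor>) \<in> torus_cell"
    unfolding torus_cell_def by simp linarith
  then show ?thesis by (rule that)
qed

lemma torus_cell_subset_cbox: "torus_cell \<subseteq> cbox 0 1"
  by (auto simp: torus_cell_def mem_box_cart less_imp_le)

lemma periodic_representative:
  fixes f :: "real^'n \<Rightarrow> 'b"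
  assumes "periodic f"
  obtains y where "y \<in> torus_cell" "f y = f x"
proof -
  obtain \<xi> :: "int^'n" where "x - freq \<xi> \<in> torus_cell" by (rule torus_cell_representative)
  moreover have "f (x - freq \<xi>) = f x" using periodic_freq[OF assms, of x "- \<xi>"] by simp
  ultimately show ?thesis by (rule that)
qed

lemma periodic_continuous_bounded:
  fixes f :: "real^'n \<Rightarrow> real"
  assumes "periodic f" "continuous_on UNIV f"
  obtains K where "K \<ge> 0" "\<And>x. \<bar>f x\<bar> \<le> K"
proof -
  have "compact (f ` cbox 0 1)"
    using assms(2) by (intro compact_continuous_image compact_cbox) (auto intro: continuous_on_subset)
  then obtain K where K: "\<And>y. y \<in> cbox 0 1 \<Longrightarrow> \<bar>f y\<bar> \<le> K"
    by (auto dest!: compact_imp_bounded simp: bounded_iff) blast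
  have "\<bar>f x\<bar> \<le> K" for x
    using periodic_representative[OF assms(1), of x] K torus_cell_subset_cbox by (metis subsetD)
  then show ?thesis using that[of K] by (meson abs_ge_zero order_trans)
qed

section \<open>The Hartley functions\<close>

definition cas :: "int^'n \<Rightarrow> real^'n \<Rightarrow> real" where
  "cas \<xi> x = cos (2 * pi * (x \<bullet> freq \<xi>)) + sin (2 * pi * (x \<bullet> freq \<xi>))"

lemma cas_0 [simp]: "cas 0 x = 1" by (simp add: cas_def)

lemma cos_freq: "cos (2 * pi * (x \<bullet> freq \<xi>)) = (cas \<xi> x + cas (- \<xi>) x) / 2"
  and sin_freq: "sin (2 * pi * (x \<bullet> freq \<xi>)) = (cas \<xi> x - cas (- \<xi>) x) / 2"
  by (simp_all add: cas_def)

lemma abs_cas_le: "\<bar>cas \<xi> x\<bar> \<le> 2"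
  using abs_triangle_ineq[of "cos (2 * pi * (x \<bullet> freq \<xi>))" "sin (2 * pi * (x \<bullet> freq \<xi>))"]
    abs_cos_le_one[of "2 * pi * (x \<bullet> freq \<xi>)"] abs_sin_le_one[of "2 * pi * (x \<bullet> freq \<xi>)"]
  unfolding cas_def by linarith

text \<open>The product equals cos(s - t) + sin(s + t); cosine and sine are then written as half sum
  and half difference of Hartley functions at opposite frequencies. The formula yields
  orthonormality and keeps products of basis functions in the span.\<close>

lemma cas_mult:
  "cas \<xi> x * cas \<eta> x = (cas (\<xi> - \<eta>) x + cas (\<eta> - \<xi>) x + cas (\<xi> + \<eta>) x - cas (- \<xi> - \<eta>) x) / 2"
proof -
  define s t where "s = 2 * pi * (x \<bullet> freq \<xi>)" and "t = 2 * pi * (x \<bullet> freq \<eta>)"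
  have e: "2 * pi * (x \<bullet> freq (\<xi> - \<eta>)) = s - t" "2 * pi * (x \<bullet> freq (\<eta> - \<xi>)) = t - s"
    "2 * pi * (x \<bullet> freq (\<xi> + \<eta>)) = s + t" "2 * pi * (x \<bullet> freq (- \<xi> - \<eta>)) = - s - t"
    by (simp_all add: s_def t_def inner_diff_right inner_add_right algebra_simps)
  show ?thesis
    unfolding cas_def e s_def[symmetric] t_def[symmetric]
    by (simp add: cos_add cos_diff sin_add sin_diff field_simps)
qed

lemma periodic_cas: "periodic (cas \<xi> :: real^'n \<Rightarrow> real)"
proof -
  have "cas \<xi> (x + axis i 1) = cas \<xi> x" for x :: "real^'n" and i
  proof -
    have "2 * pi * ((x + axis i 1) \<bullet> freq \<xi>) = 2 * pi * (x \<bullet> freq \<xi>) + 2 * pi * real_of_int (\<xi> $ i)"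
      by (simp add: inner_add_left inner_axis' algebra_simps)
    then show ?thesis unfolding cas_def
      by (simp add: sin_add cos_add)
  qed
  then show ?thesis by (simp add: periodic_def)
qed

lemma periodic_add: "periodic f \<Longrightarrow> periodic g \<Longrightarrow> periodic (\<lambda>x. f x + g x)"
  and periodic_diff: "periodic f \<Longrightarrow> periodic g \<Longrightarrow> periodic (\<lambda>x. f x - g x)"
  and periodic_mult: "periodic f \<Longrightarrow> periodic g \<Longrightarrow> periodic (\<lambda>x. f x * g x)"
  and periodic_const: "periodic (\<lambda>x. c)"
  by (simp_all add: periodic_def)

lemma periodic_sum:
  "(\<And>i. i \<in> F \<Longrightarrow> periodic (f i)) \<Longrightarrow> periodic (\<lambda>x. \<Sum>i\<in>F. f i x)"
  by (simp add: periodic_def)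

section \<open>Partial derivatives and closure properties of test functions\<close>

lemma partial_eqI:
  "(\<phi> has_derivative D) (at x) \<Longrightarrow> partial j \<phi> x = D (axis j 1)"
  unfolding partial_def by (metis frechet_derivative_at)

lemma has_derivative_cas:
  "(cas \<xi> has_derivative (\<lambda>h. 2 * pi * (h \<bullet> freq \<xi>) * cas (- \<xi>) x)) (at x)"
  unfolding cas_def
  by (auto intro!: derivative_eq_intros simp: fun_eq_iff algebra_simps)

lemma differentiable_cas: "cas \<xi> differentiable (at x)"
  using has_derivative_cas by (rule differentiableI)

lemma continuous_on_cas: "continuous_on S (cas \<xi>)"
  unfolding cas_def by (intro continuous_intros)

lemma borel_measurable_cas [measurable]: "cas \<xi> \<in> borel_measurable borel"
  using continuous_on_cas by (rule borel_measurable_continuous_onI)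

lemma partial_add:
  "\<phi> differentiable (at x) \<Longrightarrow> \<psi> differentiable (at x) \<Longrightarrow>
    partial j (\<lambda>x. \<phi> x + \<psi> x) x = partial j \<phi> x + partial j \<psi> x"
  by (subst partial_eqI[OF has_derivative_add])
    (auto simp: frechet_derivative_works partial_def)

lemma partial_cmult:
  "\<phi> differentiable (at x) \<Longrightarrow> partial j (\<lambda>x. c * \<phi> x) x = c * partial j \<phi> x"
  by (subst partial_eqI[OF has_derivative_mult_right])
    (auto simp: frechet_derivative_works partial_def)

lemma partial_mult:
  "\<phi> differentiable (at x) \<Longrightarrow> \<psi> differentiable (at x) \<Longrightarrow>
    partial j (\<lambda>x. \<phi> x * \<psi> x) x = \<phi> x * partial j \<psi> x + partial j \<phi> x * \<psi> x"
  by (subst partial_eqI[OF has_derivative_mult])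
    (auto simp: frechet_derivative_works partial_def)

lemma partial_cas: "partial j (cas \<xi>) = (\<lambda>x. 2 * pi * of_int (\<xi> $ j) * cas (- \<xi>) x)"
  by (rule ext, subst partial_eqI[OF has_derivative_cas]) (simp add: inner_axis')

text \<open>The argument covers points without a derivative as well: the two points have the same
  set of derivatives, and \<open>frechet_derivative\<close> is a choice from that set.\<close>

lemma periodic_partial:
  fixes \<phi> :: "real^'n \<Rightarrow> real"
  assumes "periodic \<phi>"
  shows "periodic (partial j \<phi>)"
proof -
  have "frechet_derivative \<phi> (at (x + axis i 1)) = frechet_derivative \<phi> (at x)" for i x
  proof -
    have shift: "(\<lambda>x. \<phi> (x + c)) = \<phi>" if "c = axis i 1 \<or> c = - axis i 1" for c
    proof -
      have "\<phi> (x - axis i 1) = \<phi> (x - axis i 1 + axis i 1)" for x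
        using assms unfolding periodic_def by metis
      then show ?thesis using that assms by (auto simp: fun_eq_iff periodic_def)
    qed
    have 1: "(\<phi> has_derivative D) (at y)"
      if D: "(\<phi> has_derivative D) (at (y + c))" and c: "c = axis i 1 \<or> c = - axis i 1" for D c y
    proof -
      have "((\<lambda>x. \<phi> (x + c)) has_derivative (\<lambda>h. D h)) (at y)"
        by (rule has_derivative_compose[where f = "\<lambda>x. x + c" and g = \<phi>, OF _ D])
          (auto intro!: derivative_eq_intros)
      then show ?thesis using shift[OF c] by simp
    qed
    have "(\<phi> has_derivative D) (at (x + axis i 1)) \<longleftrightarrow> (\<phi> has_derivative D) (at x)" for D
      using 1[of D x "axis i 1"] 1[of D "x + axis i 1" "- axis i 1"] by auto
    then show ?thesis unfolding frechet_derivative_def by simp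
  qed
  then show ?thesis by (simp add: periodic_def partial_def)
qed

lemma test_funD:
  assumes "\<phi> \<in> test_fun"
  shows "periodic \<phi>" "partials js \<phi> differentiable (at x)" "\<phi> differentiable (at x)"
  using assms by (auto simp: test_fun_def partials_def dest: spec[of _ "[]"])

lemma partials_simps [simp]:
  "partials [] \<phi> = \<phi>" "partials (j # js) \<phi> = partial j (partials js \<phi>)"
  "partials (js @ js') \<phi> = partials js (partials js' \<phi>)"
  by (simp_all add: partials_def)

lemma partials_test_fun: "\<phi> \<in> test_fun \<Longrightarrow> partials js \<phi> \<in> test_fun"
proof -
  assume \<phi>: "\<phi> \<in> test_fun"
  have "periodic (partials js \<phi>)"
    by (induction js) (use \<phi> in \<open>auto intro: periodic_partial dest: test_funD\<close>)
  moreover have "partials is (partials js \<phi>) differentiable (at x)" for "is" x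
    using test_funD(2)[OF \<phi>, of "is @ js"] by simp
  ultimately show ?thesis by (simp add: test_fun_def)
qed

lemma partial_test_fun: "\<phi> \<in> test_fun \<Longrightarrow> partial j \<phi> \<in> test_fun"
  using partials_test_fun[of \<phi> "[j]"] by simp

lemma continuous_on_test_fun: "\<phi> \<in> test_fun \<Longrightarrow> continuous_on S \<phi>"
  using test_funD(3) by (metis continuous_at_imp_continuous_on differentiable_imp_continuous_within)

lemma borel_measurable_test_fun: "\<phi> \<in> test_fun \<Longrightarrow> \<phi> \<in> borel_measurable borel"
  using continuous_on_test_fun by (rule borel_measurable_continuous_onI)

lemma test_fun_bounded:
  assumes "\<phi> \<in> test_fun"
  obtains K where "K \<ge> 0" "\<And>x. \<bar>\<phi> x\<bar> \<le> K"
  using periodic_continuous_bounded[OF test_funD(1)[OF assms] continuous_on_test_fun[OF assms]] that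
  by blast

lemma partials_add:
  assumes "\<phi> \<in> test_fun" "\<psi> \<in> test_fun"
  shows "partials js (\<lambda>x. \<phi> x + \<psi> x) = (\<lambda>x. partials js \<phi> x + partials js \<psi> x)"
proof (induction js)
  case (Cons j js)
  show ?case unfolding partials_simps Cons
    by (rule ext, rule partial_add) (rule test_funD assms)+
qed simp

lemma partials_cmult:
  assumes "\<phi> \<in> test_fun"
  shows "partials js (\<lambda>x. c * \<phi> x) = (\<lambda>x. c * partials js \<phi> x)"
proof (induction js)
  case (Cons j js)
  show ?case unfolding partials_simps Cons
    by (rule ext, rule partial_cmult) (rule test_funD assms)+
qed simp

lemma test_fun_add: "\<phi> \<in> test_fun \<Longrightarrow> \<psi> \<in> test_fun \<Longrightarrow> (\<lambda>x. \<phi> x + \<psi> x) \<in> test_fun"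
  using partials_add[of \<phi> \<psi>] by (auto simp: test_fun_def periodic_add)

lemma test_fun_cmult: "\<phi> \<in> test_fun \<Longrightarrow> (\<lambda>x. c * \<phi> x) \<in> test_fun"
  using partials_cmult[of \<phi>] by (auto simp: test_fun_def periodic_def)

lemma test_fun_diff: "\<phi> \<in> test_fun \<Longrightarrow> \<psi> \<in> test_fun \<Longrightarrow> (\<lambda>x. \<phi> x - \<psi> x) \<in> test_fun"
  using test_fun_add[OF _ test_fun_cmult[of \<psi> "-1"], of \<phi>] by simp

lemma partials_diff:
  "\<phi> \<in> test_fun \<Longrightarrow> \<psi> \<in> test_fun \<Longrightarrow>
    partials js (\<lambda>x. \<phi> x - \<psi> x) = (\<lambda>x. partials js \<phi> x - partials js \<psi> x)"
  using partials_add[OF _ test_fun_cmult[of \<psi> "-1"], of \<phi> js] partials_cmult[of \<psi> js "-1"] by simp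

lemma test_fun_cas: "cas \<xi> \<in> test_fun"
proof -
  have "\<exists>c \<eta>. partials js (cas \<xi>) = (\<lambda>x. c * cas \<eta> x)" for js
  proof (induction js)
    case Nil
    show ?case by (rule exI[of _ 1]) auto
  next
    case (Cons j js)
    then obtain c \<eta> where "partials js (cas \<xi>) = (\<lambda>x. c * cas \<eta> x)" by blast
    then have "partials (j # js) (cas \<xi>) x = (c * (2 * pi * of_int (\<eta> $ j))) * cas (- \<eta>) x" for x
      using partial_cmult[OF differentiable_cas, of j c \<eta> x] by (simp only: partials_simps partial_cas mult.assoc)
    then have "partials (j # js) (cas \<xi>) = (\<lambda>x. (c * (2 * pi * of_int (\<eta> $ j))) * cas (- \<eta>) x)" ..
    then show ?case by (intro exI)
  qed
  moreover have "(\<lambda>x. c * cas \<eta> x) differentiable (at x)" for c \<eta> and x :: "real^'a"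
    by (intro differentiable_mult differentiable_cas differentiable_const)
  ultimately have "partials js (cas \<xi>) differentiable (at x)" for js x
    by metis
  then show ?thesis by (simp add: test_fun_def periodic_cas)
qed

lemma test_fun_sum:
  "finite F \<Longrightarrow> (\<And>i. i \<in> F \<Longrightarrow> \<phi> i \<in> test_fun) \<Longrightarrow> (\<lambda>x. \<Sum>i\<in>F. \<phi> i x) \<in> test_fun"
proof (induction F rule: finite_induct)
  case empty
  show ?case using test_fun_cmult[OF test_fun_cas, of 0] by simp
qed (simp add: test_fun_add)


section \<open>Integration over the torus\<close>

lemma borel_measurable_vec_nth [measurable (raw)]:
  fixes f :: "'a \<Rightarrow> real^'n"
  shows "f \<in> borel_measurable M \<Longrightarrow> (\<lambda>x. f x $ i) \<in> borel_measurable M"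
  by (rule measurable_compose[of f _ borel])
    (auto intro!: borel_measurable_continuous_onI continuous_intros)

text \<open>A probability measure on the half-open cell; restricting the measure turns the set
  integrals of the definitions into plain integrals.\<close>

definition torus :: "(real^'n) measure" where
  "torus = restrict_space lborel torus_cell"

lemma torus_cell_borel [measurable]: "(torus_cell :: (real^'n) set) \<in> sets borel"
proof -
  have "(torus_cell :: (real^'n) set) = (\<Inter>i. {x. 0 \<le> x $ i} \<inter> {x. x $ i < 1})"
    by (auto simp: torus_cell_def)
  moreover have "{x::real^'n. 0 \<le> x $ i} \<inter> {x. x $ i < 1} \<in> sets borel" for i :: 'n
  proof (rule sets.Int)
    have c: "continuous_on UNIV (\<lambda>x::real^'n. x $ i)" by (intro continuous_intros)
    show "{x::real^'n. 0 \<le> x $ i} \<in> sets borel"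
      by (rule borel_closed[OF closed_Collect_le[OF continuous_on_const c]])
    show "{x::real^'n. x $ i < 1} \<in> sets borel"
      by (rule borel_open[OF open_Collect_less[OF c continuous_on_const]])
  qed
  then have "(\<Inter>i. {x::real^'n. 0 \<le> x $ i} \<inter> {x. x $ i < 1}) \<in> sets borel"
    by (intro sets.finite_INT) auto
  ultimately show ?thesis by (simp only:)
qed

lemma space_torus: "space torus = torus_cell"
  by (simp add: torus_def space_restrict_space)

lemma set_integral_torus_cell:
  fixes f :: "real^'n \<Rightarrow> real"
  shows "(LINT x:torus_cell|lborel. f x) = integral\<^sup>L torus f"
  unfolding torus_def set_lebesgue_integral_def
  by (rule integral_restrict_space[symmetric]) simp

lemma set_integrable_torus_cell:
  fixes f :: "real^'n \<Rightarrow> real"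
  shows "set_integrable lborel torus_cell f = integrable torus f"
  unfolding torus_def set_integrable_def
  by (rule integrable_restrict_space[symmetric]) simp

lemma measurable_torus [measurable (raw)]:
  "f \<in> borel_measurable borel \<Longrightarrow> f \<in> borel_measurable torus"
  unfolding torus_def by (rule measurable_restrict_space1) simp

lemma emeasure_torus: "emeasure torus (torus_cell :: (real^'n) set) = 1"
proof -
  have "emeasure lborel (torus_cell :: (real^'n) set) \<le> emeasure lborel (cbox 0 1 :: (real^'n) set)"
    by (intro emeasure_mono torus_cell_subset_cbox) auto
  moreover have "emeasure lborel (box 0 1 :: (real^'n) set) \<le> emeasure lborel (torus_cell :: (real^'n) set)"
    by (intro emeasure_mono) (auto simp: torus_cell_def mem_box_cart less_imp_le)
  moreover have B: "b \<in> Basis \<Longrightarrow> (1::real^'n) \<bullet> b = 1" for b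
    by (auto simp: Basis_vec_def inner_axis)
  then have "(\<Prod>b\<in>Basis. ((1::real^'n) - 0) \<bullet> b) = 1" by (intro prod.neutral) simp
  then have "emeasure lborel (cbox 0 1 :: (real^'n) set) = 1" "emeasure lborel (box 0 1 :: (real^'n) set) = 1"
    using B by (simp_all only: emeasure_lborel_cbox_eq emeasure_lborel_box_eq) auto
  ultimately have "emeasure lborel (torus_cell :: (real^'n) set) = 1"
    by (metis antisym)
  then show ?thesis unfolding torus_def by (simp add: emeasure_restrict_space)
qed

interpretation torus: finite_measure torus
  by standard (simp add: space_torus emeasure_torus)

lemma measure_torus: "measure torus torus_cell = 1"
  by (simp add: measure_def emeasure_torus)

lemma integrable_torus_bounded:
  fixes f :: "real^'n \<Rightarrow> real"
  assumes "f \<in> borel_measurable borel" "\<And>x. \<bar>f x\<bar> \<le> K"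
  shows "integrable torus f"
  using assms by (intro torus.integrable_const_bound[of _ K]) auto

lemma integrable_test_fun: "\<phi> \<in> test_fun \<Longrightarrow> integrable torus \<phi>"
  using test_fun_bounded borel_measurable_test_fun integrable_torus_bounded by metis

lemma integrable_torus_mult_bounded:
  fixes f g :: "real^'n \<Rightarrow> real"
  assumes "integrable torus f" "g \<in> borel_measurable borel" "\<And>x. \<bar>g x\<bar> \<le> K"
  shows "integrable torus (\<lambda>x. f x * g x)"
proof (rule Bochner_Integration.integrable_bound)
  show "integrable torus (\<lambda>x. K * f x)" using assms(1) by simp
  have "K \<ge> 0" using assms(3)[of 0] by simp
  then show "AE x in torus. norm (f x * g x) \<le> norm (K * f x)"
    using assms(3) by (auto simp: abs_mult mult.commute[of "\<bar>f _\<bar>"] intro!: AE_I2 mult_right_mono)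
qed (use assms in measurable)

lemma integrable_torus_mult_test_fun:
  "integrable torus f \<Longrightarrow> \<phi> \<in> test_fun \<Longrightarrow> integrable torus (\<lambda>x. f x * \<phi> x)"
  using borel_measurable_test_fun integrable_torus_mult_bounded test_fun_bounded by metis

section \<open>Translation invariance and integration by parts on the torus\<close>

lemma lborel_integral_shift:
  fixes g :: "real^'n \<Rightarrow> real"
  assumes [measurable]: "g \<in> borel_measurable borel"
  shows "(\<integral>x. g (x + c) \<partial>lborel) = (\<integral>x. g x \<partial>lborel)"
proof -
  have "(\<integral>x. g x \<partial>distr lborel borel ((+) c)) = (\<integral>x. g (c + x) \<partial>lborel)"
    by (rule integral_distr) auto
  then show ?thesis by (simp add: lborel_distr_plus add.commute)
qed

lemma integrable_lborel_bounded_support: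
  fixes g :: "real^'n \<Rightarrow> real"
  assumes "g \<in> borel_measurable borel" "\<And>x. \<bar>g x\<bar> \<le> K" "\<And>x. x \<notin> cbox a b \<Longrightarrow> g x = 0"
  shows "integrable lborel g"
proof (rule integrableI_bounded_set[where A = "cbox a b" and B = K])
  show "emeasure lborel (cbox a b) < \<infinity>" by (rule emeasure_lborel_cbox_finite)
qed (use assms in auto)

text \<open>The cell moved by h in direction j is the part \<open>A\<close> of the cell together
  with the part \<open>B\<close> moved by a full period. Periodicity moves \<open>B\<close> back,
  and \<open>A\<close>, \<open>B\<close> partition the cell.\<close>

lemma torus_integral_shift:
  fixes f :: "real^'n \<Rightarrow> real"
  assumes per: "periodic f" and f [measurable]: "f \<in> borel_measurable borel"
    and K: "\<And>x. \<bar>f x\<bar> \<le> K" and h: "0 \<le> h" "h \<le> 1"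
  shows "(\<integral>x. f (x + axis j h) \<partial>torus) = (\<integral>x. f x \<partial>torus)"
proof -
  define A where "A = {x \<in> torus_cell. h \<le> x $ j}"
  define B where "B = {x \<in> torus_cell. x $ j < h}"
  have mA [measurable]: "A \<in> sets borel" and mB [measurable]: "B \<in> sets borel"
  proof -
    have "A = torus_cell \<inter> {x. h \<le> x $ j}" "B = torus_cell \<inter> {x. x $ j < h}"
      by (auto simp: A_def B_def)
    then show "A \<in> sets borel" "B \<in> sets borel" by simp_all
  qed
  have AB: "indicator torus_cell (y - axis j h) = indicator A y + (indicator B (y - axis j 1) :: real)" for y
  proof (cases "\<forall>i. i \<noteq> j \<longrightarrow> 0 \<le> y $ i \<and> y $ i < 1")
    case True
    have e: "z \<in> torus_cell \<longleftrightarrow> 0 \<le> z $ j \<and> z $ j < 1" if "\<And>i. i \<noteq> j \<Longrightarrow> z $ i = y $ i" for z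
      using True that unfolding torus_cell_def by force
    have "y - axis j h \<in> torus_cell \<longleftrightarrow> h \<le> y $ j \<and> y $ j < 1 + h"
      "y \<in> A \<longleftrightarrow> h \<le> y $ j \<and> y $ j < 1"
      "y - axis j 1 \<in> B \<longleftrightarrow> 1 \<le> y $ j \<and> y $ j < 1 + h"
      unfolding A_def B_def using h by (auto simp: e axis_def)
    then show ?thesis using h by (auto simp: indicator_def)
  next
    case False
    then obtain i where i: "i \<noteq> j" "\<not> (0 \<le> y $ i \<and> y $ i < 1)" by blast
    then have "y - axis j c \<notin> torus_cell" for c
      unfolding torus_cell_def by (auto simp: axis_def intro!: exI[of _ i])
    from this[of h] this[of 0] this[of 1] show ?thesis
      by (auto simp: A_def B_def indicator_def axis_def vec_eq_iff minus_vec_def cong: if_cong)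
  qed
  have box: "x \<notin> torus_cell" if "x \<notin> cbox 0 1" for x :: "real^'n"
    using that torus_cell_subset_cbox by blast
  have bnd: "\<bar>indicator C z * f x\<bar> \<le> K" for C and x z :: "real^'n"
    using K[of x] by (auto simp: indicator_def)
  have iA: "integrable lborel (\<lambda>y. indicator A y * f y)"
    and iB: "integrable lborel (\<lambda>y. indicator B y * f y)"
    subgoal by (rule integrable_lborel_bounded_support[where K = K and a = 0 and b = 1])
        (measurable, rule bnd, use box in \<open>auto simp: A_def\<close>)
    subgoal by (rule integrable_lborel_bounded_support[where K = K and a = 0 and b = 1])
        (measurable, rule bnd, use box in \<open>auto simp: B_def\<close>)
    done
  have iB1: "integrable lborel (\<lambda>y. indicator B (y - axis j 1) * f y)"
  proof (rule integrable_lborel_bounded_support[where K = K and a = "axis j 1" and b = "1 + axis j 1"])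
    show "indicator B (x - axis j 1) * f x = 0" if "x \<notin> cbox (axis j 1) (1 + axis j 1)" for x
    proof -
      have "x - axis j 1 \<notin> cbox 0 1"
        using that by (auto simp: mem_box_cart algebra_simps)
      then show ?thesis using box by (auto simp: B_def indicator_def)
    qed
  qed (use bnd in auto)
  have "(\<integral>x. f (x + axis j h) \<partial>torus)
      = (\<integral>x. indicator torus_cell ((x + axis j h) - axis j h) * f (x + axis j h) \<partial>lborel)"
    by (simp flip: set_integral_torus_cell add: set_lebesgue_integral_def)
  also have "\<dots> = (\<integral>y. indicator torus_cell (y - axis j h) * f y \<partial>lborel)"
    by (rule lborel_integral_shift[where g = "\<lambda>y. indicator torus_cell (y - axis j h) * f y"]) measurable
  also have "\<dots> = (\<integral>y. indicator A y * f y + indicator B (y - axis j 1) * f y \<partial>lborel)"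
    by (simp add: AB distrib_right)
  also have "\<dots> = (\<integral>y. indicator A y * f y \<partial>lborel) + (\<integral>y. indicator B (y - axis j 1) * f y \<partial>lborel)"
    by (rule Bochner_Integration.integral_add[OF iA iB1])
  also have "(\<integral>y. indicator B (y - axis j 1) * f y \<partial>lborel) =
      (\<integral>y. indicator B ((y + axis j 1) - axis j 1) * f (y + axis j 1) \<partial>lborel)"
    by (rule lborel_integral_shift[symmetric, where g = "\<lambda>y. indicator B (y - axis j 1) * f y"]) measurable
  also have "\<dots> = (\<integral>y. indicator B y * f y \<partial>lborel)"
    using per by (simp add: periodic_def)
  also have "(\<integral>y. indicator A y * f y \<partial>lborel) + \<dots> = (\<integral>y. indicator A y * f y + indicator B y * f y \<partial>lborel)"
    by (rule Bochner_Integration.integral_add[OF iA iB, symmetric])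
  also have "\<dots> = (\<integral>y. indicator torus_cell y * f y \<partial>lborel)"
    by (intro Bochner_Integration.integral_cong) (auto simp: A_def B_def indicator_def)
  also have "\<dots> = (\<integral>x. f x \<partial>torus)"
    by (simp flip: set_integral_torus_cell add: set_lebesgue_integral_def)
  finally show ?thesis .
qed

text \<open>Difference quotients have mean zero by translation invariance, are bounded by the mean
  value theorem and converge to the derivative, so dominated convergence applies.\<close>

lemma torus_integral_partial:
  fixes \<psi> :: "real^'n \<Rightarrow> real"
  assumes per: "periodic \<psi>" and diff: "\<And>x. \<psi> differentiable (at x)"
    and cont: "continuous_on UNIV (partial j \<psi>)"
  shows "(\<integral>x. partial j \<psi> x \<partial>torus) = 0"
proof -
  have c\<psi>: "continuous_on UNIV \<psi>"
    using diff by (metis continuous_at_imp_continuous_on differentiable_imp_continuous_within)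
  then have [measurable]: "\<psi> \<in> borel_measurable borel" by (rule borel_measurable_continuous_onI)
  have [measurable]: "partial j \<psi> \<in> borel_measurable borel" using cont by (rule borel_measurable_continuous_onI)
  obtain M where M: "M \<ge> 0" "\<And>x. \<bar>\<psi> x\<bar> \<le> M" using periodic_continuous_bounded[OF per c\<psi>] by blast
  obtain K where K: "\<And>x. \<bar>partial j \<psi> x\<bar> \<le> K"
    using periodic_continuous_bounded[OF periodic_partial[OF per] cont] by blast
  \<comment> \<open>Step sizes in (0, 1], the range in which the shift of the cell is
    treated.\<close>
  define h where "h m = 1 / real (Suc m)" for m
  have h: "0 < h m" "h m \<le> 1" for m by (auto simp: h_def)
  define q where "q m x = (\<psi> (x + axis j (h m)) - \<psi> x) / h m" for m x
  have line: "((\<lambda>t. \<psi> (x + axis j t)) has_real_derivative partial j \<psi> (x + axis j t)) (at t)" for x t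
  proof -
    have ax: "axis j t = t *\<^sub>R axis j 1" for t :: real by (simp add: axis_def vec_eq_iff)
    have "(\<psi> has_derivative frechet_derivative \<psi> (at (x + axis j t))) (at (x + axis j t))"
      using diff frechet_derivative_works by blast
    moreover have "((\<lambda>t. x + axis j t) has_derivative (\<lambda>s. s *\<^sub>R axis j 1)) (at t)"
      by (subst ax) (auto intro!: derivative_eq_intros)
    ultimately have "((\<lambda>t. \<psi> (x + axis j t)) has_derivative
        (\<lambda>s. frechet_derivative \<psi> (at (x + axis j t)) (s *\<^sub>R axis j 1))) (at t)"
      by (intro has_derivative_compose[where f = "\<lambda>t. x + axis j t" and g = \<psi>])
    moreover have "frechet_derivative \<psi> (at (x + axis j t)) (s *\<^sub>R axis j 1) = partial j \<psi> (x + axis j t) * s" for s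
      unfolding partial_def using linear_frechet_derivative[OF diff]
      by (simp add: linear_scale)
    ultimately show ?thesis unfolding has_field_derivative_def by simp
  qed
  have ax0: "axis j (0::real) = 0" by (simp add: axis_def vec_eq_iff)
  have qb: "\<bar>q m x\<bar> \<le> K" for m x
  proof -
    obtain z where "\<psi> (x + axis j (h m)) - \<psi> (x + axis j 0) = (h m - 0) * partial j \<psi> (x + axis j z)"
      using MVT2[OF h(1)[of m], of "\<lambda>t. \<psi> (x + axis j t)" "\<lambda>t. partial j \<psi> (x + axis j t)"] line by blast
    then have "q m x = partial j \<psi> (x + axis j z)" using h(1)[of m] by (simp add: q_def ax0)
    then show ?thesis using K by simp
  qed
  have ql: "(\<lambda>m. q m x) \<longlonglongrightarrow> partial j \<psi> x" for x
  proof -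
    have "((\<lambda>t. (\<psi> (x + axis j (0 + t)) - \<psi> (x + axis j 0)) / t) \<longlongrightarrow> partial j \<psi> (x + axis j 0)) (at 0)"
      using line[of x 0] unfolding DERIV_def .
    moreover have "filterlim h (at 0) sequentially"
      unfolding filterlim_at using h(1) LIMSEQ_inverse_real_of_nat
      by (auto simp: h_def[abs_def] inverse_eq_divide)
    ultimately have "(\<lambda>m. (\<psi> (x + axis j (0 + h m)) - \<psi> (x + axis j 0)) / h m) \<longlonglongrightarrow> partial j \<psi> (x + axis j 0)"
      by (rule filterlim_compose)
    then show ?thesis by (simp add: q_def ax0)
  qed
  have "(\<integral>x. q m x \<partial>torus) = 0" for m
  proof -
    have sh: "continuous_on UNIV (\<lambda>x. \<psi> (x + axis j (h m)))"
      by (intro continuous_on_compose2[OF c\<psi>] continuous_intros) auto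
    have i1: "integrable torus (\<lambda>x. \<psi> (x + axis j (h m)))"
      by (rule integrable_torus_bounded[OF borel_measurable_continuous_onI[OF sh]]) (rule M)
    have i2: "integrable torus \<psi>" by (rule integrable_torus_bounded[of _ M]) (use M in auto)
    have "(\<integral>x. \<psi> (x + axis j (h m)) \<partial>torus) = (\<integral>x. \<psi> x \<partial>torus)"
      by (rule torus_integral_shift[OF per _ M(2)]) (use h[of m] in auto)
    then show ?thesis unfolding q_def using i1 i2 by simp
  qed
  moreover have "(\<lambda>m. \<integral>x. q m x \<partial>torus) \<longlonglongrightarrow> (\<integral>x. partial j \<psi> x \<partial>torus)"
  proof (rule integral_dominated_convergence[where w = "\<lambda>_. K"])
    show "q m \<in> borel_measurable torus" for m unfolding q_def by measurable
  qed (use ql qb in auto)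
  ultimately show ?thesis by (simp add: LIMSEQ_const_iff)
qed

text \<open>Away from frequency 0 the function is a multiple of a derivative of
  \<open>cas (- \<xi>)\<close>, in a direction in which the frequency has a nonzero
  component.\<close>

lemma torus_integral_cas: "(\<integral>x. cas \<xi> x \<partial>torus) = (if \<xi> = 0 then 1 else 0)"
proof (cases "\<xi> = 0")
  case True
  then show ?thesis by (simp add: space_torus measure_torus)
next
  case False
  then obtain j where j: "\<xi> $ j \<noteq> 0" by (auto simp: vec_eq_iff)
  have "(\<integral>x. partial j (cas (- \<xi>)) x \<partial>torus) = 0"
    by (rule torus_integral_partial)
      (auto simp: periodic_cas differentiable_cas partial_cas intro!: continuous_intros continuous_on_cas)
  then show ?thesis using j False by (simp add: partial_cas)
qed

lemma integrable_cas: "integrable torus (cas \<xi>)"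
  by (rule integrable_test_fun[OF test_fun_cas])

text \<open>In the product formula the terms at xi + eta and -xi - eta have the same mean and
  cancel; the terms at xi - eta and eta - xi contribute one half each when the frequencies
  agree.\<close>

lemma cas_orthonormal:
  "(\<integral>x. cas \<xi> x * cas \<eta> x \<partial>torus) = (if \<xi> = \<eta> then 1 else 0)"
proof -
  have *: "- \<xi> - \<eta> = 0 \<longleftrightarrow> \<xi> + \<eta> = 0" "\<eta> - \<xi> = 0 \<longleftrightarrow> \<xi> - \<eta> = 0"
    by (auto simp: vec_eq_iff) (smt (verit))+
  have "(\<integral>x. cas \<xi> x * cas \<eta> x \<partial>torus) =
    ((\<integral>x. cas (\<xi> - \<eta>) x \<partial>torus) + (\<integral>x. cas (\<eta> - \<xi>) x \<partial>torus)
     + (\<integral>x. cas (\<xi> + \<eta>) x \<partial>torus) - (\<integral>x. cas (- \<xi> - \<eta>) x \<partial>torus)) / 2"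
    unfolding cas_mult by (simp add: integrable_cas Bochner_Integration.integrable_add Bochner_Integration.integrable_diff)
  also have "\<dots> = (if \<xi> = \<eta> then 1 else 0)"
    unfolding torus_integral_cas * by (auto simp: vec_eq_iff)
  finally show ?thesis .
qed

definition hcoef :: "(real^'n \<Rightarrow> real) \<Rightarrow> int^'n \<Rightarrow> real" where
  "hcoef f \<xi> = (\<integral>x. f x * cas \<xi> x \<partial>torus)"

lemma hcoef_partial:
  assumes "\<phi> \<in> test_fun"
  shows "hcoef (partial j \<phi>) \<xi> = - 2 * pi * of_int (\<xi> $ j) * hcoef \<phi> (- \<xi>)"
proof -
  have pm: "partial j (\<lambda>x. \<phi> x * cas \<xi> x) = (\<lambda>x. \<phi> x * partial j (cas \<xi>) x + partial j \<phi> x * cas \<xi> x)"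
    by (rule ext, rule partial_mult) (auto simp: test_funD[OF assms] differentiable_cas)
  have "(\<integral>x. partial j (\<lambda>x. \<phi> x * cas \<xi> x) x \<partial>torus) = 0"
  proof (rule torus_integral_partial)
    show "periodic (\<lambda>x. \<phi> x * cas \<xi> x)" by (intro periodic_mult periodic_cas test_funD(1) assms)
    show "(\<lambda>x. \<phi> x * cas \<xi> x) differentiable at x" for x
      by (intro differentiable_mult differentiable_cas test_funD(3)[OF assms])
    show "continuous_on UNIV (partial j (\<lambda>x. \<phi> x * cas \<xi> x))"
      unfolding pm by (intro continuous_intros continuous_on_test_fun partial_test_fun test_fun_cas assms)
  qed
  moreover have "integrable torus (\<lambda>x. \<phi> x * partial j (cas \<xi>) x)"
    "integrable torus (\<lambda>x. partial j \<phi> x * cas \<xi> x)"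
    by (intro integrable_torus_mult_test_fun integrable_test_fun partial_test_fun test_fun_cas assms)+
  ultimately have "(\<integral>x. \<phi> x * partial j (cas \<xi>) x \<partial>torus) + hcoef (partial j \<phi>) \<xi> = 0"
    unfolding pm hcoef_def by simp
  moreover have "(\<integral>x. \<phi> x * partial j (cas \<xi>) x \<partial>torus) = 2 * pi * of_int (\<xi> $ j) * hcoef \<phi> (- \<xi>)"
    unfolding partial_cas hcoef_def
    by (simp flip: integral_mult_right_zero add: ac_simps)
  ultimately show ?thesis by simp
qed


section \<open>Completeness of the Hartley basis\<close>

text \<open>Realizes the torus as a product of circles in a Euclidean space, so that polynomial
  functions restricted to it are trigonometric polynomials and the Stone-Weierstrass theorem
  applies.\<close>

definition torus_embedding :: "real^'n \<Rightarrow> (real^'n) \<times> (real^'n)" where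
  "torus_embedding x = ((\<chi> i. cos (2 * pi * x $ i)), (\<chi> i. sin (2 * pi * x $ i)))"

lemma continuous_on_torus_embedding: "continuous_on S torus_embedding"
  unfolding torus_embedding_def by (intro continuous_intros)

lemma borel_measurable_torus_embedding [measurable]: "torus_embedding \<in> borel_measurable borel"
  using continuous_on_torus_embedding by (rule borel_measurable_continuous_onI)

text \<open>The annihilator of the basis among integrable functions, to be shown trivial up to null
  sets. Working in L1 lets uniqueness cover every function that represents a distribution.\<close>

definition hartley_null :: "(real^'n \<Rightarrow> real) \<Rightarrow> bool" where
  "hartley_null h \<longleftrightarrow> integrable torus h \<and> (\<forall>\<xi>. hcoef h \<xi> = 0)"

lemma integrable_mult_cas:
  "integrable torus h \<Longrightarrow> integrable torus (\<lambda>x. h x * cas \<xi> x)"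
  by (rule integrable_torus_mult_test_fun[OF _ test_fun_cas])

lemma hcoef_add:
  "integrable torus f \<Longrightarrow> integrable torus g \<Longrightarrow>
    hcoef (\<lambda>x. f x + g x) \<xi> = hcoef f \<xi> + hcoef g \<xi>"
  unfolding hcoef_def by (simp add: distrib_right integrable_mult_cas)

lemma hcoef_diff:
  "integrable torus f \<Longrightarrow> integrable torus g \<Longrightarrow>
    hcoef (\<lambda>x. f x - g x) \<xi> = hcoef f \<xi> - hcoef g \<xi>"
  unfolding hcoef_def by (simp add: left_diff_distrib integrable_mult_cas)

lemma hcoef_cmult: "hcoef (\<lambda>x. c * f x) \<xi> = c * hcoef f \<xi>"
  unfolding hcoef_def by (simp add: mult.assoc)

lemma hartley_null_add:
  "hartley_null f \<Longrightarrow> hartley_null g \<Longrightarrow> hartley_null (\<lambda>x. f x + g x)"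
  by (auto simp: hartley_null_def hcoef_add)

lemma hartley_null_cmult: "hartley_null f \<Longrightarrow> hartley_null (\<lambda>x. c * f x)"
  by (auto simp: hartley_null_def hcoef_cmult)

lemma hartley_null_sum:
  assumes "\<And>i. i \<in> I \<Longrightarrow> hartley_null (f i)"
  shows "hartley_null (\<lambda>x. \<Sum>i\<in>I. f i x)"
  using assms
proof (induction I rule: infinite_finite_induct)
  case (insert i I)
  then show ?case by (simp add: hartley_null_add)
qed (simp_all add: hartley_null_def hcoef_def)

lemma hartley_null_mult_cas:
  assumes h: "hartley_null h"
  shows "hartley_null (\<lambda>x. h x * cas \<eta> x)"
proof -
  have i: "integrable torus (\<lambda>x. h x * cas \<zeta> x)" for \<zeta>
    using h by (simp add: hartley_null_def integrable_mult_cas)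
  have z: "(\<integral>x. h x * cas \<zeta> x \<partial>torus) = 0" for \<zeta>
    using h by (simp add: hartley_null_def hcoef_def)
  have "hcoef (\<lambda>x. h x * cas \<eta> x) \<xi> = 0" for \<xi>
  proof -
    have "hcoef (\<lambda>x. h x * cas \<eta> x) \<xi> = (\<integral>x. (h x * cas (\<eta> - \<xi>) x + h x * cas (\<xi> - \<eta>) x
        + h x * cas (\<eta> + \<xi>) x - h x * cas (- \<eta> - \<xi>) x) / 2 \<partial>torus)"
      unfolding hcoef_def mult.assoc cas_mult[of \<eta> _ \<xi>]
      by (intro Bochner_Integration.integral_cong) (auto simp: field_simps)
    also have "\<dots> = 0"
      by (simp add: Bochner_Integration.integrable_add Bochner_Integration.integrable_diff i z)
    finally show ?thesis .
  qed
  then show ?thesis using i by (simp add: hartley_null_def)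
qed

text \<open>The induction on \<open>p\<close> needs no trigonometric polynomials, since the property is quantified over
  all \<open>h\<close>: a product \<open>p * q\<close> is handled by multiplying \<open>h\<close> first with \<open>p\<close> and then with \<open>q\<close>.\<close>

lemma hartley_null_mult_polynomial:
  fixes p :: "(real^'n) \<times> (real^'n) \<Rightarrow> real"
  assumes "real_polynomial_function p" "hartley_null h"
  shows "hartley_null (\<lambda>x. h x * p (torus_embedding x))"
  using assms
proof (induction p arbitrary: h rule: real_polynomial_function.induct)
  case (linear f)
  interpret bounded_linear f by fact
  have cs: "cos (2 * pi * x $ i) = (cas (axis i 1) x + cas (- axis i 1) x) / 2"
    "sin (2 * pi * x $ i) = (cas (axis i 1) x - cas (- axis i 1) x) / 2" for x :: "real^'n" and i
  proof -
    have "x \<bullet> freq (axis i 1) = x $ i"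
      by (simp add: freq_def axis_def inner_vec_def if_distrib sum.delta cong: if_cong)
    then show "cos (2 * pi * x $ i) = (cas (axis i 1) x + cas (- axis i 1) x) / 2"
      "sin (2 * pi * x $ i) = (cas (axis i 1) x - cas (- axis i 1) x) / 2"
      using cos_freq[of x "axis i 1"] sin_freq[of x "axis i 1"] by simp_all
  qed
  have "torus_embedding x = (\<Sum>i\<in>UNIV. cos (2 * pi * x $ i) *\<^sub>R (axis i 1, 0) + sin (2 * pi * x $ i) *\<^sub>R (0, axis i 1))" for x :: "real^'n"
    unfolding torus_embedding_def
    by (simp add: prod_eq_iff fst_sum snd_sum vec_eq_iff axis_def if_distrib sum.delta cong: if_cong)
  then have e: "f (torus_embedding x) = (\<Sum>i\<in>UNIV. cos (2 * pi * x $ i) * f (axis i 1, 0) + sin (2 * pi * x $ i) * f (0, axis i 1))" for x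
    by (simp only: sum add scaleR) simp
  have "h x * f (torus_embedding x) = (\<Sum>i\<in>UNIV.
      ((f (axis i 1, 0) + f (0, axis i 1)) / 2) * (h x * cas (axis i 1) x) +
      ((f (axis i 1, 0) - f (0, axis i 1)) / 2) * (h x * cas (- axis i 1) x))" for x
    unfolding e cs sum_distrib_left by (intro sum.cong refl) (simp add: field_simps)
  then show ?case
    by (simp only:)
      (intro hartley_null_sum hartley_null_add hartley_null_cmult hartley_null_mult_cas linear.prems)
next
  case (const c)
  then show ?case using hartley_null_cmult[of h c] by (simp add: mult.commute)
next
  case (add f g)
  then show ?case by (simp add: distrib_left hartley_null_add)
next
  case (mult f g)
  then show ?case by (simp add: mult.assoc[symmetric])
qed

lemma hartley_null_integral:
  assumes "hartley_null h"
  shows "(\<integral>x. h x \<partial>torus) = 0"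
proof -
  have "hcoef h 0 = 0" using assms by (simp add: hartley_null_def)
  then show ?thesis by (simp add: hcoef_def)
qed

lemma integrable_mult_embedding:
  fixes \<psi> :: "(real^'n) \<times> (real^'n) \<Rightarrow> real"
  assumes h: "integrable torus h" and \<psi>: "\<psi> \<in> borel_measurable borel"
    and K: "\<And>z. \<bar>\<psi> z\<bar> \<le> K"
  shows "integrable torus (\<lambda>x. h x * \<psi> (torus_embedding x))"
  using h measurable_compose[OF borel_measurable_torus_embedding \<psi>] K
  by (rule integrable_torus_mult_bounded)

text \<open>Stone-Weierstrass approximates \<psi> by a polynomial uniformly on the compact image of
  the unit cube; polynomial multiples of h have mean zero, and the error is at most e times the L1
  norm of h.\<close>

lemma hartley_null_continuous:
  fixes \<psi> :: "(real^'n) \<times> (real^'n) \<Rightarrow> real"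
  assumes h: "hartley_null h" and \<psi>: "continuous_on UNIV \<psi>" and K: "\<And>z. \<bar>\<psi> z\<bar> \<le> K"
  shows "(\<integral>x. h x * \<psi> (torus_embedding x) \<partial>torus) = 0"
proof -
  have hi: "integrable torus h" using h by (simp add: hartley_null_def)
  define N where "N = (\<integral>x. \<bar>h x\<bar> \<partial>torus)"
  have "compact (torus_embedding ` (cbox 0 1 :: (real^'n) set))"
    by (intro compact_continuous_image continuous_on_torus_embedding compact_cbox)
  have "\<bar>\<integral>x. h x * \<psi> (torus_embedding x) \<partial>torus\<bar> \<le> e * N" if e: "e > 0" for e
  proof -
    obtain g where g: "real_polynomial_function g"
      "\<And>z. z \<in> torus_embedding ` (cbox 0 1 :: (real^'n) set) \<Longrightarrow> \<bar>\<psi> z - g z\<bar> < e"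
      using Stone_Weierstrass_real_polynomial_function[OF \<open>compact _\<close> continuous_on_subset[OF \<psi>] e] by blast
    have gn: "hartley_null (\<lambda>x. h x * g (torus_embedding x))"
      by (rule hartley_null_mult_polynomial[OF g(1) h])
    have i1: "integrable torus (\<lambda>x. h x * \<psi> (torus_embedding x))"
      by (rule integrable_mult_embedding[OF hi borel_measurable_continuous_onI[OF \<psi>] K])
    have i2: "integrable torus (\<lambda>x. h x * g (torus_embedding x))"
      using gn by (simp add: hartley_null_def)
    have "(\<integral>x. h x * \<psi> (torus_embedding x) \<partial>torus) =
        (\<integral>x. h x * \<psi> (torus_embedding x) - h x * g (torus_embedding x) \<partial>torus)"
      using i1 i2 hartley_null_integral[OF gn] by simp
    also have "\<bar>\<dots>\<bar> \<le> (\<integral>x. \<bar>h x * \<psi> (torus_embedding x) - h x * g (torus_embedding x)\<bar> \<partial>torus)"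
      by (rule integral_abs_bound)
    also have "\<dots> \<le> (\<integral>x. e * \<bar>h x\<bar> \<partial>torus)"
    proof (rule integral_mono)
      fix x :: "real^'n" assume "x \<in> space torus"
      then have "x \<in> cbox 0 1" using torus_cell_subset_cbox by (auto simp: space_torus)
      then have "\<bar>\<psi> (torus_embedding x) - g (torus_embedding x)\<bar> \<le> e"
        using g(2)[of "torus_embedding x"] by auto
      then show "\<bar>h x * \<psi> (torus_embedding x) - h x * g (torus_embedding x)\<bar> \<le> e * \<bar>h x\<bar>"
        unfolding right_diff_distrib[symmetric] abs_mult
        by (subst mult.commute) (intro mult_right_mono, auto)
    qed (use hi i1 i2 in auto)
    also have "\<dots> = e * N" by (simp add: N_def)
    finally show ?thesis .
  qed
  then have "\<bar>\<integral>x. h x * \<psi> (torus_embedding x) \<partial>torus\<bar> \<le> 0"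
  proof -
    assume *: "\<And>e. e > 0 \<Longrightarrow> \<bar>\<integral>x. h x * \<psi> (torus_embedding x) \<partial>torus\<bar> \<le> e * N"
    have N: "N \<ge> 0" by (simp add: N_def)
    show ?thesis
    proof (rule field_le_epsilon)
      fix e :: real assume e: "e > 0"
      then have "e / (N + 1) * N \<le> e" using N by (simp add: field_simps)
      then show "\<bar>\<integral>x. h x * \<psi> (torus_embedding x) \<partial>torus\<bar> \<le> 0 + e"
        using *[of "e / (N + 1)"] e N by simp
    qed
  qed
  then show ?thesis by simp
qed

text \<open>The indicator of a nonempty closed set is the pointwise limit of continuous cutoffs that
  decrease linearly with the distance to the set, with slope m; |h| dominates.\<close>

lemma hartley_null_closed:
  fixes C :: "((real^'n) \<times> (real^'n)) set"
  assumes h: "hartley_null h" and C: "closed C"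
  shows "(\<integral>x. h x * indicator C (torus_embedding x) \<partial>torus) = 0"
proof (cases "C = {}")
  case False
  have hi: "integrable torus h" using h by (simp add: hartley_null_def)
  define \<psi> where "\<psi> m z = max 0 (1 - real m * infdist z C)" for m z
  have \<psi>b: "\<bar>\<psi> m z\<bar> \<le> 1" for m z by (auto simp: \<psi>_def infdist_nonneg)
  have \<psi>c: "continuous_on UNIV (\<psi> m)" for m
    unfolding \<psi>_def by (intro continuous_intros)
  have \<psi>l: "(\<lambda>m. \<psi> m z) \<longlonglongrightarrow> indicator C z" for z
  proof (cases "z \<in> C")
    case True
    then show ?thesis by (simp add: \<psi>_def)
  next
    case z: False
    then have pos: "infdist z C > 0" using infdist_pos_not_in_closed[OF C False] by simp
    obtain M where M: "1 / infdist z C < real M" using reals_Archimedean2 by blast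
    have "\<psi> m z = 0" if "m \<ge> M" for m
    proof -
      have "1 / infdist z C < real m" using M that by linarith
      then show ?thesis using pos by (simp add: \<psi>_def field_simps)
    qed
    then have "eventually (\<lambda>m. \<psi> m z = 0) sequentially" unfolding eventually_sequentially by blast
    then show ?thesis using z by (simp add: tendsto_eventually)
  qed
  have mes: "\<psi> m \<in> borel_measurable borel" for m by (rule borel_measurable_continuous_onI[OF \<psi>c])
  have hm: "h \<in> borel_measurable torus" using hi by simp
  have "(\<lambda>m. \<integral>x. h x * \<psi> m (torus_embedding x) \<partial>torus) \<longlonglongrightarrow>
      (\<integral>x. h x * indicator C (torus_embedding x) \<partial>torus)"
  proof (rule integral_dominated_convergence[where w = "\<lambda>x. \<bar>h x\<bar>"])
    show "(\<lambda>x. h x * indicator C (torus_embedding x)) \<in> borel_measurable torus"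
      using hm C by (intro borel_measurable_times) (auto intro!: measurable_torus
          measurable_compose[OF borel_measurable_torus_embedding borel_measurable_indicator])
    show "(\<lambda>x. h x * \<psi> m (torus_embedding x)) \<in> borel_measurable torus" for m
      using hm by (intro borel_measurable_times) (auto intro!: measurable_torus
          measurable_compose[OF borel_measurable_torus_embedding mes])
    show "AE x in torus. (\<lambda>m. h x * \<psi> m (torus_embedding x)) \<longlonglongrightarrow>
        h x * indicator C (torus_embedding x)"
      by (intro AE_I2 tendsto_intros \<psi>l)
    show "AE x in torus. norm (h x * \<psi> m (torus_embedding x)) \<le> \<bar>h x\<bar>" for m
      using \<psi>b[of m "torus_embedding x" for x] by (simp add: abs_mult mult_left_le del: split_paired_All)
  qed (use hi in auto)
  moreover have "(\<integral>x. h x * \<psi> m (torus_embedding x) \<partial>torus) = 0" for m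
    by (rule hartley_null_continuous[OF h \<psi>c \<psi>b])
  ultimately show ?thesis by (simp add: LIMSEQ_const_iff)
qed simp

text \<open>On the half-open cell each coordinate is an angle, and the condition x_i \<le> a_i cuts
  out a compact arc of its circle: empty for a_i < 0, the whole circle for a_i \<ge> 1. Sets of the
  form {x. x \<le> a} generate the Borel sets, so closed sets suffice for completeness.\<close>

lemma atMost_torus_embedding:
  fixes a :: "real^'n"
  obtains C where "closed C" "\<And>x. x \<in> torus_cell \<Longrightarrow> torus_embedding x \<in> C \<longleftrightarrow> x \<le> a"
proof -
  define \<gamma> :: "real \<Rightarrow> real \<times> real" where "\<gamma> t = (cos (2 * pi * t), sin (2 * pi * t))" for t
  define C where "C = (\<Inter>i. (\<lambda>z. (fst z $ i, snd z $ i)) -` (\<gamma> ` {0..min (a $ i) 1}) :: ((real^'n) \<times> (real^'n)) set)"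
  have "closed C"
    unfolding C_def
  proof (intro closed_INT ballI closed_vimage)
    show "closed (\<gamma> ` {0..min (a $ i) 1})" for i
      unfolding \<gamma>_def by (intro compact_imp_closed compact_continuous_image continuous_intros) simp
  qed (intro continuous_intros)
  moreover have "torus_embedding x \<in> C \<longleftrightarrow> x \<le> a" if x: "x \<in> torus_cell" for x
  proof
    assume "x \<le> a"
    then show "torus_embedding x \<in> C"
      using x unfolding C_def torus_embedding_def torus_cell_def \<gamma>_def less_eq_vec_def
      by (auto intro!: image_eqI[where x = "x $ _"] simp: less_imp_le)
  next
    assume "torus_embedding x \<in> C"
    show "x \<le> a"
      unfolding less_eq_vec_def
    proof
      fix i
      obtain t where t: "0 \<le> t" "t \<le> a $ i" "t \<le> 1" "cos (2 * pi * t) = cos (2 * pi * x $ i)"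
        "sin (2 * pi * t) = sin (2 * pi * x $ i)"
        using \<open>torus_embedding x \<in> C\<close> unfolding C_def torus_embedding_def \<gamma>_def by fastforce
      then obtain n :: int where "2 * pi * t = 2 * pi * x $ i + 2 * pi * n"
        using sin_cos_eq_iff[of "2 * pi * t" "2 * pi * x $ i"] by auto
      then have "2 * pi * t = 2 * pi * (x $ i + n)" by (simp add: distrib_left)
      then have n: "t = x $ i + n" by simp
      moreover have "0 \<le> x $ i" "x $ i < 1" using x by (auto simp: torus_cell_def)
      \<comment> \<open>Here x_i < 1 is used: since t \<ge> 0, the angle t cannot lie a full turn
        below x_i. Hence x_i \<le> t \<le> a_i.\<close>
      ultimately have "real_of_int n > -1" using t by linarith
      then have "n \<ge> 0" by linarith
      then show "x $ i \<le> a $ i" using n t(2) by linarith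
    qed
  qed
  ultimately show ?thesis by (rule that)
qed

text \<open>The positive and the negative part of h on the cell are densities of two finite
  measures. Integrals of h over lower orthants vanish, so the measures agree on an
  intersection-stable generator, hence everywhere, and uniqueness of densities gives equality of the
  two parts almost everywhere.\<close>

theorem hartley_complete:
  fixes h :: "real^'n \<Rightarrow> real"
  assumes [measurable]: "h \<in> borel_measurable borel" and h: "hartley_null h"
  shows "AE x in torus. h x = 0"
proof -
  have hi: "integrable torus h" using h by (simp add: hartley_null_def)
  \<comment> \<open>The value s = 1 gives the positive part of h and s = -1 the negative part, both
    cut off outside the cell.\<close>
  define f where "f s x = indicator torus_cell x * max 0 (s * h x)" for s :: real and x
  have [measurable]: "f s \<in> borel_measurable borel" for s unfolding f_def by measurable
  have f0: "f s x \<ge> 0" for s x by (simp add: f_def)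
  have hT: "integrable lborel (\<lambda>x. indicator torus_cell x * h x)"
    using hi unfolding set_integrable_torus_cell[symmetric] set_integrable_def by simp
  have fi: "integrable lborel (\<lambda>x. f s x * indicator A x)" if [measurable]: "A \<in> sets borel" for s A
    by (rule Bochner_Integration.integrable_bound[OF integrable_mult_right[OF hT, of s]])
      (auto simp: f_def indicator_def max_def intro!: AE_I2 abs_ge_self simp flip: abs_mult)
  have em: "emeasure (density lborel (\<lambda>x. ennreal (f s x))) A = ennreal (\<integral>x. f s x * indicator A x \<partial>lborel)"
    if [measurable]: "A \<in> sets borel" for s A
  proof -
    have "emeasure (density lborel (\<lambda>x. ennreal (f s x))) A = (\<integral>\<^sup>+ x. ennreal (f s x * indicator A x) \<partial>lborel)"
      by (subst emeasure_density) (auto intro!: nn_integral_cong simp: indicator_def)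
    also have "\<dots> = ennreal (\<integral>x. f s x * indicator A x \<partial>lborel)"
      by (rule nn_integral_eq_integral[OF fi]) (auto simp: f0)
    finally show ?thesis .
  qed
  have "density lborel (\<lambda>x. ennreal (f 1 x)) = density lborel (\<lambda>x. ennreal (f (-1) x))"
  proof (rule measure_eqI_generator_eq[where E = "range atMost" and \<Omega> = UNIV
        and A = "\<lambda>i. {..(\<chi> _. real i)}"])
    show "Int_stable (range (atMost :: real^'n \<Rightarrow> _))"
    proof -
      have "{..a} \<inter> {..b} = {..(\<chi> i. min (a $ i) (b $ i))}" for a b :: "real^'n"
        by (auto simp: less_eq_vec_def)
      then show ?thesis by (auto simp: Int_stable_def)
    qed
    show "emeasure (density lborel (\<lambda>x. ennreal (f 1 x))) X = emeasure (density lborel (\<lambda>x. ennreal (f (-1) x))) X"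
      if "X \<in> range atMost" for X
    proof -
      obtain a where X: "X = {..a}" using \<open>X \<in> range atMost\<close> by blast
      then have [measurable]: "X \<in> sets borel" by simp
      obtain C where C: "closed C" "\<And>x. x \<in> torus_cell \<Longrightarrow> torus_embedding x \<in> C \<longleftrightarrow> x \<le> a"
        using atMost_torus_embedding by blast
      have "(\<integral>x. f 1 x * indicator X x \<partial>lborel) - (\<integral>x. f (-1) x * indicator X x \<partial>lborel)
          = (\<integral>x. f 1 x * indicator X x - f (-1) x * indicator X x \<partial>lborel)"
        using fi by simp
      also have "\<dots> = (\<integral>x. indicator torus_cell x * (h x * indicator C (torus_embedding x)) \<partial>lborel)"
        by (intro Bochner_Integration.integral_cong) (auto simp: f_def indicator_def max_def C X)
      also have "\<dots> = (\<integral>x. h x * indicator C (torus_embedding x) \<partial>torus)"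
        by (simp flip: set_integral_torus_cell add: set_lebesgue_integral_def)
      also have "\<dots> = 0" by (rule hartley_null_closed[OF h C(1)])
      finally show ?thesis by (simp add: em)
    qed
    have s: "sets (density lborel (\<lambda>x. ennreal (f s x))) = sigma_sets UNIV (range atMost)" for s
    proof -
      have "sets (borel :: (real^'n) measure) = sigma_sets UNIV (range atMost)"
        by (subst borel_eq_atMost) (rule sets_measure_of, simp)
      then show ?thesis by simp
    qed
    show "sets (density lborel (\<lambda>x. ennreal (f 1 x))) = sigma_sets UNIV (range atMost)"
      "sets (density lborel (\<lambda>x. ennreal (f (-1) x))) = sigma_sets UNIV (range atMost)"
      by (rule s)+
    show "(\<Union>i. {..\<chi> _. real i}) = (UNIV :: (real^'n) set)"
    proof -
      have "\<exists>i. x \<le> (\<chi> _. real i)" for x :: "real^'n"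
      proof -
        obtain i where i: "norm x \<le> real i" using real_arch_simple by blast
        have "x $ k \<le> real i" for k
          using component_le_norm_cart[of x k] i by linarith
        then show ?thesis by (auto simp: less_eq_vec_def)
      qed
      then show ?thesis by auto
    qed
    show "range (\<lambda>i. {..\<chi> _. real i}) \<subseteq> range atMost" by auto
    show "emeasure (density lborel (\<lambda>x. ennreal (f 1 x))) {..\<chi> _. real i} \<noteq> \<infinity>" for i
      by (simp add: em)
  qed auto
  then have "AE x in lborel. ennreal (f 1 x) = ennreal (f (-1) x)"
    by (intro sigma_finite_measure.density_unique[OF sigma_finite_lborel]) auto
  then have "AE x in lborel. x \<in> torus_cell \<longrightarrow> h x = 0"
    by eventually_elim (auto simp: f_def max_def split: if_splits)
  then show ?thesis
    unfolding torus_def by (subst AE_restrict_space_iff) auto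
qed

lemma hcoef_unique:
  assumes "f \<in> borel_measurable borel" "g \<in> borel_measurable borel"
    "integrable torus f" "integrable torus g" "\<And>\<xi>. hcoef f \<xi> = hcoef g \<xi>"
  shows "AE x in torus. f x = g x"
proof -
  have "AE x in torus. f x - g x = 0"
    by (rule hartley_complete) (use assms in \<open>auto simp: hartley_null_def hcoef_diff\<close>)
  then show ?thesis by simp
qed


section \<open>Hartley expansion of test functions\<close>

text \<open>The l1 norm is convenient because each of its summands is the factor produced by a
  single partial derivative.\<close>

definition l1_size :: "int^'n \<Rightarrow> real" where
  "l1_size \<xi> = (\<Sum>j\<in>UNIV. \<bar>real_of_int (\<xi> $ j)\<bar>)"

lemma l1_size_nonneg: "0 \<le> l1_size \<xi>"
  by (simp add: l1_size_def sum_nonneg)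

lemma l1_size_uminus [simp]: "l1_size (- \<xi>) = l1_size \<xi>"
  by (simp add: l1_size_def)

lemma abs_hcoef_le:
  assumes "integrable torus f"
  shows "\<bar>hcoef f \<xi>\<bar> \<le> 2 * (\<integral>x. \<bar>f x\<bar> \<partial>torus)"
proof -
  have "\<bar>hcoef f \<xi>\<bar> \<le> (\<integral>x. \<bar>f x * cas \<xi> x\<bar> \<partial>torus)"
    unfolding hcoef_def by (rule integral_abs_bound)
  also have "\<dots> \<le> (\<integral>x. 2 * \<bar>f x\<bar> \<partial>torus)"
  proof (rule integral_mono)
    show "\<bar>f x * cas \<xi> x\<bar> \<le> 2 * \<bar>f x\<bar>" for x
      unfolding abs_mult using mult_left_mono[OF abs_cas_le, of "\<bar>f x\<bar>" \<xi> x] by simp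
    show "integrable torus (\<lambda>x. \<bar>f x * cas \<xi> x\<bar>)"
      by (rule integrable_abs[OF integrable_mult_cas[OF assms]])
  qed (use assms in auto)
  finally show ?thesis by simp
qed

text \<open>One factor 1 + |xi|_1 is expanded into 1 and the |xi_j|; each |xi_j| is absorbed into a
  partial derivative, which is again a test function, so the induction runs over all test functions
  at once.\<close>

lemma hcoef_decay:
  assumes "\<phi> \<in> test_fun"
  shows "\<exists>K. \<forall>\<xi>. \<bar>hcoef \<phi> \<xi>\<bar> * (1 + l1_size \<xi>) ^ m \<le> K"
  using assms
proof (induction m arbitrary: \<phi>)
  case 0
  then show ?case using abs_hcoef_le[OF integrable_test_fun] by auto
next
  case (Suc m)
  obtain K where K: "\<And>\<xi>. \<bar>hcoef \<phi> \<xi>\<bar> * (1 + l1_size \<xi>) ^ m \<le> K" using Suc by blast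
  have "\<forall>j. \<exists>L. \<forall>\<xi>. \<bar>hcoef (partial j \<phi>) \<xi>\<bar> * (1 + l1_size \<xi>) ^ m \<le> L"
    using Suc.IH[OF partial_test_fun[OF Suc.prems]] by blast
  then obtain L where L: "\<And>j \<xi>. \<bar>hcoef (partial j \<phi>) \<xi>\<bar> * (1 + l1_size \<xi>) ^ m \<le> L j" by metis
  have "\<bar>hcoef \<phi> \<xi>\<bar> * (1 + l1_size \<xi>) ^ Suc m \<le> K + (\<Sum>j\<in>UNIV. L j)" for \<xi>
  proof -
    have "\<bar>hcoef \<phi> \<xi>\<bar> * (1 + l1_size \<xi>) ^ Suc m = \<bar>hcoef \<phi> \<xi>\<bar> * (1 + l1_size \<xi>) ^ m +
        (\<Sum>j\<in>UNIV. \<bar>real_of_int (\<xi> $ j)\<bar> * \<bar>hcoef \<phi> \<xi>\<bar> * (1 + l1_size \<xi>) ^ m)"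
    proof -
      have "(\<Sum>j\<in>UNIV. \<bar>real_of_int (\<xi> $ j)\<bar> * \<bar>hcoef \<phi> \<xi>\<bar> * (1 + l1_size \<xi>) ^ m)
          = l1_size \<xi> * \<bar>hcoef \<phi> \<xi>\<bar> * (1 + l1_size \<xi>) ^ m"
        unfolding l1_size_def[of \<xi>] by (simp only: sum_distrib_right)
      then show ?thesis by (simp add: algebra_simps)
    qed
    also have "\<dots> \<le> K + (\<Sum>j\<in>UNIV. L j)"
    proof (intro add_mono K sum_mono)
      fix j
      have "\<bar>hcoef (partial j \<phi>) (- \<xi>)\<bar> = 2 * pi * (\<bar>real_of_int (\<xi> $ j)\<bar> * \<bar>hcoef \<phi> \<xi>\<bar>)"
        by (simp add: hcoef_partial[OF Suc.prems] abs_mult)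
      moreover have "1 * (\<bar>real_of_int (\<xi> $ j)\<bar> * \<bar>hcoef \<phi> \<xi>\<bar>) \<le> 2 * pi * (\<bar>real_of_int (\<xi> $ j)\<bar> * \<bar>hcoef \<phi> \<xi>\<bar>)"
        using pi_gt3 by (intro mult_right_mono) auto
      ultimately have "\<bar>real_of_int (\<xi> $ j)\<bar> * \<bar>hcoef \<phi> \<xi>\<bar> \<le> \<bar>hcoef (partial j \<phi>) (- \<xi>)\<bar>" by simp
      then have "\<bar>real_of_int (\<xi> $ j)\<bar> * \<bar>hcoef \<phi> \<xi>\<bar> * (1 + l1_size \<xi>) ^ m
          \<le> \<bar>hcoef (partial j \<phi>) (- \<xi>)\<bar> * (1 + l1_size (- \<xi>)) ^ m"
        by (simp add: mult_right_mono l1_size_nonneg)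
      also have "\<dots> \<le> L j" by (rule L)
      finally show "\<bar>real_of_int (\<xi> $ j)\<bar> * \<bar>hcoef \<phi> \<xi>\<bar> * (1 + l1_size \<xi>) ^ m \<le> L j" .
    qed
    finally show ?thesis .
  qed
  then show ?case by blast
qed

text \<open>The subtracted term makes the induction close: the two new summands 1/(N+2)^2 are at
  most the telescoping difference 2/(N+1) - 2/(N+2).\<close>

lemma sum_int_inverse_squares_le:
  "(\<Sum>m\<in>{- int N..int N}. 1 / (1 + \<bar>real_of_int m\<bar>)\<^sup>2) \<le> 4 - 2 / (real N + 1)"
proof (induction N)
  case (Suc N)
  have "{- int (Suc N)..int (Suc N)} = insert (int (Suc N)) (insert (- int (Suc N)) {- int N..int N})"
    by auto
  then have "(\<Sum>m\<in>{- int (Suc N)..int (Suc N)}. 1 / (1 + \<bar>real_of_int m\<bar>)\<^sup>2)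
      = 2 / (real N + 2)\<^sup>2 + (\<Sum>m\<in>{- int N..int N}. 1 / (1 + \<bar>real_of_int m\<bar>)\<^sup>2)"
    by (simp add: add.commute)
  moreover have "2 / (real N + 2)\<^sup>2 \<le> 2 / (real N + 1) - 2 / (real N + 2)"
  proof -
    have "2 / (real N + 1) - 2 / (real N + 2) = 2 / ((real N + 1) * (real N + 2))"
      by (simp add: field_simps)
    then show ?thesis
      by (simp only: power2_eq_square) (intro divide_left_mono mult_right_mono mult_pos_pos, auto)
  qed
  ultimately show ?case using Suc by (simp add: add.commute)
qed simp

text \<open>The power (1 + |xi|_1)^(2n) dominates the product of the squares (1 + |xi_i|)^2 over the
  n coordinates, so a sum over a box is at most a product of n one-dimensional sums, each at most
  4.\<close>

lemma summable_on_l1_size: "(\<lambda>\<xi>::int^'n. 1 / (1 + l1_size \<xi>) ^ (2 * CARD('n))) summable_on UNIV"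
proof (rule nonneg_bdd_above_summable_on)
  show "bdd_above (sum (\<lambda>\<xi>::int^'n. 1 / (1 + l1_size \<xi>) ^ (2 * CARD('n))) ` {F. F \<subseteq> UNIV \<and> finite F})"
  proof (rule bdd_aboveI2)
    fix F :: "(int^'n) set" assume "F \<in> {F. F \<subseteq> UNIV \<and> finite F}"
    then have F: "finite F" by simp
    define w where "w m = 1 / (1 + \<bar>real_of_int m\<bar>)\<^sup>2" for m :: int
    define N where "N = Max (insert 0 ((\<lambda>(\<xi>, i). nat \<bar>\<xi> $ i\<bar>) ` (F \<times> UNIV)))"
    have N: "\<bar>\<xi> $ i\<bar> \<le> int N" if "\<xi> \<in> F" for \<xi> i
    proof -
      have "nat \<bar>\<xi> $ i\<bar> \<le> N" unfolding N_def using F that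
        by (intro Max_ge) (auto intro!: image_eqI[where x = "(\<xi>, i)"])
      then show ?thesis by linarith
    qed
    define P where "P = PiE (UNIV :: 'n set) (\<lambda>_. {- int N..int N})"
    have "(\<Sum>\<xi>\<in>F. 1 / (1 + l1_size \<xi>) ^ (2 * CARD('n))) \<le> (\<Sum>\<xi>\<in>F. \<Prod>i\<in>UNIV. w (\<xi> $ i))"
    proof (rule sum_mono)
      fix \<xi> :: "int^'n"
      have "(\<Prod>i\<in>UNIV. (1 + \<bar>real_of_int (\<xi> $ i)\<bar>)\<^sup>2) \<le> (\<Prod>i\<in>(UNIV::'n set). (1 + l1_size \<xi>)\<^sup>2)"
      proof (intro prod_mono conjI power_mono)
        show "1 + \<bar>real_of_int (\<xi> $ i)\<bar> \<le> 1 + l1_size \<xi>" for i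
          unfolding l1_size_def
          using member_le_sum[of i UNIV "\<lambda>j. \<bar>real_of_int (\<xi> $ j)\<bar>"] by simp
      qed auto
      also have "\<dots> = (1 + l1_size \<xi>) ^ (2 * CARD('n))" by (simp add: power_mult)
      finally have "1 / (1 + l1_size \<xi>) ^ (2 * CARD('n)) \<le> 1 / (\<Prod>i\<in>UNIV. (1 + \<bar>real_of_int (\<xi> $ i)\<bar>)\<^sup>2)"
        by (intro divide_left_mono mult_pos_pos prod_pos) (auto simp: l1_size_nonneg add_pos_nonneg)
      then show "1 / (1 + l1_size \<xi>) ^ (2 * CARD('n)) \<le> (\<Prod>i\<in>UNIV. w (\<xi> $ i))"
        by (simp add: w_def prod_dividef)
    qed
    also have "\<dots> = (\<Sum>g\<in>vec_nth ` F. \<Prod>i\<in>UNIV. w (g i))"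
      by (subst sum.reindex) (auto simp: inj_on_def vec_nth_inject)
    also have "\<dots> \<le> (\<Sum>g\<in>P. \<Prod>i\<in>UNIV. w (g i))"
    proof (rule sum_mono2)
      show "finite P" unfolding P_def by (rule finite_PiE) auto
      show "vec_nth ` F \<subseteq> P" unfolding P_def using N by (auto simp: abs_le_iff PiE_def) (smt (verit))+
    qed (auto intro!: prod_nonneg simp: w_def)
    also have "\<dots> = (\<Prod>i\<in>(UNIV::'n set). \<Sum>m\<in>{- int N..int N}. w m)"
      unfolding P_def by (rule prod_sum_PiE[symmetric]) auto
    also have "\<dots> \<le> (\<Prod>i\<in>(UNIV::'n set). 4)"
    proof (intro prod_mono conjI)
      have "0 \<le> 2 / (real N + 1)" by simp
      then show "(\<Sum>m\<in>{- int N..int N}. w m) \<le> 4"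
        using sum_int_inverse_squares_le[of N] unfolding w_def by linarith
    qed (auto intro!: sum_nonneg simp: w_def)
    finally show "(\<Sum>\<xi>\<in>F. 1 / (1 + l1_size \<xi>) ^ (2 * CARD('n))) \<le> (\<Prod>i\<in>(UNIV::'n set). 4)" .
  qed
qed (simp add: l1_size_nonneg)

lemma summable_on_hcoef:
  fixes \<phi> :: "real^'n \<Rightarrow> real"
  assumes "\<phi> \<in> test_fun"
  shows "(\<lambda>\<xi>. \<bar>hcoef \<phi> \<xi>\<bar>) summable_on UNIV"
proof -
  obtain K where K: "\<And>\<xi>. \<bar>hcoef \<phi> \<xi>\<bar> * (1 + l1_size \<xi>) ^ (2 * CARD('n)) \<le> K"
    using hcoef_decay[OF assms] by blast
  show ?thesis
  proof (rule summable_on_comparison_test)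
    show "(\<lambda>\<xi>::int^'n. K * (1 / (1 + l1_size \<xi>) ^ (2 * CARD('n)))) summable_on UNIV"
      by (intro summable_on_cmult_right summable_on_l1_size)
    fix \<xi> :: "int^'n"
    have "(1 + l1_size \<xi>) ^ (2 * CARD('n)) > 0" by (simp add: l1_size_nonneg add_pos_nonneg)
    then show "\<bar>hcoef \<phi> \<xi>\<bar> \<le> K * (1 / (1 + l1_size \<xi>) ^ (2 * CARD('n)))"
      using K[of \<xi>] by (simp add: field_simps)
  qed simp
qed

section \<open>Uniform convergence of Hartley series\<close>

definition hartley_sum :: "(real^'n \<Rightarrow> real) \<Rightarrow> (int^'n) set \<Rightarrow> real^'n \<Rightarrow> real" where
  "hartley_sum \<phi> F x = (\<Sum>\<xi>\<in>F. hcoef \<phi> \<xi> * cas \<xi> x)"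

lemma hcoef_trig_poly:
  assumes "finite F"
  shows "hcoef (\<lambda>x. \<Sum>\<xi>\<in>F. c \<xi> * cas \<xi> x) \<eta> = (if \<eta> \<in> F then c \<eta> else 0)"
proof -
  have "hcoef (\<lambda>x. \<Sum>\<xi>\<in>F. c \<xi> * cas \<xi> x) \<eta> = (\<integral>x. (\<Sum>\<xi>\<in>F. c \<xi> * (cas \<xi> x * cas \<eta> x)) \<partial>torus)"
    unfolding hcoef_def by (simp add: sum_distrib_right mult.assoc)
  also have "\<dots> = (\<Sum>\<xi>\<in>F. c \<xi> * (if \<xi> = \<eta> then 1 else 0))"
    by (subst Bochner_Integration.integral_sum)
      (auto simp: cas_orthonormal intro!: integrable_mult_right integrable_mult_cas integrable_cas)
  also have "\<dots> = (\<Sum>\<xi>\<in>F. if \<xi> = \<eta> then c \<xi> else 0)" by (intro sum.cong) auto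
  also have "\<dots> = (if \<eta> \<in> F then c \<eta> else 0)" using assms by (simp add: sum.delta)
  finally show ?thesis .
qed

text \<open>A nonzero value spreads to an open set by continuity. Its point in the cell may lie on a
  face, so it is pushed along the diagonal into the open cube, where a nonempty open set cannot be
  negligible.\<close>

lemma AE_torus_continuous_eq_0:
  fixes u :: "real^'n \<Rightarrow> real"
  assumes "periodic u" "continuous_on UNIV u" and ae: "AE x in torus. u x = 0"
  shows "u x = 0"
proof (rule ccontr)
  assume "u x \<noteq> 0"
  then obtain y where y: "y \<in> torus_cell" "u y \<noteq> 0"
    using periodic_representative[OF assms(1), of x] by metis
  define U where "U = {x. u x \<noteq> 0}"
  have "open U" unfolding U_def
    by (intro open_Collect_neq assms continuous_intros)
  define p where "p k = y + (1 / Suc k) *\<^sub>R (1::real^'n)" for k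
  have "p \<longlonglongrightarrow> y + 0 *\<^sub>R 1" unfolding p_def
    using LIMSEQ_inverse_real_of_nat by (intro tendsto_intros) (simp add: inverse_eq_divide)
  then have "eventually (\<lambda>k. p k \<in> U) sequentially"
    using \<open>open U\<close> y(2) by (intro topological_tendstoD) (auto simp: U_def)
  moreover have "eventually (\<lambda>k. p k \<in> box 0 1) sequentially"
  proof -
    have "eventually (\<lambda>k. p k $ i < 1) sequentially" for i
    proof (rule order_tendstoD)
      show "(\<lambda>k. p k $ i) \<longlonglongrightarrow> y $ i" using tendsto_vec_nth[OF \<open>p \<longlonglongrightarrow> _\<close>] by simp
      show "y $ i < 1" using y(1) by (simp add: torus_cell_def)
    qed
    then have "eventually (\<lambda>k. \<forall>i. p k $ i < 1) sequentially" by (simp add: eventually_all_finite)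
    moreover have "0 < p k $ i" for k i
      using y(1) by (simp add: p_def torus_cell_def add_nonneg_pos)
    ultimately show ?thesis by (simp add: mem_box_cart)
  qed
  ultimately have "eventually (\<lambda>k. p k \<in> U \<inter> box 0 1) sequentially" by eventually_elim simp
  then have ne: "U \<inter> box 0 1 \<noteq> {}" using eventually_happens'[OF sequentially_bot] by fastforce
  have "AE x in lborel. x \<in> torus_cell \<longrightarrow> u x = 0"
    using ae unfolding torus_def by (subst (asm) AE_restrict_space_iff) auto
  then have "AE x in lborel. x \<notin> U \<inter> box 0 1"
    by eventually_elim (auto simp: U_def torus_cell_def mem_box_cart less_imp_le)
  moreover have "U \<inter> box 0 1 \<in> sets lborel" using \<open>open U\<close> by auto
  ultimately have "U \<inter> box 0 1 \<in> null_sets lborel" by (subst AE_iff_null_sets) auto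
  then have "negligible (U \<inter> box 0 1)"
    unfolding negligible_iff_null_sets by (rule null_sets_completionI)
  then show False using open_not_negligible[of "U \<inter> box 0 1"] \<open>open U\<close> ne by auto
qed

text \<open>Absolute summability of the coefficients gives some continuous limit g. Only
  completeness identifies it: g and \<phi> have the same coefficients, so they agree almost
  everywhere and, being continuous, everywhere.\<close>

lemma hartley_sum_uniform_limit:
  fixes \<phi> :: "real^'n \<Rightarrow> real"
  assumes \<phi>: "\<phi> \<in> test_fun"
  shows "uniform_limit UNIV (\<lambda>F x. hartley_sum \<phi> F x) \<phi> (finite_subsets_at_top UNIV)"
proof -
  define g where "g x = (\<Sum>\<^sub>\<infinity>\<xi>. hcoef \<phi> \<xi> * cas \<xi> x)" for x
  have lim: "uniform_limit UNIV (\<lambda>F x. hartley_sum \<phi> F x) g (finite_subsets_at_top UNIV)"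
    unfolding hartley_sum_def g_def
  proof (rule Weierstrass_m_test_general)
    show "norm (hcoef \<phi> \<xi> * cas \<xi> x) \<le> 2 * \<bar>hcoef \<phi> \<xi>\<bar>" for \<xi> x
      using mult_left_mono[OF abs_cas_le, of "\<bar>hcoef \<phi> \<xi>\<bar>" \<xi> x] by (simp add: abs_mult)
    show "(\<lambda>\<xi>. 2 * \<bar>hcoef \<phi> \<xi>\<bar>) summable_on UNIV"
      by (intro summable_on_cmult_right summable_on_hcoef \<phi>)
  qed
  have "continuous_on UNIV (\<lambda>x. hartley_sum \<phi> F x)" for F
    unfolding hartley_sum_def by (intro continuous_intros continuous_on_cas)
  then have gc: "continuous_on UNIV g"
    by (intro uniform_limit_theorem[OF _ lim]) auto
  have gp: "periodic g"
  proof -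
    have "cas \<xi> (x + axis i 1) = cas \<xi> x" for \<xi> and x :: "real^'n" and i
      using periodic_cas[of \<xi>] by (simp add: periodic_def)
    then show ?thesis by (simp add: periodic_def g_def)
  qed
  obtain K where "\<And>x. \<bar>g x\<bar> \<le> K" using periodic_continuous_bounded[OF gp gc] by blast
  then have gi: "integrable torus g"
    by (rule integrable_torus_bounded[OF borel_measurable_continuous_onI[OF gc]])
  have "hcoef g \<eta> = hcoef \<phi> \<eta>" for \<eta>
  proof -
    have "\<bar>hcoef g \<eta> - hcoef \<phi> \<eta>\<bar> \<le> e" if e: "e > 0" for e
    proof -
      have "eventually (\<lambda>F. \<forall>x\<in>UNIV. dist (hartley_sum \<phi> F x) (g x) < e / 2) (finite_subsets_at_top UNIV)"
        using uniform_limitD[OF lim, of "e / 2"] e by simp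
      moreover have "eventually (\<lambda>F. finite F \<and> {\<eta>} \<subseteq> F) (finite_subsets_at_top UNIV)"
        by (rule eventually_finite_subsets_at_top_weakI[THEN eventually_mono, THEN eventually_conj])
          (auto simp: eventually_finite_subsets_at_top)
      ultimately have "eventually (\<lambda>F. finite F \<and> \<eta> \<in> F \<and> (\<forall>x. dist (hartley_sum \<phi> F x) (g x) < e / 2))
          (finite_subsets_at_top UNIV)" by eventually_elim auto
      then obtain F where "finite F \<and> \<eta> \<in> F \<and> (\<forall>x. dist (hartley_sum \<phi> F x) (g x) < e / 2)"
        using eventually_happens'[OF finite_subsets_at_top_neq_bot] by blast
      then have F: "finite F" "\<eta> \<in> F" "\<And>x. \<bar>hartley_sum \<phi> F x - g x\<bar> \<le> e / 2"
        by (auto simp: dist_real_def less_imp_le)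
      have i: "integrable torus (hartley_sum \<phi> F)"
        unfolding hartley_sum_def by (intro Bochner_Integration.integrable_sum integrable_mult_right integrable_cas)
      have "hcoef (hartley_sum \<phi> F) \<eta> = hcoef \<phi> \<eta>"
        unfolding hartley_sum_def hcoef_trig_poly[OF F(1)] using F(2) by simp
      then have "hcoef g \<eta> - hcoef \<phi> \<eta> = hcoef (\<lambda>x. g x - hartley_sum \<phi> F x) \<eta>"
        using hcoef_diff[OF gi i] by simp
      also have "\<bar>\<dots>\<bar> \<le> 2 * (\<integral>x. \<bar>g x - hartley_sum \<phi> F x\<bar> \<partial>torus)"
        by (rule abs_hcoef_le) (use gi i in simp)
      also have "\<dots> \<le> 2 * (\<integral>x. e / 2 \<partial>(torus :: (real^'n) measure))"
        by (intro mult_left_mono integral_mono) (use gi i F(3) in \<open>auto simp: abs_minus_commute\<close>)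
      also have "\<dots> = e" by (simp add: space_torus measure_torus)
      finally show ?thesis .
    qed
    then show ?thesis using field_le_epsilon[of "\<bar>hcoef g \<eta> - hcoef \<phi> \<eta>\<bar>" 0] by simp
  qed
  then have "AE x in torus. g x = \<phi> x"
    by (intro hcoef_unique borel_measurable_continuous_onI gc continuous_on_test_fun \<phi> gi
        integrable_test_fun)
  then have "AE x in torus. g x - \<phi> x = 0" by simp
  then have "g x - \<phi> x = 0" for x
    by (rule AE_torus_continuous_eq_0[rotated 2])
      (intro periodic_diff gp test_funD(1) \<phi> continuous_intros gc continuous_on_test_fun)+
  then have "g = \<phi>" by auto
  then show ?thesis using lim by simp
qed

lemma hartley_sum_test_fun: "finite F \<Longrightarrow> hartley_sum \<phi> F \<in> test_fun"
  unfolding hartley_sum_def[abs_def] by (intro test_fun_sum test_fun_cmult test_fun_cas)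

lemma partial_sum:
  "finite F \<Longrightarrow> (\<And>i. i \<in> F \<Longrightarrow> \<phi> i \<in> test_fun) \<Longrightarrow>
    partial j (\<lambda>x. \<Sum>i\<in>F. \<phi> i x) x = (\<Sum>i\<in>F. partial j (\<phi> i) x)"
proof (induction F rule: finite_induct)
  case empty
  have "partial j (\<lambda>x. 0 * cas 0 x) x = 0 * partial j (cas 0) x"
    by (rule partial_cmult[OF differentiable_cas])
  then show ?case by simp
next
  case (insert i F)
  have "partial j (\<lambda>x. \<phi> i x + (\<Sum>i\<in>F. \<phi> i x)) x = partial j (\<phi> i) x + partial j (\<lambda>x. \<Sum>i\<in>F. \<phi> i x) x"
    by (rule partial_add; rule test_funD(3)) (use insert in \<open>auto intro: test_fun_sum\<close>)
  then show ?case using insert by simp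
qed

text \<open>Differentiation exchanges xi and -xi, so the derivative of a partial sum is the partial
  sum of the derivative over the reflected set; symmetry of F makes the two sets equal.\<close>

lemma partial_hartley_sum:
  assumes F: "finite F" "uminus ` F = F" and \<phi>: "\<phi> \<in> test_fun"
  shows "partial j (hartley_sum \<phi> F) = hartley_sum (partial j \<phi>) F"
proof
  fix x
  have "partial j (hartley_sum \<phi> F) x = (\<Sum>\<xi>\<in>F. partial j (\<lambda>x. hcoef \<phi> \<xi> * cas \<xi> x) x)"
    unfolding hartley_sum_def[abs_def]
    by (rule partial_sum[OF F(1)]) (intro test_fun_cmult test_fun_cas)
  also have "\<dots> = (\<Sum>\<xi>\<in>F. hcoef \<phi> \<xi> * (2 * pi * of_int (\<xi> $ j) * cas (- \<xi>) x))"
    by (simp add: partial_cmult[OF differentiable_cas] partial_cas)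
  also have "\<dots> = (\<Sum>\<xi>\<in>uminus ` F. hcoef \<phi> \<xi> * (2 * pi * of_int (\<xi> $ j) * cas (- \<xi>) x))"
    by (simp add: F)
  also have "\<dots> = (\<Sum>\<xi>\<in>F. hcoef \<phi> (- \<xi>) * (2 * pi * of_int ((- \<xi>) $ j) * cas \<xi> x))"
    by (subst sum.reindex) (auto simp: inj_on_def)
  also have "\<dots> = hartley_sum (partial j \<phi>) F x"
    unfolding hartley_sum_def by (intro sum.cong) (auto simp: hcoef_partial[OF \<phi>])
  finally show "partial j (hartley_sum \<phi> F) x = hartley_sum (partial j \<phi>) F x" .
qed

lemma partials_hartley_sum:
  assumes F: "finite F" "uminus ` F = F" and \<phi>: "\<phi> \<in> test_fun"
  shows "partials js (hartley_sum \<phi> F) = hartley_sum (partials js \<phi>) F"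
  by (induction js) (simp_all add: partial_hartley_sum[OF F partials_test_fun[OF \<phi>]])

text \<open>Density of trigonometric polynomials in the C^N norms by which continuity of
  distributions is defined. The finitely many derivatives share one finite set of frequencies,
  symmetrized so that derivatives commute with the partial sum.\<close>

lemma test_fun_approximation:
  assumes \<phi>: "\<phi> \<in> test_fun" and e: "e > 0"
  obtains F where "finite F"
    "\<And>js x. length js \<le> N \<Longrightarrow> \<bar>partials js (\<lambda>x. \<phi> x - hartley_sum \<phi> F x) x\<bar> \<le> e"
proof -
  have fin: "finite {js :: 'a list. length js \<le> N}"
    using finite_lists_length_le[of "UNIV :: 'a set" N] by simp
  have "eventually (\<lambda>F. \<forall>x\<in>UNIV. dist (hartley_sum (partials js \<phi>) F x) (partials js \<phi> x) < e)
      (finite_subsets_at_top UNIV)" for js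
    using uniform_limitD[OF hartley_sum_uniform_limit[OF partials_test_fun[OF \<phi>]] e] .
  then have "eventually (\<lambda>F. \<forall>js\<in>{js. length js \<le> N}. \<forall>x\<in>UNIV.
      dist (hartley_sum (partials js \<phi>) F x) (partials js \<phi> x) < e) (finite_subsets_at_top UNIV)"
    by (intro eventually_ball_finite fin) auto
  then obtain F0 where F0: "finite F0" "\<And>F js x. finite F \<Longrightarrow> F0 \<subseteq> F \<Longrightarrow> length js \<le> N \<Longrightarrow>
      \<bar>hartley_sum (partials js \<phi>) F x - partials js \<phi> x\<bar> < e"
    unfolding eventually_finite_subsets_at_top dist_real_def by auto
  define F where "F = F0 \<union> uminus ` F0"
  have F: "finite F" "uminus ` F = F" "F0 \<subseteq> F"
    using F0(1) by (auto simp: F_def image_Un image_image)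
  have "\<bar>partials js (\<lambda>x. \<phi> x - hartley_sum \<phi> F x) x\<bar> \<le> e" if "length js \<le> N" for js x
    using F0(2)[OF F(1,3) that, of x]
    by (simp add: partials_diff[OF \<phi> hartley_sum_test_fun[OF F(1)]] partials_hartley_sum[OF F(1,2) \<phi>])
  then show ?thesis using that F(1) by blast
qed


section \<open>Distributions and their Hartley coefficients\<close>

lemma pdistr_add:
  "g \<in> pdistr \<Longrightarrow> \<phi> \<in> test_fun \<Longrightarrow> \<psi> \<in> test_fun \<Longrightarrow> g (\<lambda>x. \<phi> x + \<psi> x) = g \<phi> + g \<psi>"
  and pdistr_cmult: "g \<in> pdistr \<Longrightarrow> \<phi> \<in> test_fun \<Longrightarrow> g (\<lambda>x. c * \<phi> x) = c * g \<phi>"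
  by (auto simp: pdistr_def)

lemma pdistr_diff:
  "g \<in> pdistr \<Longrightarrow> \<phi> \<in> test_fun \<Longrightarrow> \<psi> \<in> test_fun \<Longrightarrow> g (\<lambda>x. \<phi> x - \<psi> x) = g \<phi> - g \<psi>"
  using pdistr_add[OF _ _ test_fun_cmult[of \<psi> "-1"], of g \<phi>] pdistr_cmult[of g \<psi> "-1"] by simp

lemma pdistr_sum:
  "g \<in> pdistr \<Longrightarrow> finite F \<Longrightarrow> (\<And>i. i \<in> F \<Longrightarrow> \<phi> i \<in> test_fun) \<Longrightarrow>
    g (\<lambda>x. \<Sum>i\<in>F. \<phi> i x) = (\<Sum>i\<in>F. g (\<phi> i))"
proof (induction F rule: infinite_finite_induct)
  case empty
  then show ?case using pdistr_cmult[OF _ test_fun_cas, of g 0] by simp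
next
  case (insert i F)
  have "g (\<lambda>x. \<phi> i x + (\<Sum>i\<in>F. \<phi> i x)) = g (\<phi> i) + g (\<lambda>x. \<Sum>i\<in>F. \<phi> i x)"
    by (rule pdistr_add) (use insert in \<open>auto intro: test_fun_sum\<close>)
  then show ?case using insert by simp
qed simp

text \<open>Both functionals agree on trigonometric polynomials by linearity, and their C^N bounds
  carry the agreement over to limits.\<close>

lemma pdistr_eq_on_test_fun:
  assumes g: "g \<in> pdistr" and h: "h \<in> pdistr" and eq: "\<And>\<xi>. g (cas \<xi>) = h (cas \<xi>)"
    and \<phi>: "\<phi> \<in> test_fun"
  shows "g \<phi> = h \<phi>"
proof -
  obtain C N where C: "\<And>\<phi> M. \<phi> \<in> test_fun \<Longrightarrow> (\<And>js x. length js \<le> N \<Longrightarrow> \<bar>partials js \<phi> x\<bar> \<le> M) \<Longrightarrow> \<bar>g \<phi>\<bar> \<le> C * M"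
    using g unfolding pdistr_def by blast
  obtain C' N' where C': "\<And>\<phi> M. \<phi> \<in> test_fun \<Longrightarrow> (\<And>js x. length js \<le> N' \<Longrightarrow> \<bar>partials js \<phi> x\<bar> \<le> M) \<Longrightarrow> \<bar>h \<phi>\<bar> \<le> C' * M"
    using h unfolding pdistr_def by blast
  have "\<bar>g \<phi> - h \<phi>\<bar> \<le> 0 + e" if e: "e > 0" for e
  proof -
    \<comment> \<open>Small enough that the two errors C d and C' d add up to at most e; absolute
      values appear because the constants carry no sign condition.\<close>
    define d where "d = e / (\<bar>C\<bar> + \<bar>C'\<bar> + 1)"
    have d: "d > 0" using e by (simp add: d_def add_nonneg_pos)
    obtain F where F: "finite F" "\<And>js x. length js \<le> max N N' \<Longrightarrow> \<bar>partials js (\<lambda>x. \<phi> x - hartley_sum \<phi> F x) x\<bar> \<le> d"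
      using test_fun_approximation[OF \<phi> d] by blast
    have S: "hartley_sum \<phi> F \<in> test_fun" using F(1) by (rule hartley_sum_test_fun)
    have "k (hartley_sum \<phi> F) = (\<Sum>\<xi>\<in>F. hcoef \<phi> \<xi> * k (cas \<xi>))" if "k \<in> pdistr" for k
      unfolding hartley_sum_def[abs_def]
      by (subst pdistr_sum[OF that F(1)]) (auto simp: pdistr_cmult[OF that test_fun_cas] intro: test_fun_cmult test_fun_cas)
    from this[OF g] this[OF h] have "g (hartley_sum \<phi> F) = h (hartley_sum \<phi> F)" using eq by simp
    then have "g \<phi> - h \<phi> = g (\<lambda>x. \<phi> x - hartley_sum \<phi> F x) - h (\<lambda>x. \<phi> x - hartley_sum \<phi> F x)"
      by (simp add: pdistr_diff g h \<phi> S)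
    moreover have "\<bar>g (\<lambda>x. \<phi> x - hartley_sum \<phi> F x)\<bar> \<le> C * d"
      by (rule C) (use F \<phi> S in \<open>auto intro: test_fun_diff\<close>)
    moreover have "\<bar>h (\<lambda>x. \<phi> x - hartley_sum \<phi> F x)\<bar> \<le> C' * d"
      by (rule C') (use F \<phi> S in \<open>auto intro: test_fun_diff\<close>)
    moreover have "C * d + C' * d \<le> (\<bar>C\<bar> + \<bar>C'\<bar> + 1) * d"
      unfolding distrib_right[symmetric] using d by (intro mult_right_mono) auto
    moreover have "(\<bar>C\<bar> + \<bar>C'\<bar> + 1) * d = e" by (simp add: d_def add_nonneg_pos less_imp_neq[symmetric])
    ultimately show ?thesis by linarith
  qed
  then have "\<bar>g \<phi> - h \<phi>\<bar> \<le> 0" by (rule field_le_epsilon)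
  then show ?thesis by simp
qed

lemma pdistr_eqI:
  assumes "g \<in> pdistr" "h \<in> pdistr" "\<And>\<xi>. g (cas \<xi>) = h (cas \<xi>)"
  shows "g = h"
proof (rule extensionalityI[of _ test_fun])
  show "g \<in> extensional test_fun" "h \<in> extensional test_fun" using assms by (auto simp: pdistr_def)
qed (rule pdistr_eq_on_test_fun[OF assms])

lemma ddiff_pdistr:
  assumes "g \<in> pdistr"
  shows "ddiff j g \<in> pdistr"
proof -
  obtain C N where C: "\<And>\<phi> M. \<phi> \<in> test_fun \<Longrightarrow> (\<And>js x. length js \<le> N \<Longrightarrow> \<bar>partials js \<phi> x\<bar> \<le> M) \<Longrightarrow> \<bar>g \<phi>\<bar> \<le> C * M"
    using assms unfolding pdistr_def by blast
  have "\<bar>g (partial j \<phi>)\<bar> \<le> C * M"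
    if \<phi>: "\<phi> \<in> test_fun" and M: "\<And>js x. length js \<le> Suc N \<Longrightarrow> \<bar>partials js \<phi> x\<bar> \<le> M" for \<phi> M
  proof (rule C)
    show "\<bar>partials js (partial j \<phi>) x\<bar> \<le> M" if "length js \<le> N" for js x
      using M[of "js @ [j]" x] that by simp
  qed (rule partial_test_fun[OF \<phi>])
  moreover have "partial j (\<lambda>x. \<phi> x + \<psi> x) = (\<lambda>x. partial j \<phi> x + partial j \<psi> x)"
    if "\<phi> \<in> test_fun" "\<psi> \<in> test_fun" for \<phi> \<psi>
    using partials_add[OF that, of "[j]"] by simp
  moreover have "partial j (\<lambda>x. c * \<phi> x) = (\<lambda>x. c * partial j \<phi> x)" if "\<phi> \<in> test_fun" for c \<phi>
    using partials_cmult[OF that, of "[j]"] by simp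
  ultimately show ?thesis
    using assms unfolding pdistr_def ddiff_def
    by (auto simp: test_fun_add test_fun_cmult partial_test_fun intro!: exI[of _ C] exI[of _ "Suc N"])
qed

lemma pdistr_lincomb:
  assumes "finite I" "\<And>i. i \<in> I \<Longrightarrow> g i \<in> pdistr"
  shows "(\<lambda>\<phi>\<in>test_fun. \<Sum>i\<in>I. c i * g i \<phi>) \<in> pdistr"
proof -
  have "\<exists>C N. \<forall>\<phi>\<in>test_fun. \<forall>M. (\<forall>js x. length js \<le> N \<longrightarrow> \<bar>partials js \<phi> x\<bar> \<le> M)
      \<longrightarrow> \<bar>\<Sum>i\<in>I. c i * g i \<phi>\<bar> \<le> C * M"
    using assms
  proof (induction I rule: finite_induct)
    case empty
    show ?case by (rule exI[of _ 0]) simp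
  next
    case (insert i I)
    obtain C N where C: "\<And>\<phi> M. \<phi> \<in> test_fun \<Longrightarrow> (\<And>js x. length js \<le> N \<Longrightarrow> \<bar>partials js \<phi> x\<bar> \<le> M) \<Longrightarrow>
        \<bar>\<Sum>i\<in>I. c i * g i \<phi>\<bar> \<le> C * M"
      using insert by (metis insertCI)
    obtain C' N' where C': "\<And>\<phi> M. \<phi> \<in> test_fun \<Longrightarrow> (\<And>js x. length js \<le> N' \<Longrightarrow> \<bar>partials js \<phi> x\<bar> \<le> M) \<Longrightarrow>
        \<bar>g i \<phi>\<bar> \<le> C' * M"
      using insert.prems[of i] unfolding pdistr_def by blast
    have "\<bar>\<Sum>i\<in>insert i I. c i * g i \<phi>\<bar> \<le> (\<bar>c i\<bar> * C' + C) * M"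
      if "\<phi> \<in> test_fun" "\<And>js x. length js \<le> max N N' \<Longrightarrow> \<bar>partials js \<phi> x\<bar> \<le> M" for \<phi> M
    proof -
      have "\<bar>\<Sum>i\<in>insert i I. c i * g i \<phi>\<bar> \<le> \<bar>c i\<bar> * \<bar>g i \<phi>\<bar> + \<bar>\<Sum>i\<in>I. c i * g i \<phi>\<bar>"
        using insert by (simp add: abs_mult[symmetric] abs_triangle_ineq)
      also have "\<dots> \<le> \<bar>c i\<bar> * (C' * M) + C * M"
        using that by (intro add_mono mult_left_mono C C') auto
      finally show ?thesis by (simp add: algebra_simps)
    qed
    then show ?case by blast
  qed
  moreover have "(\<Sum>i\<in>I. c i * g i (\<lambda>x. \<phi> x + \<psi> x)) = (\<Sum>i\<in>I. c i * g i \<phi>) + (\<Sum>i\<in>I. c i * g i \<psi>)"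
    if "\<phi> \<in> test_fun" "\<psi> \<in> test_fun" for \<phi> \<psi>
    using assms that by (simp add: pdistr_add sum.distrib[symmetric] distrib_left)
  moreover have "(\<Sum>i\<in>I. c i * g i (\<lambda>x. d * \<phi> x)) = d * (\<Sum>i\<in>I. c i * g i \<phi>)"
    if "\<phi> \<in> test_fun" for \<phi> d
    using assms that by (simp add: pdistr_cmult sum_distrib_left mult.left_commute)
  ultimately show ?thesis
    unfolding pdistr_def by (auto simp: test_fun_add test_fun_cmult)
qed

lemma ddiff_cas:
  assumes "g \<in> pdistr"
  shows "ddiff j g (cas \<xi>) = - 2 * pi * of_int (\<xi> $ j) * g (cas (- \<xi>))"
  using pdistr_cmult[OF assms test_fun_cas, of "2 * pi * of_int (\<xi> $ j)" "- \<xi>"]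
  by (simp add: ddiff_def test_fun_cas partial_cas)

lemma regular_apply:
  fixes g :: "real^'n \<Rightarrow> real"
  shows "\<phi> \<in> test_fun \<Longrightarrow> regular g \<phi> = (\<integral>x. g x * \<phi> x \<partial>torus)"
  by (simp add: regular_def set_integral_torus_cell)

lemma regular_cas: "regular g (cas \<xi>) = hcoef g \<xi>"
  by (simp add: regular_apply test_fun_cas hcoef_def)

lemma regular_pdistr:
  fixes g :: "real^'n \<Rightarrow> real"
  assumes g: "integrable torus g"
  shows "regular g \<in> pdistr"
proof -
  have i: "integrable torus (\<lambda>x. g x * \<phi> x)" if "\<phi> \<in> test_fun" for \<phi>
    using g that by (rule integrable_torus_mult_test_fun)
  have "\<bar>regular g \<phi>\<bar> \<le> (\<integral>x. \<bar>g x\<bar> \<partial>torus) * M"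
    if \<phi>: "\<phi> \<in> test_fun" and M: "\<And>x. \<bar>\<phi> x\<bar> \<le> M" for \<phi> M
  proof -
    have "\<bar>regular g \<phi>\<bar> \<le> (\<integral>x. \<bar>g x * \<phi> x\<bar> \<partial>torus)"
      unfolding regular_apply[OF \<phi>] by (rule integral_abs_bound)
    also have "\<dots> \<le> (\<integral>x. \<bar>g x\<bar> * M \<partial>torus)"
    proof (rule integral_mono)
      show "integrable torus (\<lambda>x. \<bar>g x * \<phi> x\<bar>)" by (rule integrable_abs[OF i[OF \<phi>]])
    qed (use g M in \<open>auto simp: abs_mult intro!: mult_left_mono\<close>)
    finally show ?thesis by simp
  qed
  then have b: "\<exists>C N. \<forall>\<phi>\<in>test_fun. \<forall>M. (\<forall>js x. length js \<le> N \<longrightarrow> \<bar>partials js \<phi> x\<bar> \<le> M) \<longrightarrow> \<bar>regular g \<phi>\<bar> \<le> C * M"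
    by (intro exI[of _ "\<integral>x. \<bar>g x\<bar> \<partial>torus"] exI[of _ 0]) auto
  have "regular g \<in> extensional test_fun" by (simp add: regular_def)
  then show ?thesis using b i unfolding pdistr_def
    by (auto simp: regular_apply test_fun_add test_fun_cmult distrib_left mult.left_commute)
qed

lemma L1_perD:
  assumes "g \<in> L1_per"
  shows "periodic g" "g \<in> borel_measurable borel" "integrable torus g"
  using assms by (auto simp: L1_per_def set_integrable_torus_cell)

text \<open>The choice made by \<open>fun_of\<close> has the same Hartley coefficients as h, so
  completeness identifies it with h up to a null set.\<close>

lemma fun_of_regular:
  assumes h: "h \<in> L1_per"
  shows "fun_of (regular h) \<in> borel_measurable borel" "integrable torus (fun_of (regular h))"
    "AE x in torus. fun_of (regular h) x = h x"
proof -
  have "fun_of (regular h) \<in> L1_per \<and> regular (fun_of (regular h)) = regular h"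
    unfolding fun_of_def by (rule someI[of _ h]) (use h in simp)
  then have f: "fun_of (regular h) \<in> L1_per" and e: "regular (fun_of (regular h)) = regular h" by auto
  show "fun_of (regular h) \<in> borel_measurable borel" "integrable torus (fun_of (regular h))"
    using L1_perD[OF f] by auto
  have "hcoef (fun_of (regular h)) \<xi> = hcoef h \<xi>" for \<xi>
    using fun_cong[OF e, of "cas \<xi>"] by (simp add: regular_cas)
  then show "AE x in torus. fun_of (regular h) x = h x"
    by (intro hcoef_unique L1_perD f h)
qed

text \<open>Real and imaginary part are half sum and half difference of two Hartley coefficients,
  and the cross terms of the squares cancel. As Sobolev weights are even in xi, the average over xi
  and -xi disappears after summation over all frequencies.\<close>

lemma fourier_hartley:
  assumes "g \<in> pdistr"
  shows "(cmod (fourier g \<xi>))\<^sup>2 = ((g (cas \<xi>))\<^sup>2 + (g (cas (- \<xi>)))\<^sup>2) / 2"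
    "fourier g \<xi> = 0 \<longleftrightarrow> g (cas \<xi>) = 0 \<and> g (cas (- \<xi>)) = 0"
proof -
  have "g (\<lambda>x. (1/2) * (cas \<xi> x + cas (- \<xi>) x)) = (1/2) * (g (cas \<xi>) + g (cas (- \<xi>)))"
    using pdistr_cmult[OF assms test_fun_add[OF test_fun_cas test_fun_cas], of "1/2" \<xi> "- \<xi>"]
      pdistr_add[OF assms test_fun_cas test_fun_cas, of \<xi> "- \<xi>"] by simp
  moreover have "g (\<lambda>x. (1/2) * (cas \<xi> x - cas (- \<xi>) x)) = (1/2) * (g (cas \<xi>) - g (cas (- \<xi>)))"
    using pdistr_cmult[OF assms test_fun_diff[OF test_fun_cas test_fun_cas], of "1/2" \<xi> "- \<xi>"]
      pdistr_diff[OF assms test_fun_cas test_fun_cas, of \<xi> "- \<xi>"] by simp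
  ultimately have f: "fourier g \<xi> = Complex ((g (cas \<xi>) + g (cas (- \<xi>))) / 2) (- ((g (cas \<xi>) - g (cas (- \<xi>))) / 2))"
    unfolding fourier_def cos_freq sin_freq by simp
  show "(cmod (fourier g \<xi>))\<^sup>2 = ((g (cas \<xi>))\<^sup>2 + (g (cas (- \<xi>)))\<^sup>2) / 2"
    unfolding f cmod_power2 by (simp add: power2_eq_square field_simps)
  show "fourier g \<xi> = 0 \<longleftrightarrow> g (cas \<xi>) = 0 \<and> g (cas (- \<xi>)) = 0"
    unfolding f by (auto simp: complex_eq_iff)
qed


section \<open>Square integrable functions and the Riesz--Fischer theorem\<close>

lemma quadratic_nonneg_imp_discriminant:
  fixes A B C :: real
  assumes "\<And>t. 0 \<le> A + 2 * t * B + t\<^sup>2 * C"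
  shows "B\<^sup>2 \<le> A * C"
proof (cases "C = 0")
  case True
  show ?thesis
  proof (cases "B = 0")
    case False
    then have "A + 2 * (- (A + 1) / (2 * B)) * B = -1" by (simp add: field_simps)
    then show ?thesis using assms[of "- (A + 1) / (2 * B)"] True by simp
  qed (use True in simp)
next
  case False
  have "C > 0"
  proof (rule ccontr)
    assume "\<not> C > 0"
    then have C: "C < 0" using False by simp
    \<comment> \<open>Large enough that t C outweighs |A| + 2 |B|, and at least 1 so that A is
      bounded by t |A|.\<close>
    define t where "t = (\<bar>A\<bar> + 2 * \<bar>B\<bar> + 1) / (- C) + 1"
    have t: "t \<ge> 1" using C by (simp add: t_def divide_nonneg_neg)
    have tC: "t * C = C - (\<bar>A\<bar> + 2 * \<bar>B\<bar> + 1)" using C by (simp add: t_def field_simps)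
    have "A + 2 * t * B + t\<^sup>2 * C \<le> t * (\<bar>A\<bar> + 2 * \<bar>B\<bar> + t * C)"
    proof -
      have "A \<le> t * \<bar>A\<bar>" using t mult_right_mono[of 1 t "\<bar>A\<bar>"] by simp
      moreover have "2 * t * B \<le> t * (2 * \<bar>B\<bar>)" using t by simp
      ultimately show ?thesis by (simp add: algebra_simps power2_eq_square)
    qed
    also have "\<dots> < 0" unfolding tC using t C by (intro mult_pos_neg) auto
    finally show False using assms[of t] by simp
  qed
  have "A + 2 * (- B / C) * B + (- B / C)\<^sup>2 * C = A - B\<^sup>2 / C"
    using False by (simp add: field_simps power2_eq_square)
  then have "0 \<le> A - B\<^sup>2 / C" using assms[of "- B / C"] by simp
  then show ?thesis using \<open>C > 0\<close> by (simp add: field_simps)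
qed

lemma integrable_mult_square_integrable:
  fixes f g :: "'a \<Rightarrow> real"
  assumes [measurable]: "f \<in> borel_measurable M" "g \<in> borel_measurable M"
    and "integrable M (\<lambda>x. (f x)\<^sup>2)" "integrable M (\<lambda>x. (g x)\<^sup>2)"
  shows "integrable M (\<lambda>x. f x * g x)"
proof (rule Bochner_Integration.integrable_bound)
  show "integrable M (\<lambda>x. (f x)\<^sup>2 + (g x)\<^sup>2)" using assms by simp
  have "\<bar>a * b\<bar> \<le> \<bar>a\<^sup>2 + b\<^sup>2\<bar>" for a b :: real
    using sum_squares_bound[of "\<bar>a\<bar>" "\<bar>b\<bar>"] mult_nonneg_nonneg[of "\<bar>a\<bar>" "\<bar>b\<bar>"]
    unfolding abs_mult power2_abs by linarith
  then show "AE x in M. norm (f x * g x) \<le> norm ((f x)\<^sup>2 + (g x)\<^sup>2)" by simp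
qed measurable

lemma integral_Cauchy_Schwarz:
  fixes f g :: "'a \<Rightarrow> real"
  assumes m: "f \<in> borel_measurable M" "g \<in> borel_measurable M"
    and i: "integrable M (\<lambda>x. (f x)\<^sup>2)" "integrable M (\<lambda>x. (g x)\<^sup>2)"
  shows "\<bar>\<integral>x. f x * g x \<partial>M\<bar> \<le> sqrt (\<integral>x. (f x)\<^sup>2 \<partial>M) * sqrt (\<integral>x. (g x)\<^sup>2 \<partial>M)"
proof -
  have fg: "integrable M (\<lambda>x. f x * g x)" by (rule integrable_mult_square_integrable[OF m i])
  have "0 \<le> (\<integral>x. (f x)\<^sup>2 \<partial>M) + 2 * t * (\<integral>x. f x * g x \<partial>M) + t\<^sup>2 * (\<integral>x. (g x)\<^sup>2 \<partial>M)" for t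
  proof -
    have "0 \<le> (\<integral>x. (f x + t * g x)\<^sup>2 \<partial>M)" by simp
    also have "\<dots> = (\<integral>x. (f x)\<^sup>2 + 2 * t * (f x * g x) + t\<^sup>2 * (g x)\<^sup>2 \<partial>M)"
      by (intro Bochner_Integration.integral_cong) (auto simp: power2_eq_square algebra_simps)
    also have "\<dots> = (\<integral>x. (f x)\<^sup>2 \<partial>M) + 2 * t * (\<integral>x. f x * g x \<partial>M) + t\<^sup>2 * (\<integral>x. (g x)\<^sup>2 \<partial>M)"
      using i fg by simp
    finally show ?thesis .
  qed
  then have "(\<integral>x. f x * g x \<partial>M)\<^sup>2 \<le> (\<integral>x. (f x)\<^sup>2 \<partial>M) * (\<integral>x. (g x)\<^sup>2 \<partial>M)"
    by (rule quadratic_nonneg_imp_discriminant)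
  then have "sqrt ((\<integral>x. f x * g x \<partial>M)\<^sup>2) \<le> sqrt ((\<integral>x. (f x)\<^sup>2 \<partial>M) * (\<integral>x. (g x)\<^sup>2 \<partial>M))"
    by (rule real_sqrt_le_mono)
  then show ?thesis by (simp add: real_sqrt_mult)
qed

text \<open>Fatou's lemma for the squares, with the bound required only from some index on. It
  serves twice in the Riesz-Fischer proof: for the partial sums, and for their differences from a
  fixed partial sum, which are controlled only for later indices.\<close>

lemma fatou_square_integrable:
  fixes u :: "nat \<Rightarrow> 'a \<Rightarrow> real"
  assumes [measurable]: "\<And>m. u m \<in> borel_measurable M" "v \<in> borel_measurable M"
    and lim: "AE x in M. (\<lambda>m. u m x) \<longlonglongrightarrow> v x"
    and i: "\<And>m. m \<ge> N \<Longrightarrow> integrable M (\<lambda>x. (u m x)\<^sup>2)"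
    and le: "\<And>m. m \<ge> N \<Longrightarrow> (\<integral>x. (u m x)\<^sup>2 \<partial>M) \<le> B"
  shows "integrable M (\<lambda>x. (v x)\<^sup>2)" "(\<integral>x. (v x)\<^sup>2 \<partial>M) \<le> B"
proof -
  have B: "B \<ge> 0" by (rule order_trans[OF Bochner_Integration.integral_nonneg le[of N]]) auto
  have "(\<integral>\<^sup>+x. ennreal ((v x)\<^sup>2) \<partial>M) = (\<integral>\<^sup>+x. liminf (\<lambda>m. ennreal ((u m x)\<^sup>2)) \<partial>M)"
  proof (rule nn_integral_cong_AE)
    show "AE x in M. ennreal ((v x)\<^sup>2) = liminf (\<lambda>m. ennreal ((u m x)\<^sup>2))"
      using lim
    proof eventually_elim
      case (elim x)
      then have "(\<lambda>m. ennreal ((u m x)\<^sup>2)) \<longlonglongrightarrow> ennreal ((v x)\<^sup>2)"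
        by (intro tendsto_ennrealI tendsto_power)
      then show ?case by (rule lim_imp_Liminf[OF sequentially_bot, symmetric])
    qed
  qed
  also have "\<dots> \<le> liminf (\<lambda>m. \<integral>\<^sup>+x. ennreal ((u m x)\<^sup>2) \<partial>M)"
    by (rule nn_integral_liminf) measurable
  also have "\<dots> \<le> ennreal B"
  proof (rule Liminf_le)
    have "(\<integral>\<^sup>+x. ennreal ((u m x)\<^sup>2) \<partial>M) \<le> ennreal B" if "m \<ge> N" for m
      using le[OF that] by (subst nn_integral_eq_integral[OF i[OF that]]) (auto intro: ennreal_leI)
    then show "\<forall>\<^sub>F m in sequentially. (\<integral>\<^sup>+x. ennreal ((u m x)\<^sup>2) \<partial>M) \<le> ennreal B"
      unfolding eventually_sequentially by blast
  qed simp
  finally have *: "(\<integral>\<^sup>+x. ennreal ((v x)\<^sup>2) \<partial>M) \<le> ennreal B" .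
  then show "integrable M (\<lambda>x. (v x)\<^sup>2)"
    by (intro integrableI_bounded) (auto simp: le_less_trans[OF _ ennreal_less_top])
  then show "(\<integral>x. (v x)\<^sup>2 \<partial>M) \<le> B"
    using * B by (simp add: nn_integral_eq_integral)
qed

definition L2_per :: "(real^'n \<Rightarrow> real) set" where
  "L2_per = {g. periodic g \<and> g \<in> borel_measurable borel \<and> integrable torus (\<lambda>x. (g x)\<^sup>2)}"

lemma L2_perD:
  assumes "g \<in> L2_per"
  shows "periodic g" "g \<in> borel_measurable borel" "integrable torus (\<lambda>x. (g x)\<^sup>2)"
    "integrable torus g"
proof -
  show m: "periodic g" "g \<in> borel_measurable borel" "integrable torus (\<lambda>x. (g x)\<^sup>2)"
    using assms by (auto simp: L2_per_def)
  then show "integrable torus g"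
    using integrable_mult_square_integrable[of g torus "\<lambda>_. 1"] by simp
qed

lemma L2_per_L1_per: "g \<in> L2_per \<Longrightarrow> g \<in> L1_per"
  using L2_perD[of g] by (auto simp: L1_per_def set_integrable_torus_cell)

lemma trig_poly_square_integral:
  assumes "finite F"
  shows "integrable torus (\<lambda>x. (\<Sum>\<xi>\<in>F. c \<xi> * cas \<xi> x)\<^sup>2)"
    "(\<integral>x. (\<Sum>\<xi>\<in>F. c \<xi> * cas \<xi> x)\<^sup>2 \<partial>torus) = (\<Sum>\<xi>\<in>F. (c \<xi>)\<^sup>2)"
proof -
  have e: "(\<Sum>\<xi>\<in>F. c \<xi> * cas \<xi> x)\<^sup>2 = (\<Sum>\<eta>\<in>F. c \<eta> * ((\<Sum>\<xi>\<in>F. c \<xi> * cas \<xi> x) * cas \<eta> x))" for x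
    by (simp add: power2_eq_square sum_distrib_left mult.assoc mult.left_commute)
  have t: "(\<lambda>x. \<Sum>\<xi>\<in>F. c \<xi> * cas \<xi> x) \<in> test_fun"
    by (intro test_fun_sum test_fun_cmult test_fun_cas assms)
  have i: "integrable torus (\<lambda>x. c \<eta> * ((\<Sum>\<xi>\<in>F. c \<xi> * cas \<xi> x) * cas \<eta> x))" for \<eta>
    by (intro integrable_mult_right integrable_mult_cas integrable_test_fun t)
  show "integrable torus (\<lambda>x. (\<Sum>\<xi>\<in>F. c \<xi> * cas \<xi> x)\<^sup>2)"
    unfolding e by (intro Bochner_Integration.integrable_sum i)
  have "(\<integral>x. (\<Sum>\<xi>\<in>F. c \<xi> * cas \<xi> x)\<^sup>2 \<partial>torus)
      = (\<Sum>\<eta>\<in>F. c \<eta> * hcoef (\<lambda>x. \<Sum>\<xi>\<in>F. c \<xi> * cas \<xi> x) \<eta>)"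
    unfolding e hcoef_def
    by (subst Bochner_Integration.integral_sum, rule i) (simp only: integral_mult_right_zero)
  also have "\<dots> = (\<Sum>\<eta>\<in>F. (c \<eta>)\<^sup>2)"
    unfolding hcoef_trig_poly[OF assms] by (intro sum.cong) (auto simp: power2_eq_square)
  finally show "(\<integral>x. (\<Sum>\<xi>\<in>F. c \<xi> * cas \<xi> x)\<^sup>2 \<partial>torus) = (\<Sum>\<xi>\<in>F. (c \<xi>)\<^sup>2)" .
qed

text \<open>Unordered summability provides finite sets outside which every finite sum is small;
  unions make them increasing. Tails of size 4^(-k) are asked because they will be squares of L2
  norms: the norms are then at most 2^(-k), a summable bound.\<close>

lemma summable_on_exhausting_sequence:
  fixes f :: "'a \<Rightarrow> real"
  assumes f: "f summable_on UNIV" and nonneg: "\<And>i. f i \<ge> 0"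
  obtains F :: "nat \<Rightarrow> 'a set" where "\<And>k. finite (F k)" "mono F"
    "\<And>k G. finite G \<Longrightarrow> G \<inter> F k = {} \<Longrightarrow> sum f G \<le> (1/4) ^ k"
proof -
  have "\<exists>A. finite A \<and> (\<forall>G. finite G \<and> G \<inter> A = {} \<longrightarrow> sum f G \<le> (1/4) ^ k)" for k :: nat
  proof -
    have "((\<lambda>A. sum f A) \<longlongrightarrow> infsum f UNIV) (finite_subsets_at_top UNIV)"
      using has_sum_infsum[OF f] by (simp add: has_sum_def)
    then have "eventually (\<lambda>A. infsum f UNIV - (1/4) ^ k < sum f A) (finite_subsets_at_top UNIV)"
      by (rule order_tendstoD) simp
    then obtain A where A: "finite A" "infsum f UNIV - (1/4) ^ k < sum f A"
      unfolding eventually_finite_subsets_at_top by blast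
    have "sum f G \<le> (1/4) ^ k" if "finite G" "G \<inter> A = {}" for G
    proof -
      have "sum f G + sum f A = sum f (G \<union> A)" using that A(1) by (simp add: sum.union_disjoint)
      also have "\<dots> \<le> infsum f UNIV"
        by (rule finite_sum_le_infsum[OF f]) (use that A(1) nonneg in auto)
      finally show ?thesis using A(2) by simp
    qed
    then show ?thesis using A(1) by blast
  qed
  then obtain A where A: "\<And>k. finite (A k)" "\<And>k G. finite G \<Longrightarrow> G \<inter> A k = {} \<Longrightarrow> sum f G \<le> (1/4) ^ k"
    by metis
  show ?thesis
  proof (rule that[of "\<lambda>k. \<Union>i\<le>k. A i"])
    show "mono (\<lambda>k. \<Union>i\<le>k. A i)" by (intro monoI UN_mono) auto
    show "sum f G \<le> (1/4) ^ k" if "finite G" "G \<inter> (\<Union>i\<le>k. A i) = {}" for k G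
      by (rule A(2)) (use that in auto)
  qed (use A(1) in simp)
qed

text \<open>Along the rapidly exhausting sets the increments of the partial sums have L1 norm at
  most 2^(-k), so the partial sums converge almost everywhere. Fatou bounds the limit and its L2
  distance to the partial sums, and the latter determines its coefficients.\<close>

theorem riesz_fischer:
  fixes c :: "int^'n \<Rightarrow> real"
  assumes c: "(\<lambda>\<xi>. (c \<xi>)\<^sup>2) summable_on UNIV"
  obtains g where "g \<in> L2_per" "\<And>\<xi>. hcoef g \<xi> = c \<xi>"
    "(\<integral>x. (g x)\<^sup>2 \<partial>torus) \<le> (\<Sum>\<^sub>\<infinity>\<xi>. (c \<xi>)\<^sup>2)"
proof -
  obtain F :: "nat \<Rightarrow> (int^'n) set" where F: "\<And>k. finite (F k)" "mono F"
    "\<And>k G. finite G \<Longrightarrow> G \<inter> F k = {} \<Longrightarrow> (\<Sum>\<xi>\<in>G. (c \<xi>)\<^sup>2) \<le> (1/4) ^ k"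
    by (rule summable_on_exhausting_sequence[OF c]) auto
  define S where "S k x = (\<Sum>\<xi>\<in>F k. c \<xi> * cas \<xi> x)" for k and x :: "real^'n"
  have [measurable]: "S k \<in> borel_measurable borel" for k unfolding S_def by measurable
  have S_diff: "S m x - S k x = (\<Sum>\<xi>\<in>F m - F k. c \<xi> * cas \<xi> x)" if "k \<le> m" for k m x
    unfolding S_def by (rule sum_diff[OF F(1) monoD[OF F(2) that], symmetric])
  have S_sq: "integrable torus (\<lambda>x. (S m x - S k x)\<^sup>2)"
    "(\<integral>x. (S m x - S k x)\<^sup>2 \<partial>torus) \<le> (1/4) ^ k" if "k \<le> m" for k m
  proof -
    have fin: "finite (F m - F k)" using F(1) by blast
    show "integrable torus (\<lambda>x. (S m x - S k x)\<^sup>2)"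
      unfolding S_diff[OF that] by (rule trig_poly_square_integral(1)[OF fin])
    show "(\<integral>x. (S m x - S k x)\<^sup>2 \<partial>torus) \<le> (1/4) ^ k"
      unfolding S_diff[OF that] trig_poly_square_integral(2)[OF fin] by (rule F(3)[OF fin]) blast
  qed
  define d where "d k x = \<bar>S (Suc k) x - S k x\<bar>" for k x
  have [measurable]: "d k \<in> borel_measurable borel" for k unfolding d_def by measurable
  have d_int: "(\<integral>\<^sup>+x. ennreal (d k x) \<partial>torus) \<le> ennreal ((1/2) ^ k)" for k
  proof -
    have i: "integrable torus (\<lambda>x. (d k x)\<^sup>2)" and le: "(\<integral>x. (d k x)\<^sup>2 \<partial>torus) \<le> (1/4) ^ k"
      using S_sq[of k "Suc k"] by (auto simp: d_def)
    have id: "integrable torus (d k)"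
      using integrable_mult_square_integrable[of "d k" torus "\<lambda>_. 1"] i by simp
    have "(\<integral>x. d k x \<partial>torus) \<le> \<bar>\<integral>x. d k x * 1 \<partial>torus\<bar>" by simp
    also have "\<dots> \<le> sqrt (\<integral>x. (d k x)\<^sup>2 \<partial>torus) * sqrt (\<integral>x. 1\<^sup>2 \<partial>(torus :: (real^'n) measure))"
      by (rule integral_Cauchy_Schwarz) (use i in auto)
    also have "\<dots> \<le> sqrt ((1/4) ^ k)" using le by (simp add: space_torus measure_torus)
    also have "\<dots> = (1/2) ^ k"
      by (simp add: real_sqrt_power real_sqrt_divide)
    finally show ?thesis
      by (subst nn_integral_eq_integral[OF id]) (auto simp: d_def[abs_def] intro!: ennreal_leI)
  qed
  have "(\<integral>\<^sup>+x. (\<Sum>k. ennreal (d k x)) \<partial>torus) = (\<Sum>k. \<integral>\<^sup>+x. ennreal (d k x) \<partial>torus)"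
    by (rule nn_integral_suminf) measurable
  also have "\<dots> \<le> (\<Sum>k. ennreal ((1/2) ^ k))" by (intro suminf_le d_int) auto
  also have "\<dots> = ennreal (\<Sum>k. (1/2) ^ k)" by (rule suminf_ennreal2) (auto intro: summable_geometric)
  also have "\<dots> < \<infinity>" by simp
  finally have "(\<integral>\<^sup>+x. (\<Sum>k. ennreal (d k x)) \<partial>torus) \<noteq> \<infinity>" by simp
  then have "AE x in torus. (\<Sum>k. ennreal (d k x)) \<noteq> \<infinity>"
    by (intro nn_integral_PInf_AE) auto
  then have ae: "AE x in torus. convergent (\<lambda>k. S k x)"
  proof eventually_elim
    case (elim x)
    then have "summable (\<lambda>k. d k x)" by (intro summable_suminf_not_top) (auto simp: d_def)
    then have "summable (\<lambda>k. S (Suc k) x - S k x)"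
      unfolding d_def by (rule summable_rabs_cancel)
    then have "convergent (\<lambda>n. \<Sum>k<n. S (Suc k) x - S k x)" by (simp add: summable_iff_convergent)
    then have "convergent (\<lambda>n. S n x - S 0 x)"
      unfolding sum_lessThan_telescope[of "\<lambda>k. S k x"] .
    then have "convergent (\<lambda>n. (S n x - S 0 x) + S 0 x)" by (intro convergent_add convergent_const)
    then show ?case by simp
  qed
  \<comment> \<open>\<open>lim\<close> has a value also where the sequence diverges and depends only
    on the sequence, so g is measurable and periodic without exceptional points.\<close>
  define g where "g x = lim (\<lambda>k. S k x)" for x
  have [measurable]: "g \<in> borel_measurable borel" unfolding g_def by measurable
  have lim: "AE x in torus. (\<lambda>k. S k x) \<longlonglongrightarrow> g x"
    using ae by eventually_elim (simp add: g_def convergent_LIMSEQ_iff)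
  have per: "periodic g"
  proof -
    have "periodic (S k)" for k unfolding S_def by (intro periodic_sum periodic_mult periodic_const periodic_cas)
    then show ?thesis by (simp add: periodic_def g_def)
  qed
  have "(\<integral>x. (S m x)\<^sup>2 \<partial>torus) \<le> (\<Sum>\<^sub>\<infinity>\<xi>. (c \<xi>)\<^sup>2)" for m
    unfolding S_def trig_poly_square_integral(2)[OF F(1)]
    by (rule finite_sum_le_infsum[OF c]) (use F(1) in auto)
  then have g2: "integrable torus (\<lambda>x. (g x)\<^sup>2)"
    "(\<integral>x. (g x)\<^sup>2 \<partial>torus) \<le> (\<Sum>\<^sub>\<infinity>\<xi>. (c \<xi>)\<^sup>2)"
    using fatou_square_integrable[of S torus g 0, OF _ _ lim]
      trig_poly_square_integral(1)[OF F(1)] by (auto simp: S_def)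
  have gL: "g \<in> L2_per" using per g2 by (simp add: L2_per_def)
  have gS: "integrable torus (\<lambda>x. (g x - S k x)\<^sup>2)" "(\<integral>x. (g x - S k x)\<^sup>2 \<partial>torus) \<le> (1/4) ^ k" for k
  proof -
    have "AE x in torus. (\<lambda>m. S m x - S k x) \<longlonglongrightarrow> g x - S k x"
      using lim by eventually_elim (intro tendsto_intros)
    from fatou_square_integrable[OF _ _ this, of k "(1/4) ^ k"] S_sq[of k]
    show "integrable torus (\<lambda>x. (g x - S k x)\<^sup>2)" "(\<integral>x. (g x - S k x)\<^sup>2 \<partial>torus) \<le> (1/4) ^ k"
      by auto
  qed
  have Si: "integrable torus (S k)" for k
    unfolding S_def by (intro Bochner_Integration.integrable_sum integrable_mult_right integrable_cas)
  have coef_g: "\<bar>hcoef g \<xi> - c \<xi>\<bar> \<le> (1/2) ^ k" if "\<xi> \<in> F k \<or> c \<xi> = 0" for \<xi> k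
  proof -
    have "hcoef (S k) \<xi> = c \<xi>"
      unfolding S_def hcoef_trig_poly[OF F(1)] using that by auto
    then have "\<bar>hcoef g \<xi> - c \<xi>\<bar> = \<bar>\<integral>x. (g x - S k x) * cas \<xi> x \<partial>torus\<bar>"
      using hcoef_diff[OF L2_perD(4)[OF gL] Si] by (simp add: hcoef_def)
    also have "\<dots> \<le> sqrt (\<integral>x. (g x - S k x)\<^sup>2 \<partial>torus) * sqrt (\<integral>x. (cas \<xi> x)\<^sup>2 \<partial>torus)"
    proof (rule integral_Cauchy_Schwarz)
      show "integrable torus (\<lambda>x. (cas \<xi> x)\<^sup>2)"
        using integrable_mult_cas[OF integrable_cas, of \<xi> \<xi>] by (simp add: power2_eq_square)
    qed (use gS in auto)
    also have "\<dots> \<le> sqrt ((1/4) ^ k)"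
      using cas_orthonormal[of \<xi> \<xi>] gS(2)[of k] by (simp add: power2_eq_square)
    also have "\<dots> = (1/2) ^ k" by (simp add: real_sqrt_power real_sqrt_divide)
    finally show ?thesis .
  qed
  have "hcoef g \<xi> = c \<xi>" for \<xi>
  proof -
    \<comment> \<open>The sets F k need not exhaust all frequencies; a frequency that is never
      reached lies in every tail, and so its coefficient is 0.\<close>
    have "\<exists>K. \<forall>k\<ge>K. \<xi> \<in> F k \<or> c \<xi> = 0"
    proof (cases "\<exists>k. \<xi> \<in> F k")
      case True
      then show ?thesis using monoD[OF F(2)] by blast
    next
      case False
      then have "(c \<xi>)\<^sup>2 \<le> (1/4) ^ k" for k using F(3)[of "{\<xi>}" k] by simp
      moreover have "(\<lambda>k. (1/4) ^ k :: real) \<longlonglongrightarrow> 0" by (rule LIMSEQ_power_zero) simp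
      ultimately have "(c \<xi>)\<^sup>2 \<le> 0" by (intro LIMSEQ_le_const) auto
      then show ?thesis by simp
    qed
    then obtain K where "\<bar>hcoef g \<xi> - c \<xi>\<bar> \<le> (1/2) ^ k" if "k \<ge> K" for k
      using coef_g by blast
    moreover have "(\<lambda>k. (1/2) ^ k :: real) \<longlonglongrightarrow> 0" by (rule LIMSEQ_power_zero) simp
    ultimately have "\<bar>hcoef g \<xi> - c \<xi>\<bar> \<le> 0" by (intro LIMSEQ_le_const) auto
    then show ?thesis by simp
  qed
  then show ?thesis using that gL g2(2) by blast
qed


section \<open>Velocity fields in terms of their Hartley coefficients\<close>

text \<open>An element \<open>x\<close> of \<open>ell2\<close> encodes the field in \<open>H_vec 1\<close> whose \<open>k\<close>-th component has Hartley
  coefficients \<open>coef x (\<xi>, k) / bessel \<xi>\<close>; this makes the encoding an isometry.\<close>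

type_synonym 'n modes = "((int^'n) \<times> 'n) ell2"

definition bessel :: "int^'n \<Rightarrow> real" where
  "bessel \<xi> = sqrt (1 + (norm (freq \<xi>))\<^sup>2)"

lemma bessel_pos: "bessel \<xi> > 0" and bessel_ge_1: "bessel \<xi> \<ge> 1"
  by (simp_all add: bessel_def add_pos_nonneg)

lemma bessel_neq_0 [simp]: "bessel \<xi> \<noteq> 0"
  using bessel_pos[of \<xi>] by simp

lemma bessel_square: "(bessel \<xi>)\<^sup>2 = 1 + (norm (freq \<xi>))\<^sup>2"
  by (simp add: bessel_def)

lemma bessel_uminus [simp]: "bessel (- \<xi>) = bessel \<xi>"
  by (simp add: bessel_def)

lemma freq_component_le_bessel: "\<bar>real_of_int (\<xi> $ j)\<bar> \<le> bessel \<xi>"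
proof -
  have "\<bar>real_of_int (\<xi> $ j)\<bar> \<le> norm (freq \<xi>)" using component_le_norm_cart[of "freq \<xi>" j] by simp
  also have "\<dots> \<le> bessel \<xi>" unfolding bessel_def by (rule real_le_rsqrt) simp
  finally show ?thesis .
qed

lemma has_sum_finite_sum:
  fixes f :: "'i \<Rightarrow> 'a \<Rightarrow> 'b::topological_comm_monoid_add"
  assumes "\<And>i. i \<in> I \<Longrightarrow> (f i has_sum s i) A"
  shows "((\<lambda>x. \<Sum>i\<in>I. f i x) has_sum (\<Sum>i\<in>I. s i)) A"
  using assms by (induction I rule: infinite_finite_induct) (auto intro: has_sum_add)

lemma has_sum_modes:
  fixes z :: "'n::finite modes"
  shows "((\<lambda>\<xi>. \<Sum>k\<in>UNIV. coef y (\<xi>, k) * coef z (\<xi>, k)) has_sum (y \<bullet> z)) UNIV"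
proof (rule has_sum_SigmaD)
  show "((\<lambda>p. coef y p * coef z p) has_sum (y \<bullet> z)) (Sigma UNIV (\<lambda>_. UNIV))"
    using has_sum_inner_ell2[of y z] by simp
qed (auto intro: has_sum_finite)

lemma has_sum_modes_norm:
  fixes z :: "'n::finite modes"
  shows "((\<lambda>\<xi>. \<Sum>k\<in>UNIV. (coef z (\<xi>, k))\<^sup>2) has_sum (norm z)\<^sup>2) UNIV"
  using has_sum_modes[of z z] by (simp only: power2_norm_eq_inner) (simp add: power2_eq_square)

lemma ell2_of_modes:
  fixes h :: "'n::finite \<Rightarrow> int^'n \<Rightarrow> real"
  assumes "(\<lambda>\<xi>. \<Sum>k\<in>UNIV. (h k \<xi>)\<^sup>2) summable_on UNIV"
  obtains z where "\<And>\<xi> k. coef z (\<xi>, k) = h k \<xi>"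
proof -
  have "(\<lambda>p. (h (snd p) (fst p))\<^sup>2) summable_on (Sigma UNIV (\<lambda>_. UNIV))"
    by (rule summable_on_SigmaI[OF _ assms]) (auto intro!: has_sum_finiteI)
  then have "coef (Abs_ell2 (\<lambda>p. h (snd p) (fst p))) = (\<lambda>p. h (snd p) (fst p))"
    by (intro Abs_ell2_inverse) simp
  then show ?thesis by (intro that[of "Abs_ell2 (\<lambda>p. h (snd p) (fst p))"]) simp
qed

lemma summable_on_uminus_iff:
  fixes f :: "int^'n \<Rightarrow> real"
  shows "(\<lambda>\<xi>. f (- \<xi>)) summable_on UNIV \<longleftrightarrow> f summable_on UNIV"
    and has_sum_uminus_iff: "((\<lambda>\<xi>. f (- \<xi>)) has_sum S) UNIV \<longleftrightarrow> (f has_sum S) UNIV"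
proof -
  have b: "bij_betw uminus (UNIV :: (int^'n) set) UNIV"
    by (rule bij_betwI[where g = uminus]) auto
  show "(\<lambda>\<xi>. f (- \<xi>)) summable_on UNIV \<longleftrightarrow> f summable_on UNIV"
    using summable_on_reindex_bij_betw[OF b, of f] .
  show "((\<lambda>\<xi>. f (- \<xi>)) has_sum S) UNIV \<longleftrightarrow> (f has_sum S) UNIV"
    using has_sum_reindex_bij_betw[OF b, of f S] .
qed

text \<open>The weight enters as an even square root w, so that the exponents 1 and -1 share one
  proof, with w equal to \<open>bessel\<close> or its reciprocal. Each term averages the Hartley
  squares at xi and -xi; only the sums over all frequencies coincide.\<close>

lemma sobolev_term_vec_hartley:
  fixes v :: "'n::finite distr^'n"
  assumes v: "\<And>k. v $ k \<in> pdistr" and s: "\<And>\<xi>. (1 + (norm (freq \<xi>))\<^sup>2) powr s = (w \<xi>)\<^sup>2"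
    and w: "\<And>\<xi>. w (- \<xi>) = w \<xi>"
  shows "sobolev_term_vec s v \<xi> =
    ((\<Sum>k\<in>UNIV. (w \<xi> * (v $ k) (cas \<xi>))\<^sup>2) + (\<Sum>k\<in>UNIV. (w (- \<xi>) * (v $ k) (cas (- \<xi>)))\<^sup>2)) / 2"
proof -
  have "(\<Sum>k\<in>UNIV. (w \<xi> * (v $ k) (cas \<xi>))\<^sup>2) + (\<Sum>k\<in>UNIV. (w (- \<xi>) * (v $ k) (cas (- \<xi>)))\<^sup>2)
      = (w \<xi>)\<^sup>2 * (\<Sum>k\<in>UNIV. ((v $ k) (cas \<xi>))\<^sup>2 + ((v $ k) (cas (- \<xi>)))\<^sup>2)"
    by (simp add: w power_mult_distrib sum_distrib_left[symmetric] sum.distrib distrib_left)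
  then show ?thesis
    unfolding sobolev_term_vec_def fourier_hartley(1)[OF v] s
    by (simp add: sum_divide_distrib[symmetric])
qed

lemma H_vec_hartley_norm:
  fixes v :: "'n::finite distr^'n"
  assumes v: "\<And>k. v $ k \<in> pdistr" and s: "\<And>\<xi>. (1 + (norm (freq \<xi>))\<^sup>2) powr s = (w \<xi>)\<^sup>2"
    and w: "\<And>\<xi>. w (- \<xi>) = w \<xi>" and z: "\<And>\<xi> k. coef z (\<xi>, k) = w \<xi> * (v $ k) (cas \<xi>)"
  shows "v \<in> H_vec s" "H_vec_norm s v = norm z"
proof -
  define T where "T \<xi> = (\<Sum>k\<in>UNIV. (coef z (\<xi>, k))\<^sup>2)" for \<xi>
  have "(T has_sum (norm z)\<^sup>2) UNIV" unfolding T_def by (rule has_sum_modes_norm)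
  then have "((\<lambda>\<xi>. (T \<xi> + T (- \<xi>)) * (1/2)) has_sum (((norm z)\<^sup>2 + (norm z)\<^sup>2) * (1/2))) UNIV"
    by (intro has_sum_cmult_left has_sum_add) (auto simp: has_sum_uminus_iff)
  moreover have "(T \<xi> + T (- \<xi>)) * (1/2) = sobolev_term_vec s v \<xi>" for \<xi>
    unfolding sobolev_term_vec_hartley[OF v s w] T_def z by simp
  ultimately have hs: "(sobolev_term_vec s v has_sum (norm z)\<^sup>2) UNIV" by simp
  then show "v \<in> H_vec s" using v by (auto simp: H_vec_def summable_on_def)
  show "H_vec_norm s v = norm z" unfolding H_vec_norm_def using infsumI[OF hs] by simp
qed

text \<open>The Sobolev term is an average of two nonnegative contributions, so each of them is at
  most twice that term; this suffices for summability.\<close>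

lemma H_vec_hartley:
  fixes v :: "'n::finite distr^'n"
  assumes v: "v \<in> H_vec s" and s: "\<And>\<xi>. (1 + (norm (freq \<xi>))\<^sup>2) powr s = (w \<xi>)\<^sup>2"
    and w: "\<And>\<xi>. w (- \<xi>) = w \<xi>"
  obtains z where "\<And>\<xi> k. coef z (\<xi>, k) = w \<xi> * (v $ k) (cas \<xi>)" "H_vec_norm s v = norm z"
proof -
  have vp: "\<And>k. v $ k \<in> pdistr" using v by (simp add: H_vec_def)
  have "(\<lambda>\<xi>. \<Sum>k\<in>UNIV. (w \<xi> * (v $ k) (cas \<xi>))\<^sup>2) summable_on UNIV"
  proof (rule summable_on_comparison_test)
    show "(\<lambda>\<xi>. 2 * sobolev_term_vec s v \<xi>) summable_on UNIV"
      using v by (intro summable_on_cmult_right) (simp add: H_vec_def)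
    show "(\<Sum>k\<in>UNIV. (w \<xi> * (v $ k) (cas \<xi>))\<^sup>2) \<le> 2 * sobolev_term_vec s v \<xi>" for \<xi>
      unfolding sobolev_term_vec_hartley[OF vp s w] by (simp add: sum_nonneg)
  qed (simp add: sum_nonneg)
  then obtain z where "\<And>\<xi> k. coef z (\<xi>, k) = w \<xi> * (v $ k) (cas \<xi>)" by (rule ell2_of_modes) blast
  then show ?thesis using that H_vec_hartley_norm(2)[OF vp s w] by blast
qed

lemma powr_1_bessel: "(1 + (norm (freq \<xi>))\<^sup>2) powr 1 = (bessel \<xi>)\<^sup>2"
  by (simp add: bessel_square add_pos_nonneg)

lemma powr_minus_1_bessel: "(1 + (norm (freq \<xi>))\<^sup>2) powr (-1) = (1 / bessel \<xi>)\<^sup>2"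
proof -
  have "1 + (norm (freq \<xi>))\<^sup>2 > 0" by (simp add: add_pos_nonneg)
  then show ?thesis by (simp add: power_one_over bessel_square powr_minus inverse_eq_divide)
qed


text \<open>Coefficients of the derivative in direction j of the component k, up to a reflection:
  the value at xi belongs to the basis function at -xi. Leaving the reflection out makes derivatives
  act frequency by frequency and changes no norm or inner product of two such families.\<close>

definition deriv_coef :: "'n::finite \<Rightarrow> 'n \<Rightarrow> 'n::finite modes \<Rightarrow> (int^'n) ell2" where
  "deriv_coef j k x = Abs_ell2 (\<lambda>\<xi>. 2 * pi * real_of_int (\<xi> $ j) / bessel \<xi> * coef x (\<xi>, k))"

lemma abs_multiplier_le: "\<bar>2 * pi * real_of_int (\<xi> $ j) / bessel \<xi>\<bar> \<le> 2 * pi"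
  using freq_component_le_bessel[of \<xi> j] bessel_pos[of \<xi>] by (simp add: abs_mult field_simps)

lemma sum_deriv_coef_le:
  assumes "finite F"
  shows "(\<Sum>\<xi>\<in>F. (2 * pi * real_of_int (\<xi> $ j) / bessel \<xi> * coef x (\<xi>, k))\<^sup>2) \<le> (2 * pi * norm x)\<^sup>2"
proof -
  have "(\<Sum>\<xi>\<in>F. (2 * pi * real_of_int (\<xi> $ j) / bessel \<xi> * coef x (\<xi>, k))\<^sup>2)
      \<le> (\<Sum>\<xi>\<in>F. (2 * pi)\<^sup>2 * (coef x (\<xi>, k))\<^sup>2)"
  proof (rule sum_mono)
    fix \<xi>
    have "(2 * pi * real_of_int (\<xi> $ j) / bessel \<xi>)\<^sup>2 \<le> (2 * pi)\<^sup>2"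
      using power_mono[OF abs_multiplier_le[of \<xi> j], of 2] by (simp only: power2_abs abs_ge_zero)
    then show "(2 * pi * real_of_int (\<xi> $ j) / bessel \<xi> * coef x (\<xi>, k))\<^sup>2 \<le> (2 * pi)\<^sup>2 * (coef x (\<xi>, k))\<^sup>2"
      unfolding power_mult_distrib[of _ "coef x (\<xi>, k)"] by (rule mult_right_mono) simp
  qed
  also have "\<dots> = (2 * pi)\<^sup>2 * (\<Sum>i\<in>(\<lambda>\<xi>. (\<xi>, k)) ` F. (coef x i)\<^sup>2)"
    by (subst sum.reindex) (auto simp: inj_on_def sum_distrib_left)
  also have "\<dots> \<le> (2 * pi)\<^sup>2 * (norm x)\<^sup>2"
    by (intro mult_left_mono finite_sum_le_norm_ell2) (use assms in auto)
  finally show ?thesis by (simp add: power_mult_distrib)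
qed

lemma coef_deriv_coef:
  "coef (deriv_coef j k x) \<xi> = 2 * pi * real_of_int (\<xi> $ j) / bessel \<xi> * coef x (\<xi>, k)"
proof -
  have "(\<lambda>\<xi>. (2 * pi * real_of_int (\<xi> $ j) / bessel \<xi> * coef x (\<xi>, k))\<^sup>2) summable_on UNIV"
    by (rule summable_on_square_finite_sums) (rule sum_deriv_coef_le)
  then show ?thesis unfolding deriv_coef_def by (subst Abs_ell2_inverse) simp_all
qed

lemma bounded_linear_deriv_coef: "bounded_linear (deriv_coef j k)"
proof (rule bounded_linear_intro[where K = "2 * pi"])
  show "norm (deriv_coef j k x) \<le> norm x * (2 * pi)" for x
    using norm_ell2_le[of "2 * pi * norm x" "deriv_coef j k x"] sum_deriv_coef_le[of _ j x k]
    by (simp add: coef_deriv_coef mult.commute)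
qed (rule ell2_eqI, simp add: coef_deriv_coef distrib_left)+

definition grad_square :: "'n::finite modes \<Rightarrow> real" where
  "grad_square x = (\<Sum>j\<in>UNIV. \<Sum>k\<in>UNIV. (norm (deriv_coef j k x))\<^sup>2)"

lemma grad_square_nonneg: "0 \<le> grad_square x"
  by (simp add: grad_square_def sum_nonneg)

lemma has_sum_grad_square:
  "((\<lambda>\<xi>. (2 * pi / bessel \<xi>)\<^sup>2 * (norm (freq \<xi>))\<^sup>2 * (\<Sum>k\<in>UNIV. (coef x (\<xi>, k))\<^sup>2)) has_sum grad_square x) UNIV"
proof -
  have "((\<lambda>\<xi>. \<Sum>j\<in>UNIV. \<Sum>k\<in>UNIV. (coef (deriv_coef j k x) \<xi>)\<^sup>2) has_sum grad_square x) UNIV"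
    unfolding grad_square_def by (intro has_sum_finite_sum has_sum_norm_ell2)
  moreover have "(\<Sum>j\<in>UNIV. \<Sum>k\<in>UNIV. (coef (deriv_coef j k x) \<xi>)\<^sup>2) =
      (2 * pi / bessel \<xi>)\<^sup>2 * (norm (freq \<xi>))\<^sup>2 * (\<Sum>k\<in>UNIV. (coef x (\<xi>, k))\<^sup>2)" for \<xi>
  proof -
    have "(norm (freq \<xi>))\<^sup>2 = (\<Sum>j\<in>UNIV. (real_of_int (\<xi> $ j))\<^sup>2)"
      unfolding power2_norm_eq_inner by (simp add: inner_vec_def power2_eq_square)
    moreover have "(coef (deriv_coef j k x) \<xi>)\<^sup>2 = (2 * pi / bessel \<xi>)\<^sup>2 * ((real_of_int (\<xi> $ j))\<^sup>2 * (coef x (\<xi>, k))\<^sup>2)" for j k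
      by (simp add: coef_deriv_coef power_mult_distrib power_divide)
    ultimately show ?thesis
      by (simp add: sum_product sum_distrib_left[symmetric] mult.assoc)
  qed
  ultimately show ?thesis by simp
qed

section \<open>Mean-free divergence-free modes and the Poincare inequality\<close>

definition vel_space :: "'n::finite modes set" where
  "vel_space = {x. (\<forall>k. coef x (0, k) = 0) \<and> (\<forall>\<xi>. (\<Sum>k\<in>UNIV. real_of_int (\<xi> $ k) * coef x (\<xi>, k)) = 0)}"

lemma subspace_vel_space: "subspace vel_space"
  by (rule subspaceI) (auto simp: vel_space_def sum.distrib distrib_left mult.left_commute simp flip: sum_distrib_left)

lemma closed_vel_space: "closed (vel_space :: 'n::finite modes set)"
proof -
  have c: "continuous_on UNIV (\<lambda>x. coef x i)" for i :: "(int^'n) \<times> 'n"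
    by (rule linear_continuous_on[OF bounded_linear_coef])
  have "(vel_space :: 'n::finite modes set) = (\<Inter>k. {x. coef x (0, k) = 0}) \<inter>
      (\<Inter>\<xi>. {x :: 'n::finite modes. (\<Sum>k\<in>UNIV. real_of_int (\<xi> $ k) * coef x (\<xi>, k)) = 0})"
    by (auto simp: vel_space_def)
  moreover have "closed \<dots>"
    by (intro closed_Int closed_INT ballI closed_Collect_eq continuous_intros c)
  ultimately show ?thesis by (simp only:)
qed

lemma norm_freq_ge_1:
  assumes "\<xi> \<noteq> 0"
  shows "norm (freq \<xi>) \<ge> 1"
proof -
  obtain j where "\<xi> $ j \<noteq> 0" using assms by (auto simp: vec_eq_iff)
  then have "1 \<le> \<bar>real_of_int (\<xi> $ j)\<bar>" by linarith
  also have "\<dots> \<le> norm (freq \<xi>)" using component_le_norm_cart[of "freq \<xi>" j] by simp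
  finally show ?thesis .
qed

text \<open>With N = |xi|^2, the gradient compares to the full H^1 norm through the factor 4 pi^2 N
  / (1 + N). It increases in N, and its value at N = 1 is the constant; the mode N = 0 is
  absent.\<close>

lemma grad_square_poincare:
  fixes x :: "'n::finite modes"
  assumes "x \<in> vel_space"
  shows "2 * pi\<^sup>2 * (norm x)\<^sup>2 \<le> grad_square x"
proof (rule has_sum_mono[OF has_sum_cmult_right[OF has_sum_modes_norm] has_sum_grad_square])
  fix \<xi> :: "int^'n"
  show "2 * pi\<^sup>2 * (\<Sum>k\<in>UNIV. (coef x (\<xi>, k))\<^sup>2) \<le>
      (2 * pi / bessel \<xi>)\<^sup>2 * (norm (freq \<xi>))\<^sup>2 * (\<Sum>k\<in>UNIV. (coef x (\<xi>, k))\<^sup>2)"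
  proof (cases "\<xi> = 0")
    case True
    then show ?thesis using assms by (simp add: vel_space_def)
  next
    case False
    define N where "N = (norm (freq \<xi>))\<^sup>2"
    have N: "N \<ge> 1" using norm_freq_ge_1[OF False] by (simp add: N_def)
    have "2 * pi\<^sup>2 \<le> (2 * pi)\<^sup>2 / (1 + N) * N"
      using N by (simp add: field_simps power2_eq_square)
    then have "2 * pi\<^sup>2 \<le> (2 * pi / bessel \<xi>)\<^sup>2 * (norm (freq \<xi>))\<^sup>2"
      by (simp add: power_divide bessel_square N_def)
    then show ?thesis by (intro mult_right_mono sum_nonneg) auto
  qed
qed


section \<open>The Stokes form\<close>

text \<open>Built with the full gradient, which the symmetries of the tensor allow in place of the
  strain. The inner products are L2 products of the derivatives, since both families are reflected
  alike.\<close>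

definition stokes_form :: "'n::finite tensor \<Rightarrow> 'n::finite modes \<Rightarrow> 'n::finite modes \<Rightarrow> real" where
  "stokes_form a x y =
     (\<Sum>k\<in>UNIV. \<Sum>j\<in>UNIV. \<Sum>\<alpha>\<in>UNIV. \<Sum>\<beta>\<in>UNIV. a k j \<alpha> \<beta> * (deriv_coef \<beta> j x \<bullet> deriv_coef \<alpha> k y))"

lemma bounded_bilinear_cmult_real:
  fixes f :: "'a::real_normed_vector \<Rightarrow> 'b::real_normed_vector \<Rightarrow> real"
  assumes "bounded_bilinear f"
  shows "bounded_bilinear (\<lambda>x y. c * f x y)"
proof -
  interpret bounded_bilinear f by fact
  obtain K where K: "\<And>x y. norm (f x y) \<le> norm x * norm y * K" using bounded by blast
  have "norm (c * f x y) \<le> norm x * norm y * (\<bar>c\<bar> * K)" for x y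
    using mult_left_mono[OF K[of x y], of "\<bar>c\<bar>"] by (simp add: abs_mult mult.left_commute mult.assoc)
  then have "\<exists>K. \<forall>x y. norm (c * f x y) \<le> norm x * norm y * K" by blast
  then show ?thesis
    by (rule bounded_bilinear.intro[rotated 4])
      (auto simp: add_left add_right scaleR_left scaleR_right algebra_simps)
qed

lemma bounded_bilinear_add_real:
  fixes f g :: "'a::real_normed_vector \<Rightarrow> 'b::real_normed_vector \<Rightarrow> real"
  assumes "bounded_bilinear f" "bounded_bilinear g"
  shows "bounded_bilinear (\<lambda>x y. f x y + g x y)"
proof -
  interpret f: bounded_bilinear f by fact
  interpret g: bounded_bilinear g by fact
  obtain K where K: "\<And>x y. norm (f x y) \<le> norm x * norm y * K" using f.bounded by blast
  obtain L where L: "\<And>x y. norm (g x y) \<le> norm x * norm y * L" using g.bounded by blast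
  have "norm (f x y + g x y) \<le> norm x * norm y * (K + L)" for x y
    using norm_triangle_ineq[of "f x y" "g x y"] K[of x y] L[of x y] by (simp add: distrib_left)
  then have "\<exists>K. \<forall>x y. norm (f x y + g x y) \<le> norm x * norm y * K" by blast
  then show ?thesis
    by (rule bounded_bilinear.intro[rotated 4])
      (auto simp: f.add_left f.add_right f.scaleR_left f.scaleR_right
        g.add_left g.add_right g.scaleR_left g.scaleR_right algebra_simps)
qed

lemma bounded_bilinear_sum_real:
  fixes f :: "'i \<Rightarrow> 'a::real_normed_vector \<Rightarrow> 'b::real_normed_vector \<Rightarrow> real"
  assumes "\<And>i. i \<in> I \<Longrightarrow> bounded_bilinear (f i)"
  shows "bounded_bilinear (\<lambda>x y. \<Sum>i\<in>I. f i x y)"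
  using assms
proof (induction I rule: infinite_finite_induct)
  have z: "bounded_bilinear (\<lambda>(x::'a) (y::'b). 0::real)"
    by unfold_locales (auto intro: exI[of _ 0])
  case (infinite A)
  show ?case using infinite z by simp
next
  have z: "bounded_bilinear (\<lambda>(x::'a) (y::'b). 0::real)"
    by unfold_locales (auto intro: exI[of _ 0])
  case empty
  show ?case using z by simp
next
  case (insert i I)
  then show ?case by (simp add: bounded_bilinear_add_real)
qed

lemma bounded_bilinear_stokes_form: "bounded_bilinear (stokes_form a)"
  unfolding stokes_form_def[abs_def]
  by (intro bounded_bilinear_sum_real bounded_bilinear_cmult_real
      bounded_bilinear.comp[OF bounded_bilinear_inner] bounded_linear_deriv_coef)

section \<open>Tensor symmetries and ellipticity at a single frequency\<close>

definition tensor_form :: "'n::finite tensor \<Rightarrow> ('n \<Rightarrow> 'n \<Rightarrow> real) \<Rightarrow> ('n \<Rightarrow> 'n \<Rightarrow> real) \<Rightarrow> real" where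
  "tensor_form a M N = (\<Sum>k\<in>UNIV. \<Sum>j\<in>UNIV. \<Sum>\<alpha>\<in>UNIV. \<Sum>\<beta>\<in>UNIV. a k j \<alpha> \<beta> * M k \<alpha> * N j \<beta>)"

text \<open>The symmetry exchanges the indices k and \<alpha> contracted with M, so after renaming
  only the order of summation changes.\<close>

lemma tensor_form_transpose_left:
  assumes "symmetric_tensor a"
  shows "tensor_form a (\<lambda>k \<alpha>. M \<alpha> k) N = tensor_form a M N"
proof -
  have "tensor_form a (\<lambda>k \<alpha>. M \<alpha> k) N = (\<Sum>\<alpha>\<in>UNIV. \<Sum>j\<in>UNIV. \<Sum>k\<in>UNIV. \<Sum>\<beta>\<in>UNIV. a k j \<alpha> \<beta> * M k \<alpha> * N j \<beta>)"
    unfolding tensor_form_def using assms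
    by (intro sum.cong refl arg_cong2[where f = "(*)"]) (auto simp: symmetric_tensor_def)
  also have "\<dots> = (\<Sum>j\<in>UNIV. \<Sum>\<alpha>\<in>UNIV. \<Sum>k\<in>UNIV. \<Sum>\<beta>\<in>UNIV. a k j \<alpha> \<beta> * M k \<alpha> * N j \<beta>)"
    by (rule sum.swap)
  also have "\<dots> = (\<Sum>j\<in>UNIV. \<Sum>k\<in>UNIV. \<Sum>\<alpha>\<in>UNIV. \<Sum>\<beta>\<in>UNIV. a k j \<alpha> \<beta> * M k \<alpha> * N j \<beta>)"
    by (intro sum.cong refl sum.swap)
  also have "\<dots> = tensor_form a M N" unfolding tensor_form_def by (rule sum.swap)
  finally show ?thesis .
qed

lemma tensor_form_transpose_right:
  assumes "symmetric_tensor a"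
  shows "tensor_form a M (\<lambda>j \<beta>. N \<beta> j) = tensor_form a M N"
proof -
  have "tensor_form a M (\<lambda>j \<beta>. N \<beta> j) = (\<Sum>k\<in>UNIV. \<Sum>\<beta>\<in>UNIV. \<Sum>\<alpha>\<in>UNIV. \<Sum>j\<in>UNIV. a k j \<alpha> \<beta> * M k \<alpha> * N j \<beta>)"
    unfolding tensor_form_def using assms
    by (intro sum.cong refl arg_cong2[where f = "(*)"]) (auto simp: symmetric_tensor_def)
  also have "\<dots> = (\<Sum>k\<in>UNIV. \<Sum>\<alpha>\<in>UNIV. \<Sum>\<beta>\<in>UNIV. \<Sum>j\<in>UNIV. a k j \<alpha> \<beta> * M k \<alpha> * N j \<beta>)"
    by (intro sum.cong refl sum.swap)
  also have "\<dots> = (\<Sum>k\<in>UNIV. \<Sum>\<alpha>\<in>UNIV. \<Sum>j\<in>UNIV. \<Sum>\<beta>\<in>UNIV. a k j \<alpha> \<beta> * M k \<alpha> * N j \<beta>)"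
    by (intro sum.cong refl sum.swap)
  also have "\<dots> = tensor_form a M N" unfolding tensor_form_def by (intro sum.cong refl sum.swap)
  finally show ?thesis .
qed

lemma tensor_form_bilinear:
  "tensor_form a (\<lambda>k \<alpha>. (M k \<alpha> + M' k \<alpha>) / 2) N = (tensor_form a M N + tensor_form a M' N) / 2"
  "tensor_form a M (\<lambda>k \<alpha>. (N k \<alpha> + N' k \<alpha>) / 2) = (tensor_form a M N + tensor_form a M N') / 2"
  unfolding tensor_form_def
  by (simp_all add: sum.distrib[symmetric] sum_divide_distrib distrib_left distrib_right
      add_divide_distrib flip: times_divide_eq_right) (simp_all add: algebra_simps)

text \<open>The gradient amplitude of a single frequency is the rank one matrix c_k xi_\<alpha>. Its
  symmetric part has trace xi . c = 0, so the relaxed condition applies, and symmetrization leaves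
  the form unchanged. The symmetric part has square norm (|xi|^2 |c|^2 + (xi . c)^2) / 2, whence the
  factor 1/2.\<close>

lemma tensor_form_ellipticity:
  assumes sym: "symmetric_tensor a" and ell: "relaxed_elliptic a C"
    and div: "(\<Sum>k\<in>UNIV. \<xi> k * c k) = 0"
  shows "(\<Sum>k\<in>UNIV. (\<xi> k)\<^sup>2) * (\<Sum>k\<in>UNIV. (c k)\<^sup>2) / 2 \<le>
    C * tensor_form a (\<lambda>k \<alpha>. \<xi> \<alpha> * c k) (\<lambda>k \<alpha>. \<xi> \<alpha> * c k)"
proof -
  define M where "M k \<alpha> = \<xi> \<alpha> * c k" for k \<alpha>
  define \<zeta> :: "real^'a^'a" where "\<zeta> = (\<chi> k \<alpha>. (M k \<alpha> + M \<alpha> k) / 2)"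
  have "\<zeta> = transpose \<zeta>" by (simp add: \<zeta>_def transpose_def vec_eq_iff add.commute)
  moreover have "trace \<zeta> = 0" using div by (simp add: \<zeta>_def trace_def M_def)
  ultimately have "(\<Sum>k\<in>UNIV. \<Sum>\<alpha>\<in>UNIV. \<zeta> $ k $ \<alpha> * \<zeta> $ k $ \<alpha>) \<le>
      C * tensor_form a (\<lambda>k \<alpha>. (M k \<alpha> + M \<alpha> k) / 2) (\<lambda>k \<alpha>. (M k \<alpha> + M \<alpha> k) / 2)"
    using ell unfolding relaxed_elliptic_def tensor_form_def by (auto simp: \<zeta>_def)
  also have "tensor_form a (\<lambda>k \<alpha>. (M k \<alpha> + M \<alpha> k) / 2) (\<lambda>k \<alpha>. (M k \<alpha> + M \<alpha> k) / 2) = tensor_form a M M"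
    unfolding tensor_form_bilinear tensor_form_transpose_left[OF sym, of M]
      tensor_form_transpose_right[OF sym, of _ M] by simp
  also have "(\<Sum>k\<in>UNIV. \<Sum>\<alpha>\<in>UNIV. \<zeta> $ k $ \<alpha> * \<zeta> $ k $ \<alpha>) =
      (\<Sum>k\<in>UNIV. \<Sum>\<alpha>\<in>UNIV. ((c k)\<^sup>2 * (\<xi> \<alpha>)\<^sup>2 + (\<xi> k)\<^sup>2 * (c \<alpha>)\<^sup>2 + 2 * ((\<xi> k * c k) * (\<xi> \<alpha> * c \<alpha>))) / 4)"
    by (intro sum.cong refl) (simp add: \<zeta>_def M_def power2_eq_square algebra_simps)
  also have "\<dots> = ((\<Sum>k\<in>UNIV. (c k)\<^sup>2) * (\<Sum>k\<in>UNIV. (\<xi> k)\<^sup>2) + (\<Sum>k\<in>UNIV. (\<xi> k)\<^sup>2) * (\<Sum>k\<in>UNIV. (c k)\<^sup>2)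
      + 2 * ((\<Sum>k\<in>UNIV. \<xi> k * c k) * (\<Sum>k\<in>UNIV. \<xi> k * c k))) / 4"
    by (simp only: sum_product, simp only: sum.distrib sum_divide_distrib sum_distrib_left add_divide_distrib)
  also have "\<dots> = (\<Sum>k\<in>UNIV. (\<xi> k)\<^sup>2) * (\<Sum>k\<in>UNIV. (c k)\<^sup>2) / 2" by (simp add: div)
  finally show ?thesis by (simp add: M_def[abs_def])
qed

text \<open>Both sides are sums over frequencies, and the Hartley coefficients are real, so the
  ellipticity for real matrices applies to each term.\<close>

lemma stokes_form_coercive:
  fixes x :: "'n::finite modes"
  assumes sym: "symmetric_tensor a" and ell: "relaxed_elliptic a C" and x: "x \<in> vel_space"
  shows "grad_square x / 2 \<le> C * stokes_form a x x"
proof (rule has_sum_mono)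
  show "((\<lambda>\<xi>. (2 * pi / bessel \<xi>)\<^sup>2 * (norm (freq \<xi>))\<^sup>2 * (\<Sum>k\<in>UNIV. (coef x (\<xi>, k))\<^sup>2) * (1/2))
      has_sum (grad_square x / 2)) UNIV"
    using has_sum_cmult_left[OF has_sum_grad_square, of x "1/2"] by simp
  show "((\<lambda>\<xi>. C * (\<Sum>k\<in>UNIV. \<Sum>j\<in>UNIV. \<Sum>\<alpha>\<in>UNIV. \<Sum>\<beta>\<in>UNIV. a k j \<alpha> \<beta> *
      (coef (deriv_coef \<beta> j x) \<xi> * coef (deriv_coef \<alpha> k x) \<xi>))) has_sum (C * stokes_form a x x)) UNIV"
    unfolding stokes_form_def by (intro has_sum_cmult_right has_sum_finite_sum has_sum_inner_ell2)
  fix \<xi> :: "int^'n"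
  define X where "X k = real_of_int (\<xi> $ k)" for k
  define c where "c k = coef x (\<xi>, k)" for k
  define m where "m = 2 * pi / bessel \<xi>"
  have "(\<Sum>k\<in>UNIV. X k * c k) = 0" using x by (simp add: vel_space_def X_def c_def)
  from tensor_form_ellipticity[OF sym ell this]
  have "m\<^sup>2 * ((\<Sum>k\<in>UNIV. (X k)\<^sup>2) * (\<Sum>k\<in>UNIV. (c k)\<^sup>2) / 2) \<le>
      m\<^sup>2 * (C * tensor_form a (\<lambda>k \<alpha>. X \<alpha> * c k) (\<lambda>k \<alpha>. X \<alpha> * c k))"
    by (rule mult_left_mono) simp
  moreover have "(norm (freq \<xi>))\<^sup>2 = (\<Sum>k\<in>UNIV. (X k)\<^sup>2)"
    unfolding power2_norm_eq_inner by (simp add: inner_vec_def power2_eq_square X_def)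
  moreover have "(\<Sum>k\<in>UNIV. \<Sum>j\<in>UNIV. \<Sum>\<alpha>\<in>UNIV. \<Sum>\<beta>\<in>UNIV. a k j \<alpha> \<beta> *
      (coef (deriv_coef \<beta> j x) \<xi> * coef (deriv_coef \<alpha> k x) \<xi>))
      = m\<^sup>2 * tensor_form a (\<lambda>k \<alpha>. X \<alpha> * c k) (\<lambda>k \<alpha>. X \<alpha> * c k)"
  proof -
    have "coef (deriv_coef \<beta> j x) \<xi> = m * (X \<beta> * c j)" for \<beta> j
      by (simp add: coef_deriv_coef m_def X_def c_def)
    then show ?thesis
      unfolding tensor_form_def sum_distrib_left
      by (intro sum.cong refl) (simp add: power2_eq_square mult_ac)
  qed
  ultimately show "(2 * pi / bessel \<xi>)\<^sup>2 * (norm (freq \<xi>))\<^sup>2 * (\<Sum>k\<in>UNIV. (coef x (\<xi>, k))\<^sup>2) * (1/2) \<le>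
      C * (\<Sum>k\<in>UNIV. \<Sum>j\<in>UNIV. \<Sum>\<alpha>\<in>UNIV. \<Sum>\<beta>\<in>UNIV. a k j \<alpha> \<beta> *
      (coef (deriv_coef \<beta> j x) \<xi> * coef (deriv_coef \<alpha> k x) \<xi>))"
    unfolding m_def[symmetric] c_def[symmetric] by (simp add: mult_ac)
qed

lemma deriv_coef_unit:
  "deriv_coef \<alpha> l (ell2_unit (\<xi>, k)) =
    (if l = k then (2 * pi * real_of_int (\<xi> $ \<alpha>) / bessel \<xi>) *\<^sub>R ell2_unit \<xi> else 0)"
  by (rule ell2_eqI) (auto simp: coef_deriv_coef coef_ell2_unit)

lemma stokes_form_unit:
  "stokes_form a x (ell2_unit (\<xi>, k)) = (\<Sum>j\<in>UNIV. \<Sum>\<alpha>\<in>UNIV. \<Sum>\<beta>\<in>UNIV. a k j \<alpha> \<beta> *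
    ((2 * pi * real_of_int (\<xi> $ \<alpha>) / bessel \<xi>) * (2 * pi * real_of_int (\<xi> $ \<beta>) / bessel \<xi> * coef x (\<xi>, j))))"
proof -
  have "stokes_form a x (ell2_unit (\<xi>, k)) = (\<Sum>l\<in>UNIV. if l = k then (\<Sum>j\<in>UNIV. \<Sum>\<alpha>\<in>UNIV. \<Sum>\<beta>\<in>UNIV. a l j \<alpha> \<beta> *
    ((2 * pi * real_of_int (\<xi> $ \<alpha>) / bessel \<xi>) * (2 * pi * real_of_int (\<xi> $ \<beta>) / bessel \<xi> * coef x (\<xi>, j)))) else 0)"
    unfolding stokes_form_def
    by (intro sum.cong refl) (auto simp: deriv_coef_unit inner_ell2_unit coef_deriv_coef)
  then show ?thesis by (simp add: sum.delta)
qed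


section \<open>The trilinear convection form\<close>

definition fourth_integrable :: "(real^'n \<Rightarrow> real^'n) \<Rightarrow> bool" where
  "fourth_integrable u \<longleftrightarrow> u \<in> borel_measurable borel \<and> integrable torus (\<lambda>x. norm (u x) ^ 4)"

definition matrix_square_integrable :: "('n::finite \<Rightarrow> 'n \<Rightarrow> real^'n \<Rightarrow> real) \<Rightarrow> bool" where
  "matrix_square_integrable g \<longleftrightarrow>
     (\<forall>j k. g j k \<in> borel_measurable borel \<and> integrable torus (\<lambda>x. (g j k x)\<^sup>2))"

definition convect :: "(real^'n \<Rightarrow> real^'n) \<Rightarrow> ('n \<Rightarrow> 'n \<Rightarrow> real^'n \<Rightarrow> real) \<Rightarrow> (real^'n \<Rightarrow> real^'n) \<Rightarrow> real^'n \<Rightarrow> real" where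
  "convect u g w x = (\<Sum>j\<in>UNIV. \<Sum>k\<in>UNIV. u x $ j * g j k x * w x $ k)"

definition trilinear :: "(real^'n \<Rightarrow> real^'n) \<Rightarrow> ('n \<Rightarrow> 'n \<Rightarrow> real^'n \<Rightarrow> real) \<Rightarrow> (real^'n \<Rightarrow> real^'n) \<Rightarrow> real" where
  "trilinear u g w = (\<integral>x. convect u g w x \<partial>torus)"

lemma fourth_integrableD:
  assumes "fourth_integrable u"
  shows "u \<in> borel_measurable borel" "integrable torus (\<lambda>x. norm (u x) ^ 4)"
  using assms by (auto simp: fourth_integrable_def)

lemma fourth_integrable_product:
  assumes "fourth_integrable u" "fourth_integrable w"
  shows "integrable torus (\<lambda>x. (norm (u x))\<^sup>2 * (norm (w x))\<^sup>2)"
    "(\<integral>x. (norm (u x))\<^sup>2 * (norm (w x))\<^sup>2 \<partial>torus) \<le>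
      sqrt (\<integral>x. norm (u x) ^ 4 \<partial>torus) * sqrt (\<integral>x. norm (w x) ^ 4 \<partial>torus)"
proof -
  note [measurable] = fourth_integrableD(1)[OF assms(1)] fourth_integrableD(1)[OF assms(2)]
  have e: "((norm (v x))\<^sup>2)\<^sup>2 = norm (v x) ^ 4" for v :: "real^'a \<Rightarrow> real^'a" and x
    by (simp add: power_mult[symmetric])
  have i: "integrable torus (\<lambda>x. ((norm (u x))\<^sup>2)\<^sup>2)" "integrable torus (\<lambda>x. ((norm (w x))\<^sup>2)\<^sup>2)"
    unfolding e by (intro fourth_integrableD assms)+
  show "integrable torus (\<lambda>x. (norm (u x))\<^sup>2 * (norm (w x))\<^sup>2)"
    by (rule integrable_mult_square_integrable[OF _ _ i]) measurable
  have "\<bar>\<integral>x. (norm (u x))\<^sup>2 * (norm (w x))\<^sup>2 \<partial>torus\<bar> \<le>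
      sqrt (\<integral>x. ((norm (u x))\<^sup>2)\<^sup>2 \<partial>torus) * sqrt (\<integral>x. ((norm (w x))\<^sup>2)\<^sup>2 \<partial>torus)"
    by (rule integral_Cauchy_Schwarz[OF _ _ i]) measurable
  then show "(\<integral>x. (norm (u x))\<^sup>2 * (norm (w x))\<^sup>2 \<partial>torus) \<le>
      sqrt (\<integral>x. norm (u x) ^ 4 \<partial>torus) * sqrt (\<integral>x. norm (w x) ^ 4 \<partial>torus)"
    unfolding e by simp
qed

lemma integrable_convect_entry:
  assumes u: "fourth_integrable u" and w: "fourth_integrable w"
    and g: "g \<in> borel_measurable borel" "integrable torus (\<lambda>x. (g x)\<^sup>2)"
  shows "integrable torus (\<lambda>x. u x $ j * g x * w x $ k)"
proof -
  note [measurable] = fourth_integrableD(1)[OF u] fourth_integrableD(1)[OF w] g(1)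
  have "integrable torus (\<lambda>x. (u x $ j * w x $ k)\<^sup>2)"
  proof (rule Bochner_Integration.integrable_bound[OF fourth_integrable_product(1)[OF u w]])
    have "(u x $ j * w x $ k)\<^sup>2 \<le> (norm (u x))\<^sup>2 * (norm (w x))\<^sup>2" for x
      unfolding power_mult_distrib
      by (intro mult_mono) (auto simp: abs_le_square_iff[symmetric] component_le_norm_cart)
    then show "AE x in torus. norm ((u x $ j * w x $ k)\<^sup>2) \<le> norm ((norm (u x))\<^sup>2 * (norm (w x))\<^sup>2)"
      by simp
  qed measurable
  note i = this
  have "integrable torus (\<lambda>x. (u x $ j * w x $ k) * g x)"
    by (rule integrable_mult_square_integrable[OF _ _ i g(2)]) measurable
  then show ?thesis by (simp add: ac_simps)
qed

lemma integrable_convect: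
  assumes "fourth_integrable u" "fourth_integrable w" "matrix_square_integrable g"
  shows "integrable torus (convect u g w)"
  unfolding convect_def[abs_def] using assms
  by (intro Bochner_Integration.integrable_sum integrable_convect_entry) (auto simp: matrix_square_integrable_def)

text \<open>Three applications of Cauchy-Schwarz: over the index pairs at each point, in L2 between
  |u| |w| and |g|, and in L2 between |u|^2 and |w|^2. Euclidean norms of vectors and matrices are
  used throughout, so no constant depending on the dimension appears.\<close>

lemma abs_trilinear_le:
  assumes u: "fourth_integrable u" and w: "fourth_integrable w" and g: "matrix_square_integrable g"
  shows "\<bar>trilinear u g w\<bar> \<le> root 4 (\<integral>x. norm (u x) ^ 4 \<partial>torus) *
    root 4 (\<integral>x. norm (w x) ^ 4 \<partial>torus) *
    sqrt (\<Sum>j\<in>UNIV. \<Sum>k\<in>UNIV. \<integral>x. (g j k x)\<^sup>2 \<partial>torus)"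
proof -
  define G where "G x = (\<Sum>j\<in>UNIV. \<Sum>k\<in>UNIV. (g j k x)\<^sup>2)" for x
  note [measurable] = fourth_integrableD(1)[OF u] fourth_integrableD(1)[OF w]
  have [measurable]: "g j k \<in> borel_measurable borel" for j k
    using g by (simp add: matrix_square_integrable_def)
  have gi: "integrable torus (\<lambda>x. (g j k x)\<^sup>2)" for j k
    using g by (simp add: matrix_square_integrable_def)
  have Gi: "integrable torus G" unfolding G_def by (intro Bochner_Integration.integrable_sum gi)
  have G0: "G x \<ge> 0" for x by (simp add: G_def sum_nonneg)
  have [measurable]: "G \<in> borel_measurable borel" unfolding G_def by measurable
  have pt: "\<bar>convect u g w x\<bar> \<le> (norm (u x) * norm (w x)) * sqrt (G x)" for x
  proof -
    have "(convect u g w x)\<^sup>2 = (\<Sum>p\<in>UNIV \<times> UNIV. (u x $ fst p * w x $ snd p) * g (fst p) (snd p) x)\<^sup>2"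
      unfolding convect_def by (simp add: sum.cartesian_product split_def ac_simps)
    also have "\<dots> \<le> (\<Sum>p\<in>UNIV \<times> UNIV. (u x $ fst p * w x $ snd p)\<^sup>2) * (\<Sum>p\<in>UNIV \<times> UNIV. (g (fst p) (snd p) x)\<^sup>2)"
      by (rule Cauchy_Schwarz_ineq_sum)
    also have "(\<Sum>p\<in>UNIV \<times> UNIV. (g (fst p) (snd p) x)\<^sup>2) = G x"
      unfolding G_def by (simp add: sum.cartesian_product split_def)
    also have "(\<Sum>p\<in>UNIV \<times> UNIV. (u x $ fst p * w x $ snd p)\<^sup>2) = (\<Sum>j\<in>UNIV. (u x $ j)\<^sup>2) * (\<Sum>k\<in>UNIV. (w x $ k)\<^sup>2)"
      unfolding sum_product by (simp add: sum.cartesian_product split_def power_mult_distrib)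
    also have "\<dots> = (norm (u x))\<^sup>2 * (norm (w x))\<^sup>2"
      unfolding power2_norm_eq_inner by (simp add: inner_vec_def power2_eq_square)
    finally have "(convect u g w x)\<^sup>2 \<le> (norm (u x) * norm (w x) * sqrt (G x))\<^sup>2"
      using G0[of x] by (simp add: power_mult_distrib)
    then have "\<bar>convect u g w x\<bar> \<le> \<bar>norm (u x) * norm (w x) * sqrt (G x)\<bar>"
      by (simp only: abs_le_square_iff)
    then show ?thesis using G0[of x] by (simp add: abs_mult)
  qed
  have i: "integrable torus (\<lambda>x. (norm (u x) * norm (w x))\<^sup>2)" "integrable torus (\<lambda>x. (sqrt (G x))\<^sup>2)"
    using fourth_integrable_product(1)[OF u w] Gi by (simp_all add: power_mult_distrib G0)
  have "\<bar>trilinear u g w\<bar> \<le> (\<integral>x. \<bar>convect u g w x\<bar> \<partial>torus)"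
    unfolding trilinear_def by (rule integral_abs_bound)
  also have "\<dots> \<le> (\<integral>x. (norm (u x) * norm (w x)) * sqrt (G x) \<partial>torus)"
  proof (rule integral_mono)
    show "integrable torus (\<lambda>x. norm (u x) * norm (w x) * sqrt (G x))"
      by (rule integrable_mult_square_integrable[OF _ _ i]) measurable
  qed (use integrable_convect[OF u w g] pt in auto)
  also have "\<dots> \<le> sqrt (\<integral>x. (norm (u x) * norm (w x))\<^sup>2 \<partial>torus) * sqrt (\<integral>x. (sqrt (G x))\<^sup>2 \<partial>torus)"
  proof -
    have "\<bar>\<integral>x. (norm (u x) * norm (w x)) * sqrt (G x) \<partial>torus\<bar> \<le>
        sqrt (\<integral>x. (norm (u x) * norm (w x))\<^sup>2 \<partial>torus) * sqrt (\<integral>x. (sqrt (G x))\<^sup>2 \<partial>torus)"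
      by (rule integral_Cauchy_Schwarz[OF _ _ i]) measurable
    then show ?thesis by linarith
  qed
  also have "\<dots> \<le> (root 4 (\<integral>x. norm (u x) ^ 4 \<partial>torus) * root 4 (\<integral>x. norm (w x) ^ 4 \<partial>torus)) *
      sqrt (\<Sum>j\<in>UNIV. \<Sum>k\<in>UNIV. \<integral>x. (g j k x)\<^sup>2 \<partial>torus)"
  proof (rule mult_mono)
    have r: "sqrt (sqrt t) = root 4 t" for t :: real
      using real_root_mult_exp[of 2 2 t] by (simp add: sqrt_def)
    have "sqrt (\<integral>x. (norm (u x) * norm (w x))\<^sup>2 \<partial>torus) \<le>
        sqrt (sqrt (\<integral>x. norm (u x) ^ 4 \<partial>torus) * sqrt (\<integral>x. norm (w x) ^ 4 \<partial>torus))"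
      using fourth_integrable_product(2)[OF u w] by (simp add: power_mult_distrib)
    also have "\<dots> = root 4 (\<integral>x. norm (u x) ^ 4 \<partial>torus) * root 4 (\<integral>x. norm (w x) ^ 4 \<partial>torus)"
      by (simp add: real_sqrt_mult r)
    finally show "sqrt (\<integral>x. (norm (u x) * norm (w x))\<^sup>2 \<partial>torus) \<le>
        root 4 (\<integral>x. norm (u x) ^ 4 \<partial>torus) * root 4 (\<integral>x. norm (w x) ^ 4 \<partial>torus)" .
    have "(\<integral>x. G x \<partial>torus) = (\<Sum>j\<in>UNIV. \<Sum>k\<in>UNIV. \<integral>x. (g j k x)\<^sup>2 \<partial>torus)"
      unfolding G_def using gi by simp
    then show "sqrt (\<integral>x. (sqrt (G x))\<^sup>2 \<partial>torus) \<le> sqrt (\<Sum>j\<in>UNIV. \<Sum>k\<in>UNIV. \<integral>x. (g j k x)\<^sup>2 \<partial>torus)"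
      by (simp add: G0)
  qed (auto simp: G0)
  finally show ?thesis .
qed

text \<open>In \<open>represents_gradient x g\<close> the function \<open>g j k\<close> is the derivative in direction \<open>j\<close> of the \<open>k\<close>-th
  component of the field encoded by \<open>x\<close>.\<close>

definition represents_velocity :: "'n::finite modes \<Rightarrow> (real^'n \<Rightarrow> real^'n) \<Rightarrow> bool" where
  "represents_velocity x u \<longleftrightarrow> fourth_integrable u \<and>
     (\<forall>k \<xi>. hcoef (\<lambda>y. u y $ k) \<xi> = coef x (\<xi>, k) / bessel \<xi>)"

definition represents_gradient :: "'n::finite modes \<Rightarrow> ('n::finite \<Rightarrow> 'n \<Rightarrow> real^'n \<Rightarrow> real) \<Rightarrow> bool" where
  "represents_gradient x g \<longleftrightarrow> matrix_square_integrable g \<and>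
     (\<forall>j k \<xi>. hcoef (g j k) \<xi> = - 2 * pi * real_of_int (\<xi> $ j) * (coef x (- \<xi>, k) / bessel \<xi>))"

lemma fourth_integrable_component:
  assumes "fourth_integrable u"
  shows "(\<lambda>y. u y $ k) \<in> borel_measurable borel" "integrable torus (\<lambda>y. u y $ k)"
proof -
  note [measurable] = fourth_integrableD(1)[OF assms]
  show m: "(\<lambda>y. u y $ k) \<in> borel_measurable borel" by measurable
  show "integrable torus (\<lambda>y. u y $ k)"
  proof (rule Bochner_Integration.integrable_bound)
    show "integrable torus (\<lambda>y. 1 + norm (u y) ^ 4)"
      using fourth_integrableD(2)[OF assms] by simp
    have "\<bar>u y $ k\<bar> \<le> 1 + norm (u y) ^ 4" for y
    proof -
      have "norm (u y) \<le> 1 + norm (u y) ^ 4"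
      proof (cases "norm (u y) \<le> 1")
        case True
        then show ?thesis by (simp add: add_increasing2)
      next
        case False
        then show ?thesis using power_increasing[of 1 4 "norm (u y)"] by simp
      qed
      then show ?thesis using component_le_norm_cart[of "u y" k] by linarith
    qed
    then show "AE y in torus. norm (u y $ k) \<le> norm (1 + norm (u y) ^ 4)" by simp
  qed (use m in measurable)
qed

lemma matrix_square_integrableD:
  assumes "matrix_square_integrable g"
  shows "g j k \<in> borel_measurable borel" "integrable torus (\<lambda>x. (g j k x)\<^sup>2)"
    "integrable torus (g j k)"
proof -
  show m: "g j k \<in> borel_measurable borel" "integrable torus (\<lambda>x. (g j k x)\<^sup>2)"
    using assms by (auto simp: matrix_square_integrable_def)
  show "integrable torus (g j k)"
    using integrable_mult_square_integrable[of "g j k" torus "\<lambda>_. 1"] m by simp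
qed

lemma represents_velocity_unique:
  assumes "represents_velocity x u" "represents_velocity x u'"
  shows "AE y in torus. u y = u' y"
proof -
  have "AE y in torus. u y $ k = u' y $ k" for k
    using assms unfolding represents_velocity_def
    by (intro hcoef_unique fourth_integrable_component) auto
  then have "AE y in torus. \<forall>k. u y $ k = u' y $ k" by (simp add: AE_all_countable)
  then show ?thesis by (simp add: vec_eq_iff)
qed

lemma represents_gradient_unique:
  assumes "represents_gradient x g" "represents_gradient x g'"
  shows "AE y in torus. \<forall>j k. g j k y = g' j k y"
proof -
  have "AE y in torus. g j k y = g' j k y" for j k
    using assms unfolding represents_gradient_def
    by (intro hcoef_unique matrix_square_integrableD) auto
  then show ?thesis by (simp add: AE_all_countable)
qed

lemma fourth_integrable_add:
  assumes "fourth_integrable u" "fourth_integrable w"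
  shows "fourth_integrable (\<lambda>x. u x + w x)"
proof -
  note [measurable] = fourth_integrableD(1)[OF assms(1)] fourth_integrableD(1)[OF assms(2)]
  have "integrable torus (\<lambda>x. norm (u x + w x) ^ 4)"
  proof (rule Bochner_Integration.integrable_bound)
    show "integrable torus (\<lambda>x. 8 * norm (u x) ^ 4 + 8 * norm (w x) ^ 4)"
      using assms by (simp add: fourth_integrable_def)
    have "norm (u x + w x) ^ 4 \<le> 8 * norm (u x) ^ 4 + 8 * norm (w x) ^ 4" for x
    proof -
      define p q where "p = norm (u x)" and "q = norm (w x)"
      have sq: "(s + t)\<^sup>2 \<le> 2 * s\<^sup>2 + 2 * t\<^sup>2" for s t :: real
        using zero_le_power2[of "s - t"] by (simp add: power2_eq_square algebra_simps)
      have "norm (u x + w x) ^ 4 \<le> (p + q) ^ 4"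
        unfolding p_def q_def by (intro power_mono norm_triangle_ineq) auto
      also have "\<dots> = ((p + q)\<^sup>2)\<^sup>2" by (simp add: power_mult[symmetric])
      also have "\<dots> \<le> (2 * p\<^sup>2 + 2 * q\<^sup>2)\<^sup>2" by (intro power_mono sq) auto
      also have "\<dots> \<le> 2 * (2 * p\<^sup>2)\<^sup>2 + 2 * (2 * q\<^sup>2)\<^sup>2" by (rule sq)
      also have "\<dots> = 8 * p ^ 4 + 8 * q ^ 4" by (simp add: power_mult_distrib power_mult[symmetric])
      finally show ?thesis by (simp add: p_def q_def)
    qed
    then show "AE x in torus. norm (norm (u x + w x) ^ 4) \<le> norm (8 * norm (u x) ^ 4 + 8 * norm (w x) ^ 4)"
      by simp
  qed measurable
  then show ?thesis by (simp add: fourth_integrable_def)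
qed

lemma fourth_integrable_scaleR:
  "fourth_integrable u \<Longrightarrow> fourth_integrable (\<lambda>x. c *\<^sub>R u x)"
  by (auto simp: fourth_integrable_def power_mult_distrib intro!: borel_measurable_scaleR)

lemma matrix_square_integrable_add:
  assumes "matrix_square_integrable g" "matrix_square_integrable h"
  shows "matrix_square_integrable (\<lambda>j k x. g j k x + h j k x)"
  unfolding matrix_square_integrable_def
proof (intro allI conjI)
  fix j k
  note [measurable] = matrix_square_integrableD(1)[OF assms(1), of j k] matrix_square_integrableD(1)[OF assms(2), of j k]
  show "(\<lambda>x. g j k x + h j k x) \<in> borel_measurable borel" by measurable
  have "integrable torus (\<lambda>x. (g j k x)\<^sup>2 + (h j k x)\<^sup>2 + 2 * (g j k x * h j k x))"
    using integrable_mult_square_integrable[of "g j k" torus "h j k"]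
      matrix_square_integrableD(2)[OF assms(1), of j k] matrix_square_integrableD(2)[OF assms(2), of j k]
    by simp
  then show "integrable torus (\<lambda>x. (g j k x + h j k x)\<^sup>2)"
    by (simp add: power2_sum mult.assoc)
qed

lemma matrix_square_integrable_cmult:
  "matrix_square_integrable g \<Longrightarrow> matrix_square_integrable (\<lambda>j k x. c * g j k x)"
  by (auto simp: matrix_square_integrable_def power_mult_distrib intro!: borel_measurable_times)

lemma represents_velocity_add:
  "represents_velocity x u \<Longrightarrow> represents_velocity y w \<Longrightarrow> represents_velocity (x + y) (\<lambda>z. u z + w z)"
  unfolding represents_velocity_def
  by (simp add: fourth_integrable_add hcoef_add fourth_integrable_component add_divide_distrib)

lemma represents_velocity_scaleR:
  "represents_velocity x u \<Longrightarrow> represents_velocity (c *\<^sub>R x) (\<lambda>z. c *\<^sub>R u z)"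
  unfolding represents_velocity_def by (simp add: fourth_integrable_scaleR hcoef_cmult)

lemma represents_gradient_add:
  "represents_gradient x g \<Longrightarrow> represents_gradient y h \<Longrightarrow>
    represents_gradient (x + y) (\<lambda>j k z. g j k z + h j k z)"
  unfolding represents_gradient_def
  by (simp add: matrix_square_integrable_add hcoef_add matrix_square_integrableD add_divide_distrib distrib_left)

lemma represents_gradient_scaleR:
  "represents_gradient x g \<Longrightarrow> represents_gradient (c *\<^sub>R x) (\<lambda>j k z. c * g j k z)"
  unfolding represents_gradient_def by (simp add: matrix_square_integrable_cmult hcoef_cmult)

lemma represents_velocity_unit:
  "represents_velocity (ell2_unit (\<xi>, k)) (\<lambda>x. axis k (cas \<xi> x / bessel \<xi>))"
proof -
  have ax: "axis k (t::real) = t *\<^sub>R axis k 1" for t by (simp add: axis_def vec_eq_iff)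
  have na: "norm (axis k t) = \<bar>t\<bar>" for t :: real
    by (subst ax) (simp add: norm_axis_1)
  have m: "(\<lambda>x. axis k (cas \<xi> x / bessel \<xi>)) \<in> borel_measurable borel"
    by (subst ax) measurable
  have "integrable torus (\<lambda>x. norm (axis k (cas \<xi> x / bessel \<xi>)) ^ 4)"
  proof (rule integrable_torus_bounded)
    show "(\<lambda>x. norm (axis k (cas \<xi> x / bessel \<xi>)) ^ 4) \<in> borel_measurable borel" using m by measurable
    show "\<bar>norm (axis k (cas \<xi> x / bessel \<xi>)) ^ 4\<bar> \<le> 2 ^ 4" for x
    proof -
      have "\<bar>cas \<xi> x / bessel \<xi>\<bar> \<le> 2"
      proof -
        have "\<bar>cas \<xi> x / bessel \<xi>\<bar> = \<bar>cas \<xi> x\<bar> / bessel \<xi>"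
          by (simp only: abs_divide abs_of_pos[OF bessel_pos])
        also have "\<dots> \<le> \<bar>cas \<xi> x\<bar> / 1"
          using bessel_ge_1[of \<xi>] by (intro divide_left_mono) auto
        finally show ?thesis using abs_cas_le[of \<xi> x] by linarith
      qed
      then show ?thesis
        using power_mono[of "\<bar>cas \<xi> x / bessel \<xi>\<bar>" 2 4] by (simp only: na power_abs abs_abs abs_ge_zero)
    qed
  qed
  moreover have "hcoef (\<lambda>y. axis k (cas \<xi> y / bessel \<xi>) $ l) \<eta> = coef (ell2_unit (\<xi>, k)) (\<eta>, l) / bessel \<eta>" for l \<eta>
  proof (cases "l = k")
    case True
    have "hcoef (\<lambda>y. 1 / bessel \<xi> * cas \<xi> y) \<eta> = 1 / bessel \<xi> * (if \<xi> = \<eta> then 1 else 0)"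
      unfolding hcoef_cmult by (simp add: hcoef_def cas_orthonormal)
    then show ?thesis using True by (simp add: axis_def coef_ell2_unit)
  next
    case False
    then show ?thesis by (simp add: axis_def coef_ell2_unit hcoef_def)
  qed
  ultimately show ?thesis unfolding represents_velocity_def fourth_integrable_def using m by blast
qed

lemma represents_gradient_unit:
  "represents_gradient (ell2_unit (\<xi>, k)) (\<lambda>j l x. if l = k then partial j (cas \<xi>) x / bessel \<xi> else 0)"
proof -
  define t where "t j x = partial j (cas \<xi>) x / bessel \<xi>" for j x
  have te: "t j = (\<lambda>x. (2 * pi * real_of_int (\<xi> $ j) / bessel \<xi>) * cas (- \<xi>) x)" for j
    by (simp add: t_def[abs_def] partial_cas)
  have "integrable torus (\<lambda>x. (t j x)\<^sup>2)" for j
    unfolding te power_mult_distrib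
    using integrable_mult_cas[OF integrable_cas, of "- \<xi>" "- \<xi>"] by (simp add: power2_eq_square)
  then have "matrix_square_integrable (\<lambda>j l x. if l = k then t j x else 0)"
    unfolding matrix_square_integrable_def
  proof (intro allI)
    fix j l
    have "t j \<in> borel_measurable borel" unfolding te by measurable
    then show "(\<lambda>x. if l = k then t j x else 0) \<in> borel_measurable borel \<and>
        integrable torus (\<lambda>x. (if l = k then t j x else 0)\<^sup>2)"
      using \<open>\<And>j. integrable torus (\<lambda>x. (t j x)\<^sup>2)\<close> by (cases "l = k") simp_all
  qed
  moreover have "hcoef (\<lambda>x. if l = k then t j x else 0) \<eta> =
      - 2 * pi * real_of_int (\<eta> $ j) * (coef (ell2_unit (\<xi>, k)) (- \<eta>, l) / bessel \<eta>)" for j l \<eta>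
  proof (cases "l = k")
    case True
    have "hcoef (t j) \<eta> = 2 * pi * real_of_int (\<xi> $ j) / bessel \<xi> * (if - \<xi> = \<eta> then 1 else 0)"
      unfolding te hcoef_cmult by (simp add: hcoef_def cas_orthonormal)
    then show ?thesis using True by (auto simp: coef_ell2_unit)
  next
    case False
    then show ?thesis by (simp add: coef_ell2_unit hcoef_def)
  qed
  ultimately show ?thesis unfolding represents_gradient_def t_def by blast
qed

text \<open>Riesz-Fischer is applied to the reflected families, since a derivative takes its
  coefficient at xi from the mode at -xi. The norm bound is kept with constant 1 for the later
  smallness condition.\<close>

lemma represents_gradient_exists:
  obtains g where "represents_gradient x g" "\<And>j k. g j k \<in> L2_per"
    "(\<Sum>j\<in>UNIV. \<Sum>k\<in>UNIV. \<integral>y. (g j k y)\<^sup>2 \<partial>torus) \<le> grad_square x"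
proof -
  have "\<exists>g. g \<in> L2_per \<and> (\<forall>\<xi>. hcoef g \<xi> = - 2 * pi * real_of_int (\<xi> $ j) * (coef x (- \<xi>, k) / bessel \<xi>)) \<and>
      (\<integral>y. (g y)\<^sup>2 \<partial>torus) \<le> (norm (deriv_coef j k x))\<^sup>2" for j k
  proof -
    define c where "c \<xi> = coef (deriv_coef j k x) \<xi>" for \<xi>
    have "((\<lambda>\<xi>. (c (- \<xi>))\<^sup>2) has_sum (norm (deriv_coef j k x))\<^sup>2) UNIV"
      by (subst has_sum_uminus_iff[of "\<lambda>\<xi>. (c \<xi>)\<^sup>2"]) (simp add: c_def has_sum_norm_ell2)
    then have s: "(\<lambda>\<xi>. (c (- \<xi>))\<^sup>2) summable_on UNIV" "(\<Sum>\<^sub>\<infinity>\<xi>. (c (- \<xi>))\<^sup>2) = (norm (deriv_coef j k x))\<^sup>2"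
      by (auto simp: summable_on_def infsumI)
    obtain g where "g \<in> L2_per" "\<And>\<xi>. hcoef g \<xi> = c (- \<xi>)"
      "(\<integral>y. (g y)\<^sup>2 \<partial>torus) \<le> (norm (deriv_coef j k x))\<^sup>2"
      using riesz_fischer[OF s(1)] s(2) by metis
    then show ?thesis by (intro exI[of _ g]) (simp add: c_def coef_deriv_coef)
  qed
  then obtain g where g: "\<And>j k. g j k \<in> L2_per"
    "\<And>j k \<xi>. hcoef (g j k) \<xi> = - 2 * pi * real_of_int (\<xi> $ j) * (coef x (- \<xi>, k) / bessel \<xi>)"
    "\<And>j k. (\<integral>y. (g j k y)\<^sup>2 \<partial>torus) \<le> (norm (deriv_coef j k x))\<^sup>2"
    by metis
  have "represents_gradient x g"
    unfolding represents_gradient_def matrix_square_integrable_def using g(2) L2_perD[OF g(1)] by blast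
  moreover have "(\<Sum>j\<in>UNIV. \<Sum>k\<in>UNIV. \<integral>y. (g j k y)\<^sup>2 \<partial>torus) \<le> grad_square x"
    unfolding grad_square_def by (intro sum_mono g(3))
  ultimately show ?thesis using that g(1) by blast
qed

lemma trilinear_cong:
  assumes u: "fourth_integrable u" "fourth_integrable u'" and w: "fourth_integrable w" "fourth_integrable w'"
    and g: "matrix_square_integrable g" "matrix_square_integrable g'"
    and ae: "AE y in torus. u y = u' y" "AE y in torus. w y = w' y"
      "AE y in torus. \<forall>j k. g j k y = g' j k y"
  shows "trilinear u g w = trilinear u' g' w'"
  unfolding trilinear_def
proof (rule integral_cong_AE)
  show "AE x in torus. convect u g w x = convect u' g' w' x"
    using ae by eventually_elim (simp add: convect_def)
qed (use integrable_convect[OF u(1) w(1) g(1)] integrable_convect[OF u(2) w(2) g(2)] in auto)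

lemma trilinear_add:
  assumes "fourth_integrable u" "fourth_integrable u'" "fourth_integrable w" "fourth_integrable w'"
    and "matrix_square_integrable g" "matrix_square_integrable g'"
  shows "trilinear (\<lambda>x. u x + u' x) g w = trilinear u g w + trilinear u' g w"
    "trilinear u (\<lambda>j k x. g j k x + g' j k x) w = trilinear u g w + trilinear u g' w"
    "trilinear u g (\<lambda>x. w x + w' x) = trilinear u g w + trilinear u g w'"
proof -
  note i = integrable_convect
  have "convect (\<lambda>x. u x + u' x) g w = (\<lambda>x. convect u g w x + convect u' g w x)"
    "convect u (\<lambda>j k x. g j k x + g' j k x) w = (\<lambda>x. convect u g w x + convect u g' w x)"
    "convect u g (\<lambda>x. w x + w' x) = (\<lambda>x. convect u g w x + convect u g w' x)"
    by (simp_all add: fun_eq_iff convect_def sum.distrib[symmetric] algebra_simps)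
  then show "trilinear (\<lambda>x. u x + u' x) g w = trilinear u g w + trilinear u' g w"
    "trilinear u (\<lambda>j k x. g j k x + g' j k x) w = trilinear u g w + trilinear u g' w"
    "trilinear u g (\<lambda>x. w x + w' x) = trilinear u g w + trilinear u g w'"
    unfolding trilinear_def using assms by (simp_all add: i)
qed

lemma trilinear_scaleR:
  "trilinear (\<lambda>x. c *\<^sub>R u x) g w = c * trilinear u g w"
  "trilinear u (\<lambda>j k x. c * g j k x) w = c * trilinear u g w"
  "trilinear u g (\<lambda>x. c *\<^sub>R w x) = c * trilinear u g w"
proof -
  have "convect (\<lambda>x. c *\<^sub>R u x) g w = (\<lambda>x. c * convect u g w x)"
    "convect u (\<lambda>j k x. c * g j k x) w = (\<lambda>x. c * convect u g w x)"
    "convect u g (\<lambda>x. c *\<^sub>R w x) = (\<lambda>x. c * convect u g w x)"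
    by (simp_all add: fun_eq_iff convect_def sum_distrib_left mult_ac)
  then show "trilinear (\<lambda>x. c *\<^sub>R u x) g w = c * trilinear u g w"
    "trilinear u (\<lambda>j k x. c * g j k x) w = c * trilinear u g w"
    "trilinear u g (\<lambda>x. c *\<^sub>R w x) = c * trilinear u g w"
    unfolding trilinear_def by simp_all
qed


text \<open>The functions are chosen by \<open>SOME\<close>. Existence of velocities rests on the L4
  embedding, so the value is used only through \<open>conv_form_eq\<close>, which takes
  representatives as given and removes the dependence on the choice.\<close>

definition conv_form :: "'n::finite modes \<Rightarrow> 'n::finite modes \<Rightarrow> 'n::finite modes \<Rightarrow> real" where
  "conv_form x y z = trilinear (SOME u. represents_velocity x u) (SOME g. represents_gradient y g)
     (SOME w. represents_velocity z w)"

lemma conv_form_eq: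
  assumes "represents_velocity x u" "represents_gradient y g" "represents_velocity z w"
  shows "conv_form x y z = trilinear u g w"
proof -
  define u' where "u' = (SOME u. represents_velocity x u)"
  define g' where "g' = (SOME g. represents_gradient y g)"
  define w' where "w' = (SOME w. represents_velocity z w)"
  have r: "represents_velocity x u'" "represents_gradient y g'" "represents_velocity z w'"
    unfolding u'_def g'_def w'_def 
    using someI[of "represents_velocity x", OF assms(1)] someI[of "represents_gradient y", OF assms(2)]
      someI[of "represents_velocity z", OF assms(3)] by auto
  have "trilinear u' g' w' = trilinear u g w"
    using assms r represents_velocity_unique[OF r(1) assms(1)] represents_velocity_unique[OF r(3) assms(3)]
      represents_gradient_unique[OF r(2) assms(2)]
    by (intro trilinear_cong) (auto simp: represents_velocity_def represents_gradient_def)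
  then show ?thesis by (simp add: conv_form_def u'_def g'_def w'_def)
qed

section \<open>Correspondence between modes and distributions\<close>

definition encodes :: "'n::finite modes \<Rightarrow> 'n::finite distr^'n \<Rightarrow> bool" where
  "encodes x v \<longleftrightarrow> (\<forall>k. v $ k \<in> pdistr \<and> (\<forall>\<xi>. (v $ k) (cas \<xi>) = coef x (\<xi>, k) / bessel \<xi>))"

lemma encodes_unique: "encodes x v \<Longrightarrow> encodes x v' \<Longrightarrow> v = v'"
  unfolding encodes_def vec_eq_iff by (metis pdistr_eqI)

lemma encodes_H_vec:
  assumes "encodes x v"
  shows "v \<in> H_vec 1" "H_vec_norm 1 v = norm x"
  using assms H_vec_hartley_norm[of v 1 bessel x, OF _ powr_1_bessel] by (auto simp: encodes_def)

text \<open>Division by \<open>bessel\<close>, which is at least 1, keeps the families square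
  summable, so every component is even given by a square integrable function.\<close>

lemma encodes_exists: obtains v where "encodes x v"
proof -
  have "\<exists>g. g \<in> L2_per \<and> (\<forall>\<xi>. hcoef g \<xi> = coef x (\<xi>, k) / bessel \<xi>)" for k
  proof -
    have "(\<lambda>\<xi>. (coef x (\<xi>, k) / bessel \<xi>)\<^sup>2) summable_on UNIV"
    proof (rule summable_on_comparison_test)
      show "(\<lambda>\<xi>. \<Sum>k\<in>UNIV. (coef x (\<xi>, k))\<^sup>2) summable_on UNIV"
        using has_sum_modes_norm[of x] by (auto simp: summable_on_def)
      fix \<xi>
      have "(coef x (\<xi>, k) / bessel \<xi>)\<^sup>2 \<le> (coef x (\<xi>, k))\<^sup>2 / 1"
        unfolding power_divide using bessel_ge_1[of \<xi>] by (intro divide_left_mono) auto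
      also have "\<dots> \<le> (\<Sum>k\<in>UNIV. (coef x (\<xi>, k))\<^sup>2)"
        using member_le_sum[of k UNIV "\<lambda>k. (coef x (\<xi>, k))\<^sup>2"] by simp
      finally show "(coef x (\<xi>, k) / bessel \<xi>)\<^sup>2 \<le> (\<Sum>k\<in>UNIV. (coef x (\<xi>, k))\<^sup>2)" .
    qed simp
    from riesz_fischer[OF this] show ?thesis by blast
  qed
  then obtain g where g: "\<And>k. g k \<in> L2_per" "\<And>k \<xi>. hcoef (g k) \<xi> = coef x (\<xi>, k) / bessel \<xi>"
    by metis
  have "encodes x (\<chi> k. regular (g k))"
    unfolding encodes_def using regular_pdistr[OF L2_perD(4)[OF g(1)]] g(2) by (simp add: regular_cas)
  then show ?thesis by (rule that)
qed

lemma vel_space_divergence: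
  assumes v: "encodes x v" and x: "x \<in> vel_space" and \<phi>: "\<phi> \<in> test_fun"
  shows "(\<Sum>j\<in>UNIV. (v $ j) (partial j \<phi>)) = 0"
proof -
  have vp: "v $ k \<in> pdistr" for k using v by (simp add: encodes_def)
  define d where "d = (\<lambda>\<phi>\<in>test_fun. \<Sum>j\<in>UNIV. 1 * ddiff j (v $ j) \<phi>)"
  \<comment> \<open>The zero distribution, written as an empty combination so that
    \<open>pdistr_lincomb\<close> applies to it as well.\<close>
  define z where "z = (\<lambda>\<phi>\<in>test_fun. \<Sum>j\<in>{}. 0 * ddiff j (v $ j) \<phi>)"
  have dp: "d \<in> pdistr" and zp: "z \<in> pdistr"
    unfolding d_def z_def by (intro pdistr_lincomb ddiff_pdistr vp; simp)+
  have "d (cas \<xi>) = z (cas \<xi>)" for \<xi>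
  proof -
    have "d (cas \<xi>) = (\<Sum>j\<in>UNIV. 2 * pi / bessel \<xi> * (real_of_int ((- \<xi>) $ j) * coef x (- \<xi>, j)))"
      unfolding d_def using v by (simp add: test_fun_cas ddiff_cas[OF vp] encodes_def mult.assoc)
    also have "\<dots> = 2 * pi / bessel \<xi> * (\<Sum>j\<in>UNIV. real_of_int ((- \<xi>) $ j) * coef x (- \<xi>, j))"
      by (rule sum_distrib_left[symmetric])
    also have "(\<Sum>j\<in>UNIV. real_of_int ((- \<xi>) $ j) * coef x (- \<xi>, j)) = 0"
      using x unfolding vel_space_def by blast
    finally show ?thesis by (simp add: z_def test_fun_cas)
  qed
  then have "d \<phi> = z \<phi>" by (rule pdistr_eq_on_test_fun[OF dp zp _ \<phi>])
  then show ?thesis using \<phi> by (simp add: d_def z_def ddiff_def sum_negf)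
qed

lemma encodes_vel_space:
  assumes v: "encodes x v" and x: "x \<in> vel_space"
  shows "v \<in> H_vec_dot_sigma 1"
proof -
  have vp: "v $ k \<in> pdistr" for k using v by (simp add: encodes_def)
  have "fourier (v $ k) 0 = 0" for k
    unfolding fourier_hartley(2)[OF vp] using v x by (simp add: encodes_def vel_space_def)
  moreover have "div_distr v = (\<lambda>\<phi>\<in>test_fun. 0)"
    unfolding div_distr_def
    by (intro restrict_ext) (use vel_space_divergence[OF v x] in \<open>simp add: ddiff_def sum_negf\<close>)
  ultimately show ?thesis
    using encodes_H_vec(1)[OF v] by (simp add: H_vec_dot_sigma_def H_vec_dot_def)
qed

lemma H_vec_dot_sigma_encoded:
  assumes v: "v \<in> H_vec_dot_sigma 1"
  obtains x where "x \<in> vel_space" "encodes x v"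
proof -
  have vH: "v \<in> H_vec 1" using v by (simp add: H_vec_dot_sigma_def H_vec_dot_def)
  then have vp: "v $ k \<in> pdistr" for k by (simp add: H_vec_def)
  obtain x where x: "\<And>\<xi> k. coef x (\<xi>, k) = bessel \<xi> * (v $ k) (cas \<xi>)"
    using H_vec_hartley[OF vH powr_1_bessel] by (metis bessel_uminus)
  have enc: "encodes x v"
    unfolding encodes_def using vp by (simp add: x)
  have "fourier (v $ k) 0 = 0" for k using v by (simp add: H_vec_dot_sigma_def H_vec_dot_def)
  then have "coef x (0, k) = 0" for k using fourier_hartley(2)[OF vp, of k 0] by (simp add: x)
  moreover have "(\<Sum>k\<in>UNIV. real_of_int (\<xi> $ k) * coef x (\<xi>, k)) = 0" for \<xi>
  proof -
    \<comment> \<open>Tested at -xi, because differentiation reflects the frequency.\<close>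
    have "div_distr v (cas (- \<xi>)) = 0"
      using v by (simp add: H_vec_dot_sigma_def test_fun_cas)
    then have "(\<Sum>k\<in>UNIV. 2 * pi * (real_of_int (\<xi> $ k) * (v $ k) (cas \<xi>))) = 0"
      by (simp add: div_distr_def test_fun_cas ddiff_cas[OF vp] mult.assoc)
    then have "(\<Sum>k\<in>UNIV. real_of_int (\<xi> $ k) * (v $ k) (cas \<xi>)) = 0"
      by (simp add: sum_distrib_left[symmetric])
    moreover have "(\<Sum>k\<in>UNIV. real_of_int (\<xi> $ k) * coef x (\<xi>, k))
        = bessel \<xi> * (\<Sum>k\<in>UNIV. real_of_int (\<xi> $ k) * (v $ k) (cas \<xi>))"
      by (simp add: x sum_distrib_left mult.left_commute)
    ultimately show ?thesis by simp
  qed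
  ultimately have "x \<in> vel_space" by (simp add: vel_space_def)
  then show ?thesis using that enc by blast
qed

lemma grad_square_le:
  fixes x :: "'n::finite modes"
  shows "grad_square x \<le> (2 * pi * norm x)\<^sup>2"
proof (rule has_sum_mono[OF has_sum_grad_square])
  show "((\<lambda>\<xi>. (2 * pi)\<^sup>2 * (\<Sum>k\<in>UNIV. (coef x (\<xi>, k))\<^sup>2)) has_sum (2 * pi * norm x)\<^sup>2) UNIV"
    unfolding power_mult_distrib[of "2 * pi"] by (intro has_sum_cmult_right has_sum_modes_norm)
  fix \<xi> :: "int^'n"
  have "(2 * pi / bessel \<xi>)\<^sup>2 * (norm (freq \<xi>))\<^sup>2 = (2 * pi)\<^sup>2 * ((norm (freq \<xi>))\<^sup>2 / (1 + (norm (freq \<xi>))\<^sup>2))"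
    by (simp add: power_divide bessel_square)
  also have "\<dots> \<le> (2 * pi)\<^sup>2 * 1"
    by (intro mult_left_mono) (auto simp: divide_le_eq add_pos_nonneg)
  finally show "(2 * pi / bessel \<xi>)\<^sup>2 * (norm (freq \<xi>))\<^sup>2 * (\<Sum>k\<in>UNIV. (coef x (\<xi>, k))\<^sup>2)
      \<le> (2 * pi)\<^sup>2 * (\<Sum>k\<in>UNIV. (coef x (\<xi>, k))\<^sup>2)"
    by (intro mult_right_mono) (auto intro: sum_nonneg)
qed

section \<open>Bounds and antisymmetry of convection from the L4 embedding\<close>

locale L4_embedding =
  fixes C4 :: real and ty :: "'n::finite itself"
  assumes C4: "C4 > 0" and emb: "sobolev_L4_const ty C4"
begin

lemma velocity_exists:
  fixes x :: "'n::finite modes"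
  assumes v: "encodes x v"
  obtains u where "represents_velocity x u" "u \<in> L4_per" "\<And>k. regular (\<lambda>y. u y $ k) = v $ k"
    "root 4 (\<integral>y. norm (u y) ^ 4 \<partial>torus) \<le> C4 * norm x"
proof -
  obtain h where h: "h \<in> L4_per" "\<And>k. regular (\<lambda>y. h y $ k) = v $ k" "L4_norm h \<le> C4 * H_vec_norm 1 v"
    using emb encodes_H_vec(1)[OF v] unfolding sobolev_L4_const_def by metis
  have f: "fourth_integrable h"
    using h(1) by (simp add: fourth_integrable_def L4_per_def set_integrable_torus_cell)
  have "hcoef (\<lambda>y. h y $ k) \<xi> = coef x (\<xi>, k) / bessel \<xi>" for k \<xi>
    using v h(2)[of k] by (simp add: encodes_def regular_cas[symmetric])
  then have "represents_velocity x h" using f by (simp add: represents_velocity_def)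
  moreover have "root 4 (\<integral>y. norm (h y) ^ 4 \<partial>torus) \<le> C4 * norm x"
    using h(3) by (simp add: L4_norm_def set_integral_torus_cell encodes_H_vec(2)[OF v])
  ultimately show ?thesis using that h by blast
qed

lemma velocity_exists':
  fixes x :: "'n::finite modes"
  obtains u where "represents_velocity x u" "root 4 (\<integral>y. norm (u y) ^ 4 \<partial>torus) \<le> C4 * norm x"
  using encodes_exists velocity_exists by metis

text \<open>Each of the two velocities costs one factor \<open>C4\<close>. The gradient is left as
  it is, since the energy estimate controls that quantity directly; passing to the norm of y here
  would spoil the constant.\<close>

lemma abs_conv_form_le:
  fixes x y z :: "'n::finite modes"
  shows "\<bar>conv_form x y z\<bar> \<le> C4\<^sup>2 * norm x * norm z * sqrt (grad_square y)"
proof -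
  obtain u where u: "represents_velocity x u" "root 4 (\<integral>y. norm (u y) ^ 4 \<partial>torus) \<le> C4 * norm x"
    by (rule velocity_exists')
  obtain w where w: "represents_velocity z w" "root 4 (\<integral>y. norm (w y) ^ 4 \<partial>torus) \<le> C4 * norm z"
    by (rule velocity_exists')
  obtain g where g: "represents_gradient y g"
    "(\<Sum>j\<in>UNIV. \<Sum>k\<in>UNIV. \<integral>x. (g j k x)\<^sup>2 \<partial>torus) \<le> grad_square y"
    by (rule represents_gradient_exists)
  have "\<bar>conv_form x y z\<bar> = \<bar>trilinear u g w\<bar>" by (simp add: conv_form_eq[OF u(1) g(1) w(1)])
  also have "\<dots> \<le> root 4 (\<integral>x. norm (u x) ^ 4 \<partial>torus) * root 4 (\<integral>x. norm (w x) ^ 4 \<partial>torus) *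
    sqrt (\<Sum>j\<in>UNIV. \<Sum>k\<in>UNIV. \<integral>x. (g j k x)\<^sup>2 \<partial>torus)"
    using u(1) w(1) g(1)
    by (intro abs_trilinear_le) (auto simp: represents_velocity_def represents_gradient_def)
  also have "\<dots> \<le> (C4 * norm x) * (C4 * norm z) * sqrt (grad_square y)"
    using u(2) w(2) g(2) C4
    by (intro mult_mono) (auto simp: grad_square_nonneg intro!: sum_nonneg)
  finally show ?thesis by (simp add: power2_eq_square mult_ac)
qed

lemma conv_form_add:
  fixes x x' y y' z z' :: "'n::finite modes"
  shows "conv_form (x + x') y z = conv_form x y z + conv_form x' y z"
    "conv_form x (y + y') z = conv_form x y z + conv_form x y' z"
    "conv_form x y (z + z') = conv_form x y z + conv_form x y z'"
proof -
  obtain u u' w w' where r: "represents_velocity x u" "represents_velocity x' u'"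
    "represents_velocity z w" "represents_velocity z' w'"
    using velocity_exists' by metis
  obtain g g' where g: "represents_gradient y g" "represents_gradient y' g'"
    using represents_gradient_exists by metis
  note f = r[unfolded represents_velocity_def, THEN conjunct1] g[unfolded represents_gradient_def, THEN conjunct1]
  show "conv_form (x + x') y z = conv_form x y z + conv_form x' y z"
    unfolding conv_form_eq[OF represents_velocity_add[OF r(1,2)] g(1) r(3)]
      conv_form_eq[OF r(1) g(1) r(3)] conv_form_eq[OF r(2) g(1) r(3)]
    by (rule trilinear_add(1)[OF f])
  show "conv_form x (y + y') z = conv_form x y z + conv_form x y' z"
    unfolding conv_form_eq[OF r(1) represents_gradient_add[OF g] r(3)]
      conv_form_eq[OF r(1) g(1) r(3)] conv_form_eq[OF r(1) g(2) r(3)]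
    by (rule trilinear_add(2)[OF f])
  show "conv_form x y (z + z') = conv_form x y z + conv_form x y z'"
    unfolding conv_form_eq[OF r(1) g(1) represents_velocity_add[OF r(3,4)]]
      conv_form_eq[OF r(1) g(1) r(3)] conv_form_eq[OF r(1) g(1) r(4)]
    by (rule trilinear_add(3)[OF f])
qed

lemma conv_form_scaleR:
  fixes x y z :: "'n::finite modes"
  shows "conv_form (c *\<^sub>R x) y z = c * conv_form x y z"
    "conv_form x (c *\<^sub>R y) z = c * conv_form x y z"
    "conv_form x y (c *\<^sub>R z) = c * conv_form x y z"
proof -
  obtain u w where r: "represents_velocity x u" "represents_velocity z w"
    using velocity_exists' by metis
  obtain g where g: "represents_gradient y g" using represents_gradient_exists by metis
  show "conv_form (c *\<^sub>R x) y z = c * conv_form x y z"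
    unfolding conv_form_eq[OF represents_velocity_scaleR[OF r(1)] g r(2)] conv_form_eq[OF r(1) g r(2)]
    by (rule trilinear_scaleR)
  show "conv_form x (c *\<^sub>R y) z = c * conv_form x y z"
    unfolding conv_form_eq[OF r(1) represents_gradient_scaleR[OF g] r(2)] conv_form_eq[OF r(1) g r(2)]
    by (rule trilinear_scaleR)
  show "conv_form x y (c *\<^sub>R z) = c * conv_form x y z"
    unfolding conv_form_eq[OF r(1) g represents_velocity_scaleR[OF r(2)]] conv_form_eq[OF r(1) g r(2)]
    by (rule trilinear_scaleR)
qed

lemma conv_form_diff:
  fixes x x' y y' z :: "'n::finite modes"
  shows "conv_form (x - x') y z = conv_form x y z - conv_form x' y z"
    "conv_form x (y - y') z = conv_form x y z - conv_form x y' z"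
  using conv_form_add(1)[of x "(-1) *\<^sub>R x'" y z] conv_form_add(2)[of x y "(-1) *\<^sub>R y'" z]
  by (simp_all only: conv_form_scaleR) simp_all

text \<open>The bound may depend on the advecting field x, which is frozen in the linear
  problem.\<close>

lemma bounded_bilinear_conv_form:
  fixes x :: "'n::finite modes"
  shows "bounded_bilinear (conv_form x)"
proof (rule bounded_bilinear.intro)
  have "\<bar>conv_form x y z\<bar> \<le> norm y * norm z * (C4\<^sup>2 * norm x * (2 * pi))" for y z
  proof -
    have "sqrt (grad_square y) \<le> 2 * pi * norm y"
      using real_sqrt_le_mono[OF grad_square_le[of y]] by simp
    then have "C4\<^sup>2 * norm x * norm z * sqrt (grad_square y) \<le> C4\<^sup>2 * norm x * norm z * (2 * pi * norm y)"
      by (rule mult_left_mono) simp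
    then show ?thesis using abs_conv_form_le[of x y z] by (simp add: mult_ac)
  qed
  then show "\<exists>K. \<forall>y z. norm (conv_form x y z) \<le> norm y * norm z * K" by auto
qed (simp_all add: conv_form_add conv_form_scaleR)

text \<open>Only equal components interact, and the entry is the integral of (u . grad cas xi) cas
  eta; exchanging the two unit modes gives the other half of a product rule.\<close>

lemma conv_form_units:
  fixes x :: "'n::finite modes"
  assumes u: "represents_velocity x u"
  shows "conv_form x (ell2_unit (\<xi>, k)) (ell2_unit (\<eta>, l)) = (if k = l then
    (\<integral>y. (\<Sum>j\<in>UNIV. u y $ j * (partial j (cas \<xi>) y * cas \<eta> y)) \<partial>torus) / (bessel \<xi> * bessel \<eta>) else 0)"
proof -
  have "convect u (\<lambda>j m y. if m = k then partial j (cas \<xi>) y / bessel \<xi> else 0)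
      (\<lambda>y. axis l (cas \<eta> y / bessel \<eta>)) y = (if k = l then
      (\<Sum>j\<in>UNIV. u y $ j * (partial j (cas \<xi>) y * cas \<eta> y)) / (bessel \<xi> * bessel \<eta>) else 0)" for y
  proof -
    have "(\<Sum>m\<in>UNIV. u y $ j * (if m = k then partial j (cas \<xi>) y / bessel \<xi> else 0) * axis l (cas \<eta> y / bessel \<eta>) $ m)
        = (\<Sum>m\<in>UNIV. if m = k then (if k = l then
            u y $ j * (partial j (cas \<xi>) y * cas \<eta> y) / (bessel \<xi> * bessel \<eta>) else 0) else 0)" for j
      by (intro sum.cong refl) (auto simp: axis_def mult_ac)
    then show ?thesis by (simp add: convect_def sum_divide_distrib)
  qed
  then have "convect u (\<lambda>j m y. if m = k then partial j (cas \<xi>) y / bessel \<xi> else 0)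
      (\<lambda>y. axis l (cas \<eta> y / bessel \<eta>)) = (\<lambda>y. if k = l then
      (\<Sum>j\<in>UNIV. u y $ j * (partial j (cas \<xi>) y * cas \<eta> y)) / (bessel \<xi> * bessel \<eta>) else 0)" ..
  then show ?thesis
    unfolding conv_form_eq[OF u represents_gradient_unit represents_velocity_unit] trilinear_def
    by (simp only:) simp
qed

text \<open>By density it suffices to take basis fields \<open>y\<close> and \<open>z\<close>; there the claim is \<open>div x = 0\<close>, tested with the
  product of two basis functions.\<close>

lemma conv_form_antisym:
  fixes x y z :: "'n::finite modes"
  assumes x: "x \<in> vel_space"
  shows "conv_form x y z = - conv_form x z y"
proof -
  interpret bounded_bilinear "conv_form x" by (rule bounded_bilinear_conv_form)
  obtain v where v: "encodes x v" by (rule encodes_exists)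
  obtain u where u: "represents_velocity x u" "\<And>k. regular (\<lambda>y. u y $ k) = v $ k"
    using velocity_exists[OF v] by metis
  have f: "fourth_integrable u" using u(1) by (simp add: represents_velocity_def)
  have units: "conv_form x (ell2_unit i) (ell2_unit l) = - conv_form x (ell2_unit l) (ell2_unit i)" for i l
  proof (cases i, cases l)
    fix \<xi> k \<eta> k' assume il: "i = (\<xi>, k)" "l = (\<eta>, k')"
    define t where "t \<xi> \<eta> j y = u y $ j * (partial j (cas \<xi>) y * cas \<eta> y)" for \<xi> \<eta> j y
    have ti: "integrable torus (t \<xi> \<eta> j)" for \<xi> \<eta> j
      using integrable_torus_mult_test_fun[OF integrable_torus_mult_test_fun[OF fourth_integrable_component(2)[OF f]
            partial_test_fun[OF test_fun_cas]] test_fun_cas]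
      by (simp add: t_def[abs_def] mult.assoc)
    have test: "(\<lambda>y. cas \<xi> y * cas \<eta> y) \<in> test_fun"
    proof -
      have "(\<lambda>y. cas \<xi> y * cas \<eta> y) = (\<lambda>y. (1/2) * ((cas (\<xi> - \<eta>) y + cas (\<eta> - \<xi>) y + cas (\<xi> + \<eta>) y) - cas (- \<xi> - \<eta>) y))"
        by (simp add: cas_mult fun_eq_iff)
      also have "\<dots> \<in> test_fun"
        by (intro test_fun_cmult test_fun_diff test_fun_add test_fun_cas)
      finally show ?thesis .
    qed
    have "(\<integral>y. (\<Sum>j\<in>UNIV. t \<xi> \<eta> j y) \<partial>torus) + (\<integral>y. (\<Sum>j\<in>UNIV. t \<eta> \<xi> j y) \<partial>torus)
        = (\<Sum>j\<in>UNIV. (\<integral>y. t \<xi> \<eta> j y + t \<eta> \<xi> j y \<partial>torus))"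
      using ti by (simp add: sum.distrib)
    also have "\<dots> = (\<Sum>j\<in>UNIV. (v $ j) (partial j (\<lambda>y. cas \<xi> y * cas \<eta> y)))"
    proof (rule sum.cong[OF refl])
      fix j
      have "(v $ j) (partial j (\<lambda>y. cas \<xi> y * cas \<eta> y)) = (\<integral>y. u y $ j * partial j (\<lambda>y. cas \<xi> y * cas \<eta> y) y \<partial>torus)"
        unfolding u(2)[symmetric] by (rule regular_apply[OF partial_test_fun[OF test]])
      also have "\<dots> = (\<integral>y. t \<xi> \<eta> j y + t \<eta> \<xi> j y \<partial>torus)"
        by (simp add: partial_mult[OF differentiable_cas differentiable_cas] t_def algebra_simps)
      finally show "(\<integral>y. t \<xi> \<eta> j y + t \<eta> \<xi> j y \<partial>torus) = (v $ j) (partial j (\<lambda>y. cas \<xi> y * cas \<eta> y))" ..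
    qed
    also have "\<dots> = 0" by (rule vel_space_divergence[OF v x test])
    finally have "(\<integral>y. (\<Sum>j\<in>UNIV. t \<xi> \<eta> j y) \<partial>torus) = - (\<integral>y. (\<Sum>j\<in>UNIV. t \<eta> \<xi> j y) \<partial>torus)"
      by linarith
    then show ?thesis
      unfolding il conv_form_units[OF u(1)] t_def by (simp add: mult.commute)
  qed
  have "conv_form x y (ell2_unit l) = - conv_form x (ell2_unit l) y" for y l
    by (rule bounded_linear_ell2_eqI[OF bounded_linear_left bounded_linear_minus[OF bounded_linear_right] units])
  then show ?thesis
    by (rule bounded_linear_ell2_eqI[OF bounded_linear_right bounded_linear_minus[OF bounded_linear_left]])
qed

lemma conv_form_self: "x \<in> vel_space \<Longrightarrow> conv_form x y y = 0" for x y :: "'n::finite modes"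
  using conv_form_antisym[of x y y] by simp

text \<open>Hence the convection term has mean zero, which makes the equation solvable at frequency \<open>0\<close>.\<close>

lemma conv_form_constant:
  fixes x :: "'n::finite modes"
  assumes "x \<in> vel_space"
  shows "conv_form x y (ell2_unit (0, k)) = 0"
proof -
  obtain u where u: "represents_velocity x u" using velocity_exists' by metis
  obtain w where w: "represents_velocity y w" using velocity_exists' by metis
  have "conv_form x (ell2_unit (0, k)) y = 0"
    unfolding conv_form_eq[OF u represents_gradient_unit w] trilinear_def
    by (simp add: convect_def[abs_def] partial_cas if_distrib cong: if_cong)
  then show ?thesis using conv_form_antisym[OF assms, of y "ell2_unit (0, k)"] by simp
qed


section \<open>The weak problem\<close>

text \<open>Poincare's inequality bounds the norm of u by D / (sqrt 2 pi), where D is the L2 norm of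
  the gradient; one factor D then cancels. The equation is required only as tested with u itself,
  where the convection term drops out.\<close>

lemma weak_energy_estimate:
  fixes u z :: "'n::finite modes"
  assumes sym: "symmetric_tensor a" and ell: "relaxed_elliptic a C" and C: "C > 0"
    and u: "u \<in> vel_space" and eq: "stokes_form a u u = z \<bullet> u"
  shows "sqrt (grad_square u) \<le> sqrt 2 * C / pi * norm z"
proof -
  define D where "D = sqrt (grad_square u)"
  have D: "D \<ge> 0" "D\<^sup>2 = grad_square u" by (simp_all add: D_def grad_square_nonneg)
  have "sqrt (2 * pi\<^sup>2 * (norm u)\<^sup>2) \<le> D"
    unfolding D_def by (rule real_sqrt_le_mono[OF grad_square_poincare[OF u]])
  then have nu: "sqrt 2 * pi * norm u \<le> D" by (simp add: real_sqrt_mult)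
  have "D\<^sup>2 / 2 \<le> C * (z \<bullet> u)"
    using stokes_form_coercive[OF sym ell u] by (simp add: D eq)
  also have "\<dots> \<le> C * (norm z * norm u)"
    using C by (intro mult_left_mono norm_cauchy_schwarz) auto
  finally have "sqrt 2 * pi * (D\<^sup>2 / 2) \<le> sqrt 2 * pi * (C * (norm z * norm u))"
    by (intro mult_left_mono) auto
  also have "\<dots> = C * norm z * (sqrt 2 * pi * norm u)" by simp
  also have "\<dots> \<le> C * norm z * D" using nu C by (intro mult_left_mono) auto
  finally have *: "D * (sqrt 2 * pi / 2 * D) \<le> D * (C * norm z)"
    by (simp add: power2_eq_square mult_ac)
  have "sqrt 2 * pi / 2 * D \<le> C * norm z"
  proof (cases "D = 0")
    case True
    then show ?thesis using C by simp
  next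
    case False
    then show ?thesis using * D(1) by simp
  qed
  then have "sqrt 2 * (sqrt 2 * pi / 2 * D) \<le> sqrt 2 * (C * norm z)" by (intro mult_left_mono) auto
  moreover have "sqrt 2 * (sqrt 2 * pi / 2 * D) = pi * D"
    using real_sqrt_mult_self[of 2] by (simp add: field_simps)
  ultimately have "pi * D \<le> sqrt 2 * (C * norm z)" by linarith
  then show ?thesis unfolding D_def[symmetric] by (simp add: field_simps)
qed

text \<open>The energy bound for the linear problem does not depend on the advecting field, so the
  solution map is a contraction on all of \<open>vel_space\<close> and not merely on a ball; its
  fixed point is therefore unique among all weak solutions.\<close>

theorem weak_navier_stokes:
  fixes z :: "'n::finite modes"
  assumes sym: "symmetric_tensor a" and ell: "relaxed_elliptic a C" and C: "C > 0"
    and small: "norm z < pi ^ 3 / sqrt 2 * C powi (-2) * C4 powi (-2)"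
  shows "\<exists>!x. x \<in> vel_space \<and> (\<forall>w\<in>vel_space. stokes_form a x w + conv_form x x w = z \<bullet> w)"
proof -
  interpret A: bounded_bilinear "stokes_form a" by (rule bounded_bilinear_stokes_form)
  define \<alpha> where "\<alpha> = pi\<^sup>2 / C"
  have \<alpha>: "\<alpha> > 0" using C by (simp add: \<alpha>_def)
  have coer: "\<alpha> * (norm u)\<^sup>2 \<le> stokes_form a u u" if "u \<in> vel_space" for u
    using stokes_form_coercive[OF sym ell that] grad_square_poincare[OF that] C
    unfolding \<alpha>_def by (simp add: field_simps)
  have "\<exists>u\<in>vel_space. \<forall>w\<in>vel_space. stokes_form a u w + conv_form v u w = z \<bullet> w" if v: "v \<in> vel_space" for v
  proof (rule lax_milgram[OF subspace_vel_space closed_vel_space _ bounded_linear_inner_right \<alpha>])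
    show "bounded_bilinear (\<lambda>u w. stokes_form a u w + conv_form v u w)"
      by (intro bounded_bilinear_add_real bounded_bilinear_stokes_form bounded_bilinear_conv_form)
    show "\<alpha> * (norm u)\<^sup>2 \<le> stokes_form a u u + conv_form v u u" if "u \<in> vel_space" for u
      using coer[OF that] conv_form_self[OF v] by simp
  qed
  then obtain T where T: "\<And>v. v \<in> vel_space \<Longrightarrow> T v \<in> vel_space"
    "\<And>v w. v \<in> vel_space \<Longrightarrow> w \<in> vel_space \<Longrightarrow> stokes_form a (T v) w + conv_form v (T v) w = z \<bullet> w"
    by metis
  have est: "\<alpha> * (norm (u1 - u2))\<^sup>2 \<le> C4\<^sup>2 * norm (v1 - v2) * norm (u1 - u2) * (sqrt 2 * C / pi * norm z)"
    if v: "v1 \<in> vel_space" "v2 \<in> vel_space" and u: "u1 \<in> vel_space" "u2 \<in> vel_space"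
      and 1: "\<And>w. w \<in> vel_space \<Longrightarrow> stokes_form a u1 w + conv_form v1 u1 w = z \<bullet> w"
      and 2: "\<And>w. w \<in> vel_space \<Longrightarrow> stokes_form a u2 w + conv_form v2 u2 w = z \<bullet> w"
    for u1 u2 v1 v2
  proof -
    define w where "w = u1 - u2"
    have w: "w \<in> vel_space" unfolding w_def by (intro subspace_diff subspace_vel_space u)
    have g: "sqrt (grad_square u2) \<le> sqrt 2 * C / pi * norm z"
      by (rule weak_energy_estimate[OF sym ell C u(2)]) (use 2[OF u(2)] conv_form_self[OF v(2)] in simp)
    have "stokes_form a w w = stokes_form a u1 w - stokes_form a u2 w"
      by (simp add: w_def A.diff_left)
    also have "\<dots> = conv_form v2 u2 w - conv_form v1 u1 w" using 1[OF w] 2[OF w] by simp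
    \<comment> \<open>The intermediate term b(v1, u2, w) splits the difference so that the other
      part b(v1, w, w) has equal last arguments and vanishes.\<close>
    also have "\<dots> = - conv_form (v1 - v2) u2 w - conv_form v1 w w"
      by (simp add: w_def conv_form_diff)
    also have "\<dots> = - conv_form (v1 - v2) u2 w" using conv_form_self[OF v(1)] by simp
    finally have "\<alpha> * (norm w)\<^sup>2 \<le> \<bar>conv_form (v1 - v2) u2 w\<bar>" using coer[OF w] by linarith
    also have "\<dots> \<le> C4\<^sup>2 * norm (v1 - v2) * norm w * sqrt (grad_square u2)" by (rule abs_conv_form_le)
    also have "\<dots> \<le> C4\<^sup>2 * norm (v1 - v2) * norm w * (sqrt 2 * C / pi * norm z)"
      by (rule mult_left_mono[OF g]) simp
    finally show ?thesis by (simp add: w_def)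
  qed
  \<comment> \<open>The product of 1 / \<alpha> = C / pi^2, the factor \<open>C4\<^sup>2\<close> of
    the convection bound and the gradient bound sqrt 2 C / pi * |z|.\<close>
  define q where "q = sqrt 2 * C\<^sup>2 * C4\<^sup>2 / pi ^ 3 * norm z"
  have "norm z < pi ^ 3 / (sqrt 2 * C\<^sup>2 * C4\<^sup>2)"
    using small by (simp add: power_int_minus divide_inverse mult_ac)
  then have "q < 1" using C C4 by (simp add: q_def field_simps)
  have "q \<ge> 0" by (simp add: q_def)
  have contr: "norm (u1 - u2) \<le> q * norm (v1 - v2)"
    if "v1 \<in> vel_space" "v2 \<in> vel_space" "u1 \<in> vel_space" "u2 \<in> vel_space"
      "\<And>w. w \<in> vel_space \<Longrightarrow> stokes_form a u1 w + conv_form v1 u1 w = z \<bullet> w"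
      "\<And>w. w \<in> vel_space \<Longrightarrow> stokes_form a u2 w + conv_form v2 u2 w = z \<bullet> w"
    for u1 u2 v1 v2
  proof (cases "u1 = u2")
    case True
    then show ?thesis using \<open>q \<ge> 0\<close> by simp
  next
    case False
    then have pos: "norm (u1 - u2) > 0" by simp
    have "norm (u1 - u2) * (\<alpha> * norm (u1 - u2)) \<le>
        norm (u1 - u2) * (C4\<^sup>2 * norm (v1 - v2) * (sqrt 2 * C / pi * norm z))"
      using est[OF that] by (simp only: power2_eq_square mult_ac)
    then have "\<alpha> * norm (u1 - u2) \<le> C4\<^sup>2 * norm (v1 - v2) * (sqrt 2 * C / pi * norm z)"
      using pos by (simp only: mult_le_cancel_left_pos)
    then have "C / pi\<^sup>2 * (\<alpha> * norm (u1 - u2)) \<le> C / pi\<^sup>2 * (C4\<^sup>2 * norm (v1 - v2) * (sqrt 2 * C / pi * norm z))"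
      using C by (intro mult_left_mono) auto
    moreover have "C / pi\<^sup>2 * (\<alpha> * norm (u1 - u2)) = norm (u1 - u2)" using C by (simp add: \<alpha>_def)
    moreover have "C / pi\<^sup>2 * (C4\<^sup>2 * norm (v1 - v2) * (sqrt 2 * C / pi * norm z)) = q * norm (v1 - v2)"
      by (simp add: q_def power2_eq_square power3_eq_cube)
    ultimately show ?thesis by linarith
  qed
  \<comment> \<open>Equal advecting fields in \<open>contr\<close> show that the linear problem has
    only one solution, so a weak solution x coincides with the chosen \<open>T x\<close>.\<close>
  have fp: "T x = x \<longleftrightarrow> (\<forall>w\<in>vel_space. stokes_form a x w + conv_form x x w = z \<bullet> w)" if x: "x \<in> vel_space" for x
  proof
    assume "T x = x"
    then show "\<forall>w\<in>vel_space. stokes_form a x w + conv_form x x w = z \<bullet> w" using T(2)[OF x] by simp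
  next
    assume w: "\<forall>w\<in>vel_space. stokes_form a x w + conv_form x x w = z \<bullet> w"
    have "norm (T x - x) \<le> q * norm (x - x)"
      by (rule contr[OF x x T(1)[OF x] x]) (use w T(2)[OF x] in auto)
    then show "T x = x" by simp
  qed
  have "\<exists>!x. x \<in> vel_space \<and> T x = x"
  proof (rule Banach_fix[OF _ _ \<open>q \<ge> 0\<close> \<open>q < 1\<close>])
    show "complete (vel_space :: 'n::finite modes set)"
      using closed_vel_space by (simp add: complete_eq_closed)
    show "vel_space \<noteq> ({} :: 'n::finite modes set)" using subspace_vel_space subspace_0 by blast
    show "dist (T x) (T y) \<le> q * dist x y" if "x \<in> vel_space" "y \<in> vel_space" for x y
      unfolding dist_norm by (rule contr[OF that]) (use T that in auto)
  qed (use T(1) in auto)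
  then show ?thesis using fp by (metis (no_types, lifting))
qed

end


section \<open>The equation in terms of Hartley coefficients\<close>

lemma pdistr_lincomb2:
  assumes "g \<in> pdistr" "h \<in> pdistr"
  shows "(\<lambda>\<phi>\<in>test_fun. c * g \<phi> + d * h \<phi>) \<in> pdistr"
  using pdistr_lincomb[of "UNIV :: bool set" "\<lambda>b. if b then g else h" "\<lambda>b. if b then c else d"] assms
  by (simp add: UNIV_bool add.commute)

lemma strain_pdistr:
  assumes "\<And>k. u $ k \<in> pdistr"
  shows "strain u j \<beta> \<in> pdistr"
  using pdistr_lincomb2[OF ddiff_pdistr[OF assms] ddiff_pdistr[OF assms], of "1/2" j \<beta> "1/2" \<beta> j]
  by (simp add: strain_def distrib_left)

lemma stress_pdistr:
  assumes "\<And>k. u $ k \<in> pdistr"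
  shows "stress a u k \<alpha> \<in> pdistr"
proof -
  have "(\<lambda>\<phi>\<in>test_fun. \<Sum>p\<in>UNIV \<times> UNIV. a k (fst p) \<alpha> (snd p) * strain u (fst p) (snd p) \<phi>) \<in> pdistr"
    by (intro pdistr_lincomb strain_pdistr assms) simp
  then show ?thesis by (simp add: stress_def sum.cartesian_product split_def)
qed

lemma stokes_op_pdistr:
  assumes "\<And>k. u $ k \<in> pdistr"
  shows "stokes_op a u $ k \<in> pdistr"
  using pdistr_lincomb[of UNIV "\<lambda>\<alpha>. ddiff \<alpha> (stress a u k \<alpha>)" "\<lambda>_. 1"] ddiff_pdistr[OF stress_pdistr[OF assms]]
  by (simp add: stokes_op_def)

text \<open>The symmetry exchanging j and \<beta> makes the two halves of the strain contribute
  equally, so the factor 1/2 disappears and the full gradient remains.\<close>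

lemma stress_cas:
  assumes sym: "symmetric_tensor a" and u: "\<And>k. u $ k \<in> pdistr"
  shows "stress a u k \<alpha> (cas \<xi>) =
    (\<Sum>j\<in>UNIV. \<Sum>\<beta>\<in>UNIV. a k j \<alpha> \<beta> * (- 2 * pi * real_of_int (\<xi> $ \<beta>) * (u $ j) (cas (- \<xi>))))"
proof -
  define t where "t j \<beta> = - pi * real_of_int (\<xi> $ \<beta>) * (u $ j) (cas (- \<xi>))" for j \<beta>
  have "stress a u k \<alpha> (cas \<xi>) = (\<Sum>j\<in>UNIV. \<Sum>\<beta>\<in>UNIV. a k j \<alpha> \<beta> * t \<beta> j) + (\<Sum>j\<in>UNIV. \<Sum>\<beta>\<in>UNIV. a k j \<alpha> \<beta> * t j \<beta>)"
  proof -
    have "strain u j \<beta> (cas \<xi>) = t \<beta> j + t j \<beta>" for j \<beta>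
      by (simp add: strain_def test_fun_cas ddiff_cas[OF u] t_def field_simps)
    then show ?thesis by (simp add: stress_def test_fun_cas distrib_left sum.distrib)
  qed
  also have "(\<Sum>j\<in>UNIV. \<Sum>\<beta>\<in>UNIV. a k j \<alpha> \<beta> * t \<beta> j) = (\<Sum>\<beta>\<in>UNIV. \<Sum>j\<in>UNIV. a k \<beta> \<alpha> j * t \<beta> j)"
    by (subst sum.swap) (use sym in \<open>auto simp: symmetric_tensor_def intro!: sum.cong arg_cong2[where f = "(*)"]\<close>)
  finally show ?thesis by (simp add: t_def flip: sum.distrib) (simp add: algebra_simps)
qed

text \<open>Two derivatives reflect the frequency twice, so xi returns. The unit mode encodes cas xi
  / bessel xi in component k; the factor \<open>bessel \<xi>\<close> restores the test function, and
  the minus sign is that of one integration by parts.\<close>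

lemma stokes_op_cas:
  assumes sym: "symmetric_tensor a" and u: "encodes x u"
  shows "(stokes_op a u $ k) (cas \<xi>) = - bessel \<xi> * stokes_form a x (ell2_unit (\<xi>, k))"
proof -
  have up: "u $ k \<in> pdistr" and uc: "(u $ k) (cas \<xi>) = coef x (\<xi>, k) / bessel \<xi>" for k \<xi>
    using u by (auto simp: encodes_def)
  have "(stokes_op a u $ k) (cas \<xi>) = (\<Sum>\<alpha>\<in>UNIV. - 2 * pi * real_of_int (\<xi> $ \<alpha>) *
      (\<Sum>j\<in>UNIV. \<Sum>\<beta>\<in>UNIV. a k j \<alpha> \<beta> * (2 * pi * real_of_int (\<xi> $ \<beta>) * (coef x (\<xi>, j) / bessel \<xi>))))"
    by (simp add: stokes_op_def test_fun_cas ddiff_cas[OF stress_pdistr[OF up]] stress_cas[OF sym up] uc)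
  also have "\<dots> = (\<Sum>\<alpha>\<in>UNIV. \<Sum>j\<in>UNIV. \<Sum>\<beta>\<in>UNIV. - bessel \<xi> * (a k j \<alpha> \<beta> *
    ((2 * pi * real_of_int (\<xi> $ \<alpha>) / bessel \<xi>) * (2 * pi * real_of_int (\<xi> $ \<beta>) / bessel \<xi> * coef x (\<xi>, j)))))"
    unfolding sum_distrib_left by (intro sum.cong refl) (simp add: field_simps)
  also have "\<dots> = (\<Sum>j\<in>UNIV. \<Sum>\<alpha>\<in>UNIV. \<Sum>\<beta>\<in>UNIV. - bessel \<xi> * (a k j \<alpha> \<beta> *
    ((2 * pi * real_of_int (\<xi> $ \<alpha>) / bessel \<xi>) * (2 * pi * real_of_int (\<xi> $ \<beta>) / bessel \<xi> * coef x (\<xi>, j)))))"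
    by (rule sum.swap)
  also have "\<dots> = - bessel \<xi> * stokes_form a x (ell2_unit (\<xi>, k))"
    unfolding stokes_form_unit sum_distrib_left ..
  finally show ?thesis .
qed

text \<open>The representatives multiplied in \<open>convection\<close> agree almost everywhere with
  the L4 velocity of the embedding and the square integrable gradient. The product may be computed
  with these, and its coefficient is the trilinear form against one basis field.\<close>

lemma (in L4_embedding) convection_encoded:
  fixes x :: "'n::finite modes"
  assumes v: "encodes x v"
  shows "convection v $ k \<in> pdistr"
    "(convection v $ k) (cas \<xi>) = bessel \<xi> * conv_form x x (ell2_unit (\<xi>, k))"
proof -
  have vp: "v $ k \<in> pdistr" and vc: "(v $ k) (cas \<xi>) = coef x (\<xi>, k) / bessel \<xi>" for k \<xi>
    using v by (auto simp: encodes_def)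
  obtain u where u: "represents_velocity x u" "u \<in> L4_per" "\<And>k. regular (\<lambda>y. u y $ k) = v $ k"
    using velocity_exists[OF v] by metis
  obtain g where g: "represents_gradient x g" "\<And>j k. g j k \<in> L2_per"
    using represents_gradient_exists by metis
  have uf: "fourth_integrable u" using u(1) by (simp add: represents_velocity_def)
  have gm: "matrix_square_integrable g" using g(1) by (simp add: represents_gradient_def)
  have uL1: "(\<lambda>y. u y $ k) \<in> L1_per" for k
    using u(2) fourth_integrable_component[OF uf]
    by (auto simp: L1_per_def L4_per_def set_integrable_torus_cell periodic_def)
  have dg: "ddiff j (v $ k) = regular (g j k)" for j k
  proof (rule pdistr_eqI)
    show "ddiff j (v $ k) \<in> pdistr" by (rule ddiff_pdistr[OF vp])
    show "regular (g j k) \<in> pdistr" by (rule regular_pdistr[OF L2_perD(4)[OF g(2)]])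
    show "ddiff j (v $ k) (cas \<xi>) = regular (g j k) (cas \<xi>)" for \<xi>
      using g(1) by (simp add: ddiff_cas[OF vp] vc regular_cas represents_gradient_def)
  qed
  define F where "F y = (\<Sum>j\<in>UNIV. fun_of (v $ j) y * fun_of (ddiff j (v $ k)) y)" for y
  define H where "H y = (\<Sum>j\<in>UNIV. u y $ j * g j k y)" for y
  have Fm: "F \<in> borel_measurable borel"
    unfolding F_def dg unfolding u(3)[symmetric]
    by (intro borel_measurable_sum borel_measurable_times fun_of_regular(1) uL1 L2_per_L1_per g(2))
  have ae: "AE y in torus. F y = H y"
  proof -
    have "AE y in torus. \<forall>j. fun_of (v $ j) y = u y $ j \<and> fun_of (ddiff j (v $ k)) y = g j k y"
      unfolding AE_all_countable
    proof
      fix j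
      show "AE y in torus. fun_of (v $ j) y = u y $ j \<and> fun_of (ddiff j (v $ k)) y = g j k y"
        unfolding dg unfolding u(3)[symmetric]
        using fun_of_regular(3)[OF uL1] fun_of_regular(3)[OF L2_per_L1_per[OF g(2)]]
        by (intro AE_conjI)
    qed
    then show ?thesis by eventually_elim (simp add: F_def H_def)
  qed
  \<comment> \<open>A constant field as third factor: integrability of a velocity times a gradient
    is a special case of the trilinear one.\<close>
  have const: "fourth_integrable (\<lambda>y::real^'n. axis k 1)" by (simp add: fourth_integrable_def)
  have "integrable torus (\<lambda>y. u y $ j * g j k y * axis k 1 $ k)" for j
    by (rule integrable_convect_entry[OF uf const matrix_square_integrableD(1,2)[OF gm]])
  then have Hi: "integrable torus H"
    unfolding H_def by (intro Bochner_Integration.integrable_sum) (simp add: axis_def)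
  have Hm: "H \<in> borel_measurable borel"
    unfolding H_def using fourth_integrable_component(1)[OF uf] matrix_square_integrableD(1)[OF gm]
    by (intro borel_measurable_sum borel_measurable_times)
  have Fi: "integrable torus F"
    using Hi by (rule integrable_cong_AE_imp) (use ae Fm in auto)
  have cv: "convection v $ k = regular F"
    by (simp add: convection_def F_def[abs_def])
  show "convection v $ k \<in> pdistr" unfolding cv by (rule regular_pdistr[OF Fi])
  have "(convection v $ k) (cas \<xi>) = (\<integral>y. F y * cas \<xi> y \<partial>torus)"
    unfolding cv regular_cas hcoef_def ..
  also have "\<dots> = (\<integral>y. H y * cas \<xi> y \<partial>torus)"
  proof (rule integral_cong_AE)
    show "AE y in torus. F y * cas \<xi> y = H y * cas \<xi> y" using ae by eventually_elim simp
  qed (use Fm Hm in measurable)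
  also have "\<dots> = bessel \<xi> * (\<integral>y. convect u g (\<lambda>y. axis k (cas \<xi> y / bessel \<xi>)) y \<partial>torus)"
  proof -
    have "convect u g (\<lambda>y. axis k (cas \<xi> y / bessel \<xi>)) y = H y * cas \<xi> y / bessel \<xi>" for y
    proof -
      have "(\<Sum>m\<in>UNIV. u y $ j * g j m y * axis k (cas \<xi> y / bessel \<xi>) $ m)
          = (\<Sum>m\<in>UNIV. if m = k then u y $ j * g j k y * (cas \<xi> y / bessel \<xi>) else 0)" for j
        by (intro sum.cong refl) (auto simp: axis_def)
      then show ?thesis by (simp add: convect_def H_def sum_distrib_right sum_divide_distrib)
    qed
    then show ?thesis by simp
  qed
  also have "\<dots> = bessel \<xi> * conv_form x x (ell2_unit (\<xi>, k))"
    unfolding conv_form_eq[OF u(1) g(1) represents_velocity_unit] trilinear_def ..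
  finally show "(convection v $ k) (cas \<xi>) = bessel \<xi> * conv_form x x (ell2_unit (\<xi>, k))" .
qed

text \<open>All terms are periodic distributions, so testing with the basis suffices. On the left
  stands the residual of the weak form at a unit mode, on the right the coefficient of the pressure
  gradient.\<close>

lemma (in L4_embedding) navier_stokes_modes:
  fixes x z :: "'n::finite modes"
  assumes sym: "symmetric_tensor a" and u: "encodes x u" and p: "p \<in> pdistr"
    and f: "\<And>k. f $ k \<in> pdistr" "\<And>\<xi> k. coef z (\<xi>, k) = 1 / bessel \<xi> * (f $ k) (cas \<xi>)"
  shows "navier_stokes a f u p \<longleftrightarrow>
    (\<forall>\<xi> k. bessel \<xi> * (coef z (\<xi>, k) - stokes_form a x (ell2_unit (\<xi>, k)) - conv_form x x (ell2_unit (\<xi>, k)))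
      = - 2 * pi * real_of_int (\<xi> $ k) * p (cas (- \<xi>)))"
    (is "_ \<longleftrightarrow> ?modes")
proof -
  have up: "u $ k \<in> pdistr" for k using u by (simp add: encodes_def)
  define L where "L k = (\<lambda>\<phi>\<in>test_fun. 1 * (\<lambda>\<phi>\<in>test_fun. (-1) * (stokes_op a u $ k) \<phi> + 1 * ddiff k p \<phi>) \<phi>
      + 1 * (convection u $ k) \<phi>)" for k
  have L: "L k \<in> pdistr" for k
    unfolding L_def by (intro pdistr_lincomb2 stokes_op_pdistr up ddiff_pdistr p convection_encoded(1)[OF u])
  have Le: "L k \<phi> = - (stokes_op a u $ k) \<phi> + ddiff k p \<phi> + (convection u $ k) \<phi>" if "\<phi> \<in> test_fun" for k \<phi>
    using that by (simp add: L_def)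
  have "navier_stokes a f u p \<longleftrightarrow> (\<forall>k. \<forall>\<phi>\<in>test_fun. L k \<phi> = (f $ k) \<phi>)"
    unfolding navier_stokes_def using Le by simp
  also have "\<dots> \<longleftrightarrow> (\<forall>k \<xi>. L k (cas \<xi>) = (f $ k) (cas \<xi>))"
    using pdistr_eq_on_test_fun[OF L f(1)] test_fun_cas by blast
  also have "\<dots> \<longleftrightarrow> ?modes"
  proof -
    have Lc: "L k (cas \<xi>) = bessel \<xi> * stokes_form a x (ell2_unit (\<xi>, k)) - 2 * pi * real_of_int (\<xi> $ k) * p (cas (- \<xi>))
        + bessel \<xi> * conv_form x x (ell2_unit (\<xi>, k))" for k \<xi>
      by (simp add: Le[OF test_fun_cas] stokes_op_cas[OF sym u] ddiff_cas[OF p] convection_encoded(2)[OF u])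
    have fc: "(f $ k) (cas \<xi>) = bessel \<xi> * coef z (\<xi>, k)" for k \<xi> by (simp add: f(2))
    have "L k (cas \<xi>) = (f $ k) (cas \<xi>) \<longleftrightarrow>
        bessel \<xi> * (coef z (\<xi>, k) - stokes_form a x (ell2_unit (\<xi>, k)) - conv_form x x (ell2_unit (\<xi>, k)))
          = - 2 * pi * real_of_int (\<xi> $ k) * p (cas (- \<xi>))" for k \<xi>
      unfolding Lc fc by (auto simp: algebra_simps)
    then show ?thesis by blast
  qed
  finally show ?thesis .
qed

section \<open>Recovery and uniqueness of the pressure\<close>

text \<open>The part d of the amplitude orthogonal to xi is itself the amplitude of a
  divergence-free field living on this single frequency, and testing R with that field gives |d|^2 =
  0. It is the frequency-wise form of the fact that functionals vanishing on divergence-free fields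
  are gradients.\<close>

lemma orthogonal_vel_space_parallel:
  fixes R :: "'n::finite modes"
  assumes R: "\<And>w. w \<in> vel_space \<Longrightarrow> R \<bullet> w = 0" and \<xi>: "\<xi> \<noteq> 0"
  shows "coef R (\<xi>, k) = real_of_int (\<xi> $ k) * ((\<Sum>l\<in>UNIV. real_of_int (\<xi> $ l) * coef R (\<xi>, l)) / (norm (freq \<xi>))\<^sup>2)"
proof -
  define \<mu> where "\<mu> = (\<Sum>l\<in>UNIV. real_of_int (\<xi> $ l) * coef R (\<xi>, l)) / (norm (freq \<xi>))\<^sup>2"
  define d where "d k = coef R (\<xi>, k) - real_of_int (\<xi> $ k) * \<mu>" for k
  have N: "(norm (freq \<xi>))\<^sup>2 = (\<Sum>l\<in>UNIV. real_of_int (\<xi> $ l) * real_of_int (\<xi> $ l))"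
    unfolding power2_norm_eq_inner by (simp add: inner_vec_def)
  have "(norm (freq \<xi>))\<^sup>2 \<noteq> 0" using norm_freq_ge_1[OF \<xi>] by auto
  then have perp: "(\<Sum>l\<in>UNIV. real_of_int (\<xi> $ l) * d l) = 0"
    unfolding d_def right_diff_distrib sum_subtractf mult.assoc[symmetric] sum_distrib_right[symmetric]
      N[symmetric] \<mu>_def by simp
  define w where "w = (\<Sum>l\<in>UNIV. d l *\<^sub>R ell2_unit (\<xi>, l))"
  have cw: "coef w (\<eta>, m) = (if \<eta> = \<xi> then d m else 0)" for \<eta> m
  proof -
    have "coef w (\<eta>, m) = (\<Sum>l\<in>UNIV. if l = m then (if \<eta> = \<xi> then d m else 0) else 0)"
      unfolding w_def coef_sum by (intro sum.cong refl) (auto simp: coef_ell2_unit)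
    then show ?thesis by simp
  qed
  have "w \<in> vel_space"
    unfolding vel_space_def
  proof (intro CollectI conjI allI)
    show "coef w (0, m) = 0" for m using \<xi> by (simp add: cw)
    show "(\<Sum>k\<in>UNIV. real_of_int (\<eta> $ k) * coef w (\<eta>, k)) = 0" for \<eta>
      using perp by (cases "\<eta> = \<xi>") (simp_all add: cw)
  qed
  then have "R \<bullet> w = 0" by (rule R)
  then have "(\<Sum>l\<in>UNIV. d l * coef R (\<xi>, l)) = 0"
    by (simp add: w_def inner_sum_right inner_ell2_unit)
  moreover have "(\<Sum>l\<in>UNIV. d l * coef R (\<xi>, l)) = (\<Sum>l\<in>UNIV. d l * d l) + \<mu> * (\<Sum>l\<in>UNIV. real_of_int (\<xi> $ l) * d l)"
    unfolding sum_distrib_left sum.distrib[symmetric] by (intro sum.cong refl) (simp add: d_def algebra_simps)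
  ultimately have "(\<Sum>l\<in>UNIV. d l * d l) = 0" using perp by simp
  then have "d k = 0" by (simp add: sum_nonneg_eq_0_iff)
  then show ?thesis by (simp add: d_def \<mu>_def)
qed

text \<open>With amplitude \<mu> xi of R, the equation dictates the pressure coefficient -bessel
  \<mu> / (2 pi) at the opposite frequency. It is square summable since |R(xi)|^2 = |xi|^2 \<mu>^2
  and 1 + |xi|^2 \<le> 4 pi^2 |xi|^2 off frequency 0: undoing one derivative absorbs the
  weight.\<close>

lemma pressure_exists:
  fixes R :: "'n::finite modes"
  assumes R: "\<And>w. w \<in> vel_space \<Longrightarrow> R \<bullet> w = 0" and R0: "\<And>k. coef R (0, k) = 0"
  obtains p where "p \<in> H_dot 0" "\<And>\<xi> k. bessel \<xi> * coef R (\<xi>, k) = - 2 * pi * real_of_int (\<xi> $ k) * p (cas (- \<xi>))"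
proof -
  \<comment> \<open>At frequency 0 the quotient is 0 by the convention for division by zero, which
    gives the pressure mean zero.\<close>
  define \<mu> where "\<mu> \<xi> = (\<Sum>l\<in>UNIV. real_of_int (\<xi> $ l) * coef R (\<xi>, l)) / (norm (freq \<xi>))\<^sup>2" for \<xi>
  have par: "coef R (\<xi>, k) = real_of_int (\<xi> $ k) * \<mu> \<xi>" for \<xi> k
    using orthogonal_vel_space_parallel[OF R, of \<xi> k] R0[of k] by (cases "\<xi> = 0") (auto simp: \<mu>_def)
  define c where "c \<xi> = - bessel \<xi> * \<mu> (- \<xi>) / (2 * pi)" for \<xi>
  have le: "(c (- \<xi>))\<^sup>2 \<le> (\<Sum>k\<in>UNIV. (coef R (\<xi>, k))\<^sup>2)" for \<xi>
  proof (cases "\<xi> = 0")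
    case True
    then show ?thesis by (simp add: c_def \<mu>_def sum_nonneg)
  next
    case False
    define N where "N = (norm (freq \<xi>))\<^sup>2"
    have N1: "N \<ge> 1" using norm_freq_ge_1[OF False] by (simp add: N_def)
    have "(\<Sum>k\<in>UNIV. (coef R (\<xi>, k))\<^sup>2) = N * (\<mu> \<xi>)\<^sup>2"
      unfolding par N_def power2_norm_eq_inner
      by (simp add: inner_vec_def power_mult_distrib sum_distrib_right power2_eq_square[of "real_of_int _"])
    moreover have "(c (- \<xi>))\<^sup>2 = (1 + N) / (2 * pi)\<^sup>2 * (\<mu> \<xi>)\<^sup>2"
      by (simp add: c_def power_mult_distrib power_divide bessel_square N_def)
    moreover have "(1 + N) / (2 * pi)\<^sup>2 \<le> N"
    proof -
      have "2\<^sup>2 \<le> (2 * pi)\<^sup>2" using pi_gt3 by (intro power_mono) auto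
      then have "2 \<le> (2 * pi)\<^sup>2" by simp
      then have "N * 2 \<le> N * (2 * pi)\<^sup>2" using N1 by (intro mult_left_mono) auto
      then have "1 + N \<le> N * (2 * pi)\<^sup>2" using N1 by linarith
      then show ?thesis by (simp add: divide_le_eq)
    qed
    moreover from this have "(1 + N) / (2 * pi)\<^sup>2 * (\<mu> \<xi>)\<^sup>2 \<le> N * (\<mu> \<xi>)\<^sup>2"
      by (rule mult_right_mono) simp
    ultimately show ?thesis by (simp only:)
  qed
  have "(\<lambda>\<xi>. \<Sum>k\<in>UNIV. (coef R (\<xi>, k))\<^sup>2) summable_on UNIV"
    using has_sum_modes_norm[of R] by (auto simp: summable_on_def)
  then have "(\<lambda>\<xi>. (c (- \<xi>))\<^sup>2) summable_on UNIV"
    by (rule summable_on_comparison_test[OF _ le]) simp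
  then have c2: "(\<lambda>\<xi>. (c \<xi>)\<^sup>2) summable_on UNIV"
    using summable_on_uminus_iff[of "\<lambda>\<xi>. (c \<xi>)\<^sup>2"] by simp
  obtain g where g: "g \<in> L2_per" "\<And>\<xi>. hcoef g \<xi> = c \<xi>" using riesz_fischer[OF c2] by blast
  define p where "p = regular g"
  have pp: "p \<in> pdistr" unfolding p_def by (rule regular_pdistr[OF L2_perD(4)[OF g(1)]])
  have pc: "p (cas \<xi>) = c \<xi>" for \<xi> by (simp add: p_def regular_cas g(2))
  have "sobolev_term 0 p summable_on UNIV"
  proof -
    have "(\<lambda>\<xi>. ((c \<xi>)\<^sup>2 + (c (- \<xi>))\<^sup>2) * (1/2)) summable_on UNIV"
      using c2 summable_on_uminus_iff[of "\<lambda>\<xi>. (c \<xi>)\<^sup>2"]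
      by (intro summable_on_cmult_left summable_on_add) auto
    moreover have "sobolev_term 0 p \<xi> = ((c \<xi>)\<^sup>2 + (c (- \<xi>))\<^sup>2) * (1/2)" for \<xi>
    proof -
      have "1 + (norm (freq \<xi>))\<^sup>2 \<noteq> 0" using zero_le_power2[of "norm (freq \<xi>)"] by linarith
      then show ?thesis by (simp add: sobolev_term_def fourier_hartley(1)[OF pp] pc)
    qed
    ultimately show ?thesis by presburger
  qed
  moreover have "fourier p 0 = 0"
    unfolding fourier_hartley(2)[OF pp] pc by (simp add: c_def \<mu>_def)
  ultimately have "p \<in> H_dot 0" using pp by (simp add: H_dot_def H_per_def)
  moreover have "bessel \<xi> * coef R (\<xi>, k) = - 2 * pi * real_of_int (\<xi> $ k) * p (cas (- \<xi>))" for \<xi> k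
    unfolding pc par c_def by simp
  ultimately show ?thesis by (rule that)
qed

text \<open>The converse, for uniqueness: a gradient has amplitudes parallel to the frequency, and
  those of a divergence-free field are orthogonal to it.\<close>

lemma parallel_orthogonal_vel_space:
  fixes R :: "'n::finite modes"
  assumes R: "\<And>\<xi> k. bessel \<xi> * coef R (\<xi>, k) = - 2 * pi * real_of_int (\<xi> $ k) * p (cas (- \<xi>))"
    and w: "w \<in> vel_space"
  shows "R \<bullet> w = 0"
proof (rule has_sum_unique[OF has_sum_modes])
  have "(\<Sum>k\<in>UNIV. coef R (\<xi>, k) * coef w (\<xi>, k)) = 0" for \<xi>
  proof -
    have "coef R (\<xi>, k) = - 2 * pi * p (cas (- \<xi>)) / bessel \<xi> * real_of_int (\<xi> $ k)" for k
      using R[of \<xi> k] by (simp add: field_simps)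
    then have "(\<Sum>k\<in>UNIV. coef R (\<xi>, k) * coef w (\<xi>, k)) =
        - 2 * pi * p (cas (- \<xi>)) / bessel \<xi> * (\<Sum>k\<in>UNIV. real_of_int (\<xi> $ k) * coef w (\<xi>, k))"
      unfolding sum_distrib_left by (intro sum.cong refl) simp
    moreover have "(\<Sum>k\<in>UNIV. real_of_int (\<xi> $ k) * coef w (\<xi>, k)) = 0"
      using w unfolding vel_space_def by blast
    ultimately show ?thesis by simp
  qed
  then show "((\<lambda>\<xi>. \<Sum>k\<in>UNIV. coef R (\<xi>, k) * coef w (\<xi>, k)) has_sum 0) UNIV" by simp
qed

text \<open>A nonzero frequency has a nonzero component by which the equation can be divided;
  frequency 0 is fixed by the mean value condition.\<close>

lemma H_dot_pressure_unique:
  assumes p: "p \<in> H_dot 0" "q \<in> H_dot 0"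
    and eq: "\<And>\<xi> k. real_of_int (\<xi> $ k) * p (cas (- \<xi>)) = real_of_int (\<xi> $ k) * q (cas (- \<xi>))"
  shows "p = q"
proof (rule pdistr_eqI)
  show pp: "p \<in> pdistr" "q \<in> pdistr" using p by (auto simp: H_dot_def H_per_def)
  fix \<xi> :: "int^'a"
  show "p (cas \<xi>) = q (cas \<xi>)"
  proof (cases "\<xi> = 0")
    case True
    then show ?thesis using p fourier_hartley(2)[OF pp(1), of 0] fourier_hartley(2)[OF pp(2), of 0]
      by (simp add: H_dot_def)
  next
    case False
    then obtain k where "\<xi> $ k \<noteq> 0" by (auto simp: vec_eq_iff)
    then show ?thesis using eq[of "- \<xi>" k] by simp
  qed
qed

section \<open>Existence and uniqueness of velocity and pressure\<close>

theorem theorem6p2: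
  fixes a :: "'n::finite tensor"
    and f :: "'n distr^'n"
    and C_A C4 :: real
  assumes dim: "CARD('n) \<in> {2, 3, 4}"
    and sym: "symmetric_tensor a"
    and C_A: "C_A > 0" and ell: "relaxed_elliptic a C_A"
    and C4: "C4 > 0" and emb: "sobolev_L4_const TYPE('n) C4"
    and f: "f \<in> H_vec_dot (-1)"
    and small: "H_vec_norm (-1) f < pi ^ 3 / sqrt 2 * C_A powi (-2) * C4 powi (-2)"
  shows "\<exists>!(u, p) \<in> H_vec_dot_sigma 1 \<times> H_dot 0. navier_stokes a f u p"
proof -
  interpret L4_embedding C4 "TYPE('n)" by unfold_locales (fact C4 emb)+
  have fH: "f \<in> H_vec (-1)" and f0: "fourier (f $ k) 0 = 0" for k
    using f by (auto simp: H_vec_dot_def)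
  have fp: "f $ k \<in> pdistr" for k using fH by (simp add: H_vec_def)
  obtain z :: "'n::finite modes"
    where z: "\<And>\<xi> k. coef z (\<xi>, k) = 1 / bessel \<xi> * (f $ k) (cas \<xi>)" "H_vec_norm (-1) f = norm z"
    using H_vec_hartley[OF fH powr_minus_1_bessel] by auto
  have "norm z < pi ^ 3 / sqrt 2 * C_A powi (-2) * C4 powi (-2)" using small z(2) by simp
  from weak_navier_stokes[OF sym ell C_A this]
  obtain x where x: "x \<in> vel_space" "\<And>w. w \<in> vel_space \<Longrightarrow> stokes_form a x w + conv_form x x w = z \<bullet> w"
    and uniq: "\<And>y. y \<in> vel_space \<Longrightarrow> (\<And>w. w \<in> vel_space \<Longrightarrow> stokes_form a y w + conv_form y y w = z \<bullet> w) \<Longrightarrow> y = x"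
    by blast
  \<comment> \<open>Represented on the whole space and not only on \<open>vel_space\<close>: the
    coefficients of R are the residuals at all unit modes, and the pressure lives in the directions
    outside \<open>vel_space\<close>.\<close>
  have residual: "\<exists>R. \<forall>w. z \<bullet> w - stokes_form a y w - conv_form y y w = R \<bullet> w" for y
  proof -
    have "bounded_linear (\<lambda>w. z \<bullet> w - stokes_form a y w - conv_form y y w)"
      by (intro bounded_linear_sub bounded_linear_inner_right
          bounded_bilinear.bounded_linear_right[OF bounded_bilinear_stokes_form]
          bounded_bilinear.bounded_linear_right[OF bounded_bilinear_conv_form])
    from riesz_representation[OF subspace_UNIV closed_UNIV this] show ?thesis by blast
  qed
  obtain R where R: "\<And>w. z \<bullet> w - stokes_form a x w - conv_form x x w = R \<bullet> w" using residual by blast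
  have Rc: "coef R (\<xi>, k) = coef z (\<xi>, k) - stokes_form a x (ell2_unit (\<xi>, k)) - conv_form x x (ell2_unit (\<xi>, k))" for \<xi> k
    using R[of "ell2_unit (\<xi>, k)"] by (simp add: inner_ell2_unit)
  \<comment> \<open>At frequency 0 all three terms vanish: the force has mean zero, the Stokes
    multiplier is 0, and convection by a divergence-free field has mean zero.\<close>
  have "coef R (0, k) = 0" for k
    using f0[of k] fourier_hartley(2)[OF fp]
    by (simp add: Rc z(1) conv_form_constant[OF x(1)] stokes_form_unit)
  moreover have "R \<bullet> w = 0" if "w \<in> vel_space" for w
    using R[of w] x(2)[OF that] by simp
  ultimately obtain p where p: "p \<in> H_dot 0"
    "\<And>\<xi> k. bessel \<xi> * coef R (\<xi>, k) = - 2 * pi * real_of_int (\<xi> $ k) * p (cas (- \<xi>))"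
    using pressure_exists by metis
  have pp: "q \<in> pdistr" if "q \<in> H_dot 0" for q :: "'n distr" using that by (simp add: H_dot_def H_per_def)
  obtain u where u: "encodes x u" by (rule encodes_exists)
  have sol: "navier_stokes a f u p"
    unfolding navier_stokes_modes[OF sym u pp[OF p(1)] fp z(1)] using p(2) by (simp add: Rc)
  have unique: "u' = u \<and> p' = p"
    if u': "u' \<in> H_vec_dot_sigma 1" and p': "p' \<in> H_dot 0" and ns: "navier_stokes a f u' p'" for u' p'
  proof -
    obtain y where y: "y \<in> vel_space" "encodes y u'" using H_vec_dot_sigma_encoded[OF u'] by blast
    obtain Q where Q: "\<And>w. z \<bullet> w - stokes_form a y w - conv_form y y w = Q \<bullet> w" using residual by blast
    have Qc: "coef Q (\<xi>, k) = coef z (\<xi>, k) - stokes_form a y (ell2_unit (\<xi>, k)) - conv_form y y (ell2_unit (\<xi>, k))" for \<xi> k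
      using Q[of "ell2_unit (\<xi>, k)"] by (simp add: inner_ell2_unit)
    have modes: "bessel \<xi> * coef Q (\<xi>, k) = - 2 * pi * real_of_int (\<xi> $ k) * p' (cas (- \<xi>))" for \<xi> k
      using ns unfolding navier_stokes_modes[OF sym y(2) pp[OF p'] fp z(1)] Qc by blast
    have "y = x"
    proof (rule uniq[OF y(1)])
      fix w :: "'n::finite modes" assume "w \<in> vel_space"
      then have "Q \<bullet> w = 0" by (rule parallel_orthogonal_vel_space[OF modes])
      then show "stokes_form a y w + conv_form y y w = z \<bullet> w" using Q[of w] by simp
    qed
    then have "u' = u" using encodes_unique[OF y(2)] u by blast
    moreover have "p' = p"
    proof (rule H_dot_pressure_unique[OF p' p(1)])
      fix \<xi> k
      have "coef Q (\<xi>, k) = coef R (\<xi>, k)" using \<open>y = x\<close> by (simp add: Qc Rc)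
      then show "real_of_int (\<xi> $ k) * p' (cas (- \<xi>)) = real_of_int (\<xi> $ k) * p (cas (- \<xi>))"
        using modes[of \<xi> k] p(2)[of \<xi> k] by auto
    qed
    ultimately show ?thesis by blast
  qed
  show ?thesis
  proof (rule ex1I[of _ "(u, p)"], goal_cases)
    case 1
    show ?case using sol encodes_vel_space[OF u x(1)] p(1) by simp
  next
    case (2 q)
    then show ?case using unique by (cases q) auto
  qed
qed

end
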